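(* Let $H$ be an $(n+1)\times n$ integer matrix of rank $n$ in reduced Hermite normal form, and let $b\in\mathbb{Z}^{n+1}$ be such that $P(H,b)$ is a simplex. Let $\Delta=\Delta(H)$ and let $\Delta(H,b)$ be the maximum absolute value of the $n\times n$ minors of the augmented matrix $(H\,b)$. Then the problem of computing $\mathrm{width}(P(H,b))$ and a flat direction of $P(H,b)$ can be solved by an algorithm with complexity $$O\bigl(\log\Delta\cdot n^5\cdot\Delta^3\cdot\Delta(H,b)\cdot\mathrm{mult}(n^3\log\Delta(H,b)+n^3\log n)\bigr).$$
   Context: $P(H,b)=\{x\in\mathbb{R}^n : Hx\le b\}$. For an integer matrix $A$, $\Delta_k(A)$ is the greatest absolute value of the determinants of all $k\times k$ submatrices of $A$, and $\Delta(A)=\Delta_{\mathrm{rank}(A)}(A)$. The width of a convex body $P\subset\mathbb{R}^n$ is $\mathrm{width}(P)=\min_{c\in\mathbb{Z}^n\setminus\{0\}}\bigl(\max_{x\in P}c^\top x-\min_{x\in P}c^\top x\bigr)$; a vector $c\in\mathbb{Z}^n\setminus\{0\}$ attaining this minimum is a flat direction of $P$. Reduced Hermite normal form: write $H_B$ for the $n\times n$ matrix of the first $n$ rows of $H$. $H$ is in reduced Hermite normal form if $H_B$ is non-singular and lower triangular, $0\le H_{ij}<H_{ii}$ for all $1\le j<i\le n$, and there is $s\in\{0,\dots,n\}$ with $H_{ii}=1$ for $i\le s$ and $H_{ii}\ge 2$ for $s<i\le n$ (so the first $s$ rows of $H_B$ are those of the identity matrix). $\mathrm{mult}(k)$ is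 the bit complexity of multiplying two integers of bit size $k$.
   Formalization: The factor log Δ is read as max(1, log₂ Δ), because for Δ = 1 the literal bound is 0, which no algorithm can meet; n ≥ 1 is assumed, since no nonzero integer direction exists for n = 0. *)

theory Defs
  imports
    Complex_Main
    "HOL-Library.Log_Nat"
    "Jordan_Normal_Form.Determinant"
    "Jordan_Normal_Form.DL_Rank"
    "Jordan_Normal_Form.DL_Submatrix"
begin

section \<open>Simplices, width and flat directions\<close>

text \<open>The dimension has to vary inside the statement (one algorithm serves all dimensions), so
  real n-space is \<^term>\<open>carrier_vec n\<close>.\<close>

definition polyhedron :: "int mat \<Rightarrow> int vec \<Rightarrow> real vec set" where
  "polyhedron H b =
     {x \<in> carrier_vec (dim_col H). map_mat real_of_int H *\<^sub>v x \<le> map_vec real_of_int b}"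

definition affinely_independent :: "nat \<Rightarrow> real vec set \<Rightarrow> bool" where
  "affinely_independent n V \<longleftrightarrow> finite V \<and> V \<subseteq> carrier_vec n \<and>
     (\<forall>u. (\<Sum>v\<in>V. u v) = 0 \<and> (\<forall>i<n. (\<Sum>v\<in>V. u v * v $ i) = 0) \<longrightarrow> (\<forall>v\<in>V. u v = (0::real)))"

text \<open>Only used for finite sets of points.\<close>

definition finite_convex_hull :: "nat \<Rightarrow> real vec set \<Rightarrow> real vec set" where
  "finite_convex_hull n V =
     {vec n (\<lambda>i. \<Sum>v\<in>V. u v * v $ i) |u. (\<forall>v\<in>V. 0 \<le> u v) \<and> (\<Sum>v\<in>V. u v) = 1}"

definition is_simplex :: "nat \<Rightarrow> real vec set \<Rightarrow> bool" where
  "is_simplex n P \<longleftrightarrow>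
     (\<exists>V. V \<noteq> {} \<and> affinely_independent n V \<and> P = finite_convex_hull n V)"

definition nonzero_int_vecs :: "nat \<Rightarrow> int vec set" where
  "nonzero_int_vecs n = carrier_vec n - {0\<^sub>v n}"

definition width_along :: "real vec set \<Rightarrow> int vec \<Rightarrow> real" where
  "width_along P c =
     (SUP x\<in>P. map_vec real_of_int c \<bullet> x) - (INF x\<in>P. map_vec real_of_int c \<bullet> x)"

text \<open>The infimum is a minimum exactly if a flat direction exists.\<close>

definition lattice_width :: "nat \<Rightarrow> real vec set \<Rightarrow> real" where
  "lattice_width n P = (INF c\<in>nonzero_int_vecs n. width_along P c)"

definition flat_direction :: "nat \<Rightarrow> real vec set \<Rightarrow> int vec \<Rightarrow> bool" where
  "flat_direction n P c \<longleftrightarrow> c \<in> nonzero_int_vecs n \<and> width_along P c = lattice_width n P"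


section \<open>Integer matrices\<close>

definition int_rank :: "int mat \<Rightarrow> nat" where
  "int_rank A = vec_space.rank (dim_row A) (map_mat rat_of_int A)"

definition max_minor :: "nat \<Rightarrow> int mat \<Rightarrow> int" where
  "max_minor k A = Max {\<bar>det (submatrix A I J)\<bar> |I J.
     I \<subseteq> {..<dim_row A} \<and> card I = k \<and> J \<subseteq> {..<dim_col A} \<and> card J = k}"

definition Delta :: "int mat \<Rightarrow> int" where
  "Delta A = max_minor (int_rank A) A"

definition augmented :: "int mat \<Rightarrow> int vec \<Rightarrow> int mat" where
  "augmented H b = mat (dim_row H) (dim_col H + 1)
     (\<lambda>(i, j). if j < dim_col H then H $$ (i, j) else b $ i)"

definition Delta_aug :: "int mat \<Rightarrow> int vec \<Rightarrow> int" where
  "Delta_aug H b = max_minor (dim_col H) (augmented H b)"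

text \<open>Rows and columns are indexed from 0.\<close>

definition reduced_hnf :: "int mat \<Rightarrow> bool" where
  "reduced_hnf H \<longleftrightarrow> (let n = dim_col H in
     n \<le> dim_row H \<and>
     det (mat n n (\<lambda>(i, j). H $$ (i, j))) \<noteq> 0 \<and>
     (\<forall>i j. i < j \<and> j < n \<longrightarrow> H $$ (i, j) = 0) \<and>
     (\<forall>i j. j < i \<and> i < n \<longrightarrow> 0 \<le> H $$ (i, j) \<and> H $$ (i, j) < H $$ (i, i)) \<and>
     (\<exists>s\<le>n. (\<forall>i<s. H $$ (i, i) = 1) \<and> (\<forall>i. s \<le> i \<and> i < n \<longrightarrow> 2 \<le> H $$ (i, i))))"


section \<open>Bit complexity\<close>

text \<open>The machine model is the random access machine with logarithmic cost (Cook and Reckhow),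
  with structured control flow instead of jumps: registers hold integers, the only arithmetic is
  addition and subtraction, and every instruction is charged the bit lengths of the registers it
  reads (a constant is charged its own bit length). Multiplication is not an instruction, so that
  the bit complexity of multiplication is itself a running time on this machine.
  Indirect addresses below zero refer to register 0.\<close>

type_synonym memory = "nat \<Rightarrow> int"

datatype program =
    Skip
  | Const nat int
  | Add nat nat nat
  | Sub nat nat nat
  | Load nat nat
  | Store nat nat
  | Seq program program
  | IfPos nat program program
  | WhilePos nat program

definition bit_size :: "int \<Rightarrow> nat" where
  "bit_size x = nat (bitlen \<bar>x\<bar>)"

definition log_cost :: "int \<Rightarrow> nat" where
  "log_cost x = max 1 (bit_size x)"

text \<open>\<open>exec p m t m'\<close>: started in memory \<open>m\<close>, the program \<open>p\<close> halts with memory \<open>m'\<close> at total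
  cost \<open>t\<close>.\<close>

inductive exec :: "program \<Rightarrow> memory \<Rightarrow> nat \<Rightarrow> memory \<Rightarrow> bool" where
  Skip: "exec Skip m 1 m"
| Const: "exec (Const i a) m (log_cost a) (m(i := a))"
| Add: "exec (Add i j k) m (log_cost (m j) + log_cost (m k)) (m(i := m j + m k))"
| Sub: "exec (Sub i j k) m (log_cost (m j) + log_cost (m k)) (m(i := m j - m k))"
| Load: "exec (Load i j) m (log_cost (m j) + log_cost (m (nat (m j)))) (m(i := m (nat (m j))))"
| Store: "exec (Store i j) m (log_cost (m i) + log_cost (m j)) (m(nat (m i) := m j))"
| Seq: "exec p m t m' \<Longrightarrow> exec q m' t' m'' \<Longrightarrow> exec (Seq p q) m (t + t') m''"
| IfTrue: "m i > 0 \<Longrightarrow> exec p m t m' \<Longrightarrow> exec (IfPos i p q) m (log_cost (m i) + t) m'"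
| IfFalse: "m i \<le> 0 \<Longrightarrow> exec q m t m' \<Longrightarrow> exec (IfPos i p q) m (log_cost (m i) + t) m'"
| WhileTrue: "m i > 0 \<Longrightarrow> exec p m t m' \<Longrightarrow> exec (WhilePos i p) m' t' m'' \<Longrightarrow>
    exec (WhilePos i p) m (log_cost (m i) + t + t') m''"
| WhileFalse: "m i \<le> 0 \<Longrightarrow> exec (WhilePos i p) m (log_cost (m i)) m"

definition input_memory :: "int list \<Rightarrow> memory" where
  "input_memory xs = (\<lambda>i. if i < length xs then xs ! i else 0)"

definition multiplication_program :: "program \<Rightarrow> bool" where
  "multiplication_program M \<longleftrightarrow>
     (\<forall>x y. \<exists>t m. exec M (input_memory [x, y]) t m \<and> m 0 = x * y)"

text \<open>Worst-case cost of the multiplication program on integers of bit size at most \<open>k\<close>.\<close>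

definition mult_time :: "program \<Rightarrow> nat \<Rightarrow> nat" where
  "mult_time M k = Max {t. \<exists>x y m. bit_size x \<le> k \<and> bit_size y \<le> k \<and>
     exec M (input_memory [x, y]) t m}"

text \<open>The dimension, then the matrix row by row, then the right-hand side.\<close>

definition encode_instance :: "int mat \<Rightarrow> int vec \<Rightarrow> int list" where
  "encode_instance H b =
     int (dim_col H) # concat (map list_of_vec (rows H)) @ list_of_vec b"

text \<open>Output convention: the width is the fraction of registers 0 and 1, and a flat direction is in
  the registers from 2 on.\<close>

definition width_output :: "nat \<Rightarrow> real vec set \<Rightarrow> memory \<Rightarrow> bool" where
  "width_output n P m \<longleftrightarrow>
     m 1 > 0 \<and> lattice_width n P = real_of_int (m 0) / real_of_int (m 1) \<and>
     flat_direction n P (vec n (\<lambda>i. m (2 + i)))"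

end

(* Let y_k > 0 be the coefficients of the linear dependency of the rows h_k of H (maximal minors of H)
   and beta = sum_k y_k b_k. The slack of facet j at the opposite vertex is beta / y_j, so the width
   along c = sum_k t_k h_k is beta * (max_k t_k / y_k - min_k t_k / y_k). The row h_k itself gives
   beta / y_k. A direction that beats all rows has t_k / y_k within a window shorter than every 1 / y_k,
   hence it is determined by the residues of the t_k modulo 1 and by the row j where t_k / y_k is
   least. The residues form the group of integer vectors modulo the rows of the triangular block,
   of order D = det H_B <= Delta, so D (n + 1) candidates remain.

   All products are computed by repeated addition and all quotients by repeated subtraction. This takes
   O((n Delta)^3) instructions on integers bounded by a polynomial in n, Delta and Delta(H,b), which is
   already within the bound without the multiplication factor: of that only mult_time >= 1 is used. *)

theory Submission
  imports Defs
begin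

section \<open>Executions on bounded memories\<close>

text \<open>The coefficients \<open>t_k\<close> of a direction are not unique: a multiple of the
  dependency shifts all ratios equally and leaves the width unchanged. Normalising
  \<open>t_n = 0\<close> puts 0 into the window of ratios, so a window shorter than every
  \<open>1 / y_k\<close> forces \<open>|t_k| < 1\<close>; each entry is one of two representatives
  of its residue, and the least ratio decides between them. To stay in integers the code works with
  \<open>D * t_k\<close>, which are integers by the adjugate of the triangular block, and compares
  fractions by cross multiplication. The zero direction is enumerated too; demanding a positive
  spread of ratios excludes it. The other difficulty is the machine: addresses in a program are
  constants, but the input starts at register 0 and the output has to end there. So the instance is
  moved away, or shown not to collide with the variables, and at the end the result overwrites the
  very registers that control its delivery. The cost is an instruction count times one word length.
  That length grows logarithmically and is paid for by \<open>max 1 (log 2 (Delta H))\<close>, one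
  factor \<open>n\<close> and the factor \<open>Delta_aug H b\<close>.\<close>

lemma exec_deterministic: "exec p m t m1 \<Longrightarrow> exec p m t' m2 \<Longrightarrow> t = t' \<and> m1 = m2"
proof (induction arbitrary: t' m2 rule: exec.induct)
  case (Seq p m t m' q t'' m'')
  from Seq.prems show ?case by (cases rule: exec.cases) (auto dest!: Seq.IH)
next
  case (WhileTrue m i p t m' t'' m'')
  from WhileTrue.prems show ?case
    using WhileTrue.hyps by (cases rule: exec.cases) (auto dest!: WhileTrue.IH)
next
  case (IfTrue m i p t m' q)
  from IfTrue.prems show ?case
    using IfTrue.hyps by (cases rule: exec.cases) (auto dest!: IfTrue.IH)
next
  case (IfFalse m i q t m' p)
  from IfFalse.prems show ?case
    using IfFalse.hyps by (cases rule: exec.cases) (auto dest!: IfFalse.IH)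
qed (erule exec.cases; auto)+

section \<open>Costs of single instructions and the multiplication time\<close>

lemma log_cost_ge_1: "1 \<le> log_cost x"
  by (simp add: log_cost_def)

lemma exec_cost_pos: "exec p m t m' \<Longrightarrow> 1 \<le> t"
  by (induction rule: exec.induct) (use log_cost_ge_1 in \<open>auto intro: add_increasing2 trans_le_add1\<close>)

lemma finite_bit_size_le: "finite {x. bit_size x \<le> k}"
proof (rule finite_subset)
  show "{x. bit_size x \<le> k} \<subseteq> {- (2 ^ k) .. 2 ^ k}"
  proof
    fix x assume "x \<in> {x. bit_size x \<le> k}"
    then have "bitlen \<bar>x\<bar> \<le> int k" by (simp add: bit_size_def)
    moreover have "\<bar>x\<bar> < 2 ^ nat (bitlen \<bar>x\<bar>)"
      by (cases "x = 0") (use bitlen_bounds[of "\<bar>x\<bar>"] in auto)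
    moreover have "(2::int) ^ nat (bitlen \<bar>x\<bar>) \<le> 2 ^ k"
      using calculation by (intro power_increasing) auto
    ultimately have "\<bar>x\<bar> \<le> 2 ^ k" by linarith
    then show "x \<in> {- (2 ^ k) .. 2 ^ k}" by auto
  qed
qed simp

lemma mult_time_ge_1:
  assumes "multiplication_program M"
  shows "1 \<le> mult_time M k"
proof -
  define S where "S = {t. \<exists>x y m. bit_size x \<le> k \<and> bit_size y \<le> k \<and>
     exec M (input_memory [x, y]) t m}"
  define f where "f = (\<lambda>(x, y). THE t. \<exists>m. exec M (input_memory [x, y]) t m)"
  have "S \<subseteq> f ` ({x. bit_size x \<le> k} \<times> {x. bit_size x \<le> k})"
  proof
    fix t assume "t \<in> S"
    then obtain x y m where *: "bit_size x \<le> k" "bit_size y \<le> k"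
      "exec M (input_memory [x, y]) t m" unfolding S_def by blast
    have "f (x, y) = t" unfolding f_def
      using *(3) by (auto intro!: the_equality dest: exec_deterministic)
    then show "t \<in> f ` ({x. bit_size x \<le> k} \<times> {x. bit_size x \<le> k})" using * by force
  qed
  then have fin: "finite S"
    by (rule finite_subset) (intro finite_imageI finite_cartesian_product finite_bit_size_le)
  obtain t m where t: "exec M (input_memory [0, 0]) t m"
    using assms unfolding multiplication_program_def by blast
  have "t \<in> S" unfolding S_def using t by (auto intro!: exI[of _ 0] simp: bit_size_def bitlen_def floorlog_def)
  then have "t \<le> Max S" using fin by simp
  moreover have "mult_time M k = Max S" by (simp add: mult_time_def S_def)
  ultimately show ?thesis using exec_cost_pos[OF t] by simp
qed

lemma log_cost_mono: "\<bar>x\<bar> \<le> B \<Longrightarrow> log_cost x \<le> log_cost B"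
  unfolding log_cost_def bit_size_def bitlen_def
  by (intro max.mono order.refl nat_mono) (auto intro: floorlog_mono)

section \<open>Total correctness with a cost budget\<close>

text \<open>The factor 2 covers instructions that read two registers, so one unit pays for any
  single instruction.\<close>

definition word_cost :: "int \<Rightarrow> int" where
  "word_cost B = 2 * int (log_cost B)"

definition bounded_memory :: "int \<Rightarrow> memory \<Rightarrow> bool" where
  "bounded_memory B m \<longleftrightarrow> (\<forall>a. \<bar>m a\<bar> \<le> B)"

text \<open>The budget \<open>T\<close> counts instructions, each charged
  \<open>word_cost B\<close>. Boundedness is a premise here and not a part of \<open>Q\<close>:
  proofs may assume at any moment that all registers respect \<open>B\<close> and have to check only
  newly written values.\<close>

definition runs :: "int \<Rightarrow> program \<Rightarrow> memory \<Rightarrow> int \<Rightarrow> (memory \<Rightarrow> bool) \<Rightarrow> bool" where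
  "runs B p m T Q \<longleftrightarrow> (bounded_memory B m \<longrightarrow>
     (\<exists>t m'. exec p m t m' \<and> int t \<le> T * word_cost B \<and> bounded_memory B m' \<and> Q m'))"

lemma word_cost_pos: "0 < word_cost B"
  using log_cost_ge_1[of B] by (simp add: word_cost_def)

lemma word_cost_mono: "1 \<le> T \<Longrightarrow> x \<le> word_cost B \<Longrightarrow> x \<le> T * word_cost B"
  using word_cost_pos[of B] mult_right_mono[of 1 T "word_cost B"] by linarith

lemma log_cost_le_word:
  "bounded_memory B m \<Longrightarrow> int (log_cost (m i)) \<le> word_cost B"
  "bounded_memory B m \<Longrightarrow> int (log_cost (m i)) + int (log_cost (m j)) \<le> word_cost B"
  using log_cost_mono[of "m i" B] log_cost_mono[of "m j" B]
  by (auto simp: bounded_memory_def word_cost_def)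

lemma runs_atom:
  assumes "exec p m t (m(i := v))" "\<bar>v\<bar> \<le> B" "1 \<le> T" "Q (m(i := v))"
    "bounded_memory B m \<Longrightarrow> int t \<le> word_cost B"
  shows "runs B p m T Q"
  unfolding runs_def
proof
  assume bd: "bounded_memory B m"
  moreover have "bounded_memory B (m(i := v))" using bd assms(2) by (auto simp: bounded_memory_def)
  ultimately show "\<exists>t m'. exec p m t m' \<and> int t \<le> T * word_cost B \<and> bounded_memory B m' \<and> Q m'"
    using assms word_cost_mono[OF assms(3)] by blast
qed

lemma runs_Skip: "Q m \<Longrightarrow> 1 \<le> T \<Longrightarrow> runs B Skip m T Q"
  unfolding runs_def
  by (intro impI exI[of _ 1] exI[of _ m] conjI exec.Skip word_cost_mono)
    (use word_cost_pos[of B] in auto)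

lemma runs_Const: "\<bar>a\<bar> \<le> B \<Longrightarrow> Q (m(i := a)) \<Longrightarrow> 1 \<le> T \<Longrightarrow> runs B (Const i a) m T Q"
  by (rule runs_atom[OF exec.Const]) (use log_cost_mono[of a B] in \<open>auto simp: word_cost_def\<close>)

lemma runs_Add:
  "\<bar>m j + m k\<bar> \<le> B \<Longrightarrow> Q (m(i := m j + m k)) \<Longrightarrow> 1 \<le> T \<Longrightarrow> runs B (Add i j k) m T Q"
  by (rule runs_atom[OF exec.Add]) (auto intro: log_cost_le_word)

lemma runs_Sub:
  "\<bar>m j - m k\<bar> \<le> B \<Longrightarrow> Q (m(i := m j - m k)) \<Longrightarrow> 1 \<le> T \<Longrightarrow> runs B (Sub i j k) m T Q"
  by (rule runs_atom[OF exec.Sub]) (auto intro: log_cost_le_word)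

lemma runs_bounded: "(bounded_memory B m \<Longrightarrow> runs B p m T Q) \<Longrightarrow> runs B p m T Q"
  unfolding runs_def by blast

lemma runs_Load:
  "Q (m(i := m (nat (m j)))) \<Longrightarrow> 1 \<le> T \<Longrightarrow> runs B (Load i j) m T Q"
  by (rule runs_bounded, rule runs_atom[OF exec.Load])
    (auto intro: log_cost_le_word simp: bounded_memory_def)

lemma runs_Store:
  "Q (m(nat (m i) := m j)) \<Longrightarrow> 1 \<le> T \<Longrightarrow> runs B (Store i j) m T Q"
  by (rule runs_bounded, rule runs_atom[OF exec.Store])
    (auto intro: log_cost_le_word simp: bounded_memory_def)

text \<open>The postcondition of \<open>p\<close> is the triple for the rest of the program with the
  remaining budget, so a program is executed symbolically from left to right without intermediate
  assertions.\<close>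

lemma runs_Seq:
  assumes "runs B p m c (\<lambda>m'. runs B q m' (T - c) Q)"
  shows "runs B (Seq p q) m T Q"
  unfolding runs_def
proof
  assume "bounded_memory B m"
  then obtain t m' where 1: "exec p m t m'" "int t \<le> c * word_cost B" "bounded_memory B m'"
    "runs B q m' (T - c) Q" using assms unfolding runs_def by blast
  then obtain t' m'' where 2: "exec q m' t' m''" "int t' \<le> (T - c) * word_cost B"
    "bounded_memory B m''" "Q m''" unfolding runs_def by blast
  have "int (t + t') \<le> T * word_cost B" using 1 2 by (simp add: algebra_simps)
  then show "\<exists>t m'. exec (Seq p q) m t m' \<and> int t \<le> T * word_cost B \<and> bounded_memory B m' \<and> Q m'"
    using exec.Seq[OF 1(1) 2(1)] 2 by blast
qed

lemma runs_IfPos: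
  assumes "m i > 0 \<Longrightarrow> runs B p m (T - 1) Q" "m i \<le> 0 \<Longrightarrow> runs B q m (T - 1) Q"
  shows "runs B (IfPos i p q) m T Q"
  unfolding runs_def
proof
  assume bd: "bounded_memory B m"
  have c: "int (log_cost (m i)) \<le> word_cost B" using bd by (rule log_cost_le_word)
  show "\<exists>t m'. exec (IfPos i p q) m t m' \<and> int t \<le> T * word_cost B \<and> bounded_memory B m' \<and> Q m'"
  proof (cases "m i > 0")
    case True
    then obtain t m' where "exec p m t m'" "int t \<le> (T - 1) * word_cost B" "bounded_memory B m'" "Q m'"
      using assms(1) bd unfolding runs_def by blast
    moreover from this c have "int (log_cost (m i) + t) \<le> T * word_cost B" by (simp add: algebra_simps)
    ultimately show ?thesis using True by (blast intro: exec.IfTrue)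
  next
    case False
    then obtain t m' where "exec q m t m'" "int t \<le> (T - 1) * word_cost B" "bounded_memory B m'" "Q m'"
      using assms(2) bd unfolding runs_def by force
    moreover from this c have "int (log_cost (m i) + t) \<le> T * word_cost B" by (simp add: algebra_simps)
    ultimately show ?thesis using False by (force intro: exec.IfFalse)
  qed
qed

lemma runs_mono:
  "runs B p m c Q \<Longrightarrow> c \<le> T \<Longrightarrow> (\<And>m'. Q m' \<Longrightarrow> Q' m') \<Longrightarrow> runs B p m T Q'"
  unfolding runs_def using word_cost_pos[of B]
  by (meson mult_right_mono order.trans less_imp_le)

text \<open>The index \<open>k\<close> bounds the number of passes still to come. A pass costs its
  body and one test; the extra 1 is the test that ends the loop.\<close>

lemma runs_While:
  assumes "Inv k m"
    "\<And>k m. Inv k m \<Longrightarrow> m r > 0 \<Longrightarrow> 0 < k \<and> runs B p m c (Inv (k - 1))"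
    "\<And>k m. Inv k m \<Longrightarrow> m r \<le> 0 \<Longrightarrow> Q m"
    "1 + int k * (c + 1) \<le> T" "0 \<le> c"
  shows "runs B (WhilePos r p) m T Q"
proof -
  have "runs B (WhilePos r p) m (1 + int k * (c + 1)) Q" using assms(1)
  proof (induction k arbitrary: m)
    case 0
    then have "m r \<le> 0" using assms(2) by force
    then have "exec (WhilePos r p) m (log_cost (m r)) m" "Q m"
      using 0 assms(3) by (auto intro: exec.WhileFalse)
    then show ?case unfolding runs_def using log_cost_le_word(1)
      by (auto intro!: exI[of _ "log_cost (m r)"] exI[of _ m])
  next
    case (Suc k)
    show ?case
    proof (cases "m r > 0")
      case False
      then have "exec (WhilePos r p) m (log_cost (m r)) m" "Q m"
        using Suc assms(3) by (force intro: exec.WhileFalse)+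
      moreover have "1 \<le> 1 + int (Suc k) * (c + 1)" using assms(5) by simp
      ultimately show ?thesis unfolding runs_def using log_cost_le_word(1) word_cost_mono by blast
    next
      case True
      have r: "runs B p m c (Inv k)" using assms(2)[OF Suc.prems True] by simp
      show ?thesis unfolding runs_def
      proof
        assume bd: "bounded_memory B m"
        then obtain t m' where 1: "exec p m t m'" "int t \<le> c * word_cost B" "bounded_memory B m'" "Inv k m'"
          using r unfolding runs_def by blast
        obtain t' m'' where 2: "exec (WhilePos r p) m' t' m''"
          "int t' \<le> (1 + int k * (c + 1)) * word_cost B" "bounded_memory B m''" "Q m''"
          using Suc.IH[OF 1(4)] 1(3) unfolding runs_def by blast
        have "int (log_cost (m r) + t + t') \<le> (1 + int (Suc k) * (c + 1)) * word_cost B"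
          using log_cost_le_word(1)[OF bd, of r] 1 2 by (simp add: algebra_simps)
        then show "\<exists>t m'. exec (WhilePos r p) m t m' \<and>
            int t \<le> (1 + int (Suc k) * (c + 1)) * word_cost B \<and> bounded_memory B m' \<and> Q m'"
          using exec.WhileTrue[of m r p t m' t' m''] True 1 2 by blast
      qed
    qed
  qed
  then show ?thesis by (rule runs_mono) (use assms in auto)
qed

section \<open>Multiplication and division by repeated addition\<close>

text \<open>Throughout, registers 12 and 13 hold 0 and 1, and register 3 is a scratch counter.
  The quotient is rounded down: the first loop rounds up, the second one corrects it.\<close>

definition Smul :: "nat \<Rightarrow> nat \<Rightarrow> nat \<Rightarrow> program" where
  "Smul a x y = Seq (Add 3 y 12) (Seq (WhilePos 3 (Seq (Add a a x) (Sub 3 3 13)))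
     (Seq (Sub 3 12 y) (WhilePos 3 (Seq (Sub a a x) (Sub 3 3 13)))))"

definition Divmod :: "nat \<Rightarrow> nat \<Rightarrow> nat \<Rightarrow> program" where
  "Divmod q a d = Seq (Const q 0) (Seq (WhilePos a (Seq (Sub a a d) (Add q q 13)))
     (Seq (Sub 3 12 a) (Seq (WhilePos 3 (Seq (Sub 3 3 d) (Sub q q 13))) (Sub a 12 3))))"

lemma abs_partial_product_le:
  fixes s x y B :: int
  assumes "\<bar>s\<bar> + \<bar>x * y\<bar> \<le> B" "0 \<le> l" "l \<le> \<bar>y\<bar>" "\<bar>\<sigma>\<bar> = 1"
  shows "\<bar>s + \<sigma> * (x * l)\<bar> \<le> B"
proof -
  have "\<bar>\<sigma> * (x * l)\<bar> \<le> \<bar>x * y\<bar>" using assms by (simp add: abs_mult mult_left_mono)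
  then show ?thesis using assms(1) by linarith
qed

text \<open>Both loops of \<open>Smul\<close> at once, \<open>add\<close> giving the direction. A
  counter that is not positive makes the loop empty, hence \<open>max 0 (m 3)\<close> passes. All
  partial sums are covered by the start value plus the full product.\<close>

lemma runs_addition_loop:
  fixes add :: bool
  defines "\<sigma> \<equiv> if add then 1 else - 1"
  assumes "m 13 = 1" "a \<noteq> 3" "a \<noteq> 13" "a \<noteq> x" "x \<noteq> 3" "\<bar>m a\<bar> + \<bar>m x * max 0 (m 3)\<bar> \<le> B"
    "Q (m(a := m a + \<sigma> * (m x * max 0 (m 3)), 3 := min 0 (m 3)))" "1 + 3 * max 0 (m 3) \<le> T"
    "upd = (if add then Add a a x else Sub a a x)"
  shows "runs B (WhilePos 3 (Seq upd (Sub 3 3 13))) m T Q"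
proof -
  define f where "f l = m(a := m a + \<sigma> * (m x * int l), 3 := m 3 - int l)" for l
  define Inv where "Inv k m' \<longleftrightarrow> (\<exists>l. int l + int k = max 0 (m 3) \<and> m' = f l)" for k m'
  show ?thesis
  proof (rule runs_bounded, rule runs_While[of Inv "nat (m 3)" _ _ _ _ 2])
    assume bd: "bounded_memory B m"
    fix k m' assume "Inv k m'" and pos: "m' 3 > 0"
    then obtain l where l: "int l + int k = max 0 (m 3)" "m' = f l" unfolding Inv_def by blast
    have k: "0 < k" "m 3 > 0" using pos l assms by (auto simp: f_def)
    have b3: "\<bar>m 3\<bar> \<le> B" using bd by (simp add: bounded_memory_def)
    have ba: "\<bar>m a + \<sigma> * (m x * int (Suc l))\<bar> \<le> B"
      using k l by (intro abs_partial_product_le[OF assms(7)]) (auto simp: \<sigma>_def)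
    have upd: "runs B upd m' 1 Q" if "Q (m'(a := m a + \<sigma> * (m x * int (Suc l))))" for Q
      unfolding assms(10) using that ba assms(1-6) l(2)
      by (cases add) (auto intro!: runs_Add runs_Sub simp: f_def algebra_simps)
    have "runs B (Seq upd (Sub 3 3 13)) m' 2 (Inv (k - 1))"
    proof (intro runs_Seq[where c=1] upd runs_Sub, goal_cases)
      case 1
      show ?case using k l b3 assms(1-6) by (auto simp: f_def)
    next
      case 2
      have "m'(a := m a + \<sigma> * (m x * int (Suc l)), 3 := m 3 - int (Suc l)) = f (Suc l)"
        using assms(1-6) l by (auto simp: f_def fun_eq_iff)
      then show ?case unfolding Inv_def using k l assms(1-6)
        by (intro exI[of _ "Suc l"]) (auto simp: f_def)
    qed simp_all
    then show "0 < k \<and> runs B (Seq upd (Sub 3 3 13)) m' 2 (Inv (k - 1))" using k by simp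
  next
    fix k m' assume "Inv k m'" and neg: "m' 3 \<le> 0"
    then obtain l where l: "int l + int k = max 0 (m 3)" "m' = f l" unfolding Inv_def by blast
    then have "int l = max 0 (m 3)" "m 3 - int l = min 0 (m 3)" using neg by (auto simp: f_def)
    then show "Q m'" using assms l by (simp add: f_def)
  next
    show "Inv (nat (m 3)) m" unfolding Inv_def by (intro exI[of _ 0]) (auto simp: f_def)
  qed (use assms in auto)
qed

text \<open>The sign of \<open>m y\<close> decides which of the two loops runs. The cost depends on
  \<open>y\<close> alone, so callers put the factor with the smaller bound there. The quantified
  \<open>v\<close> leaves the final counter unspecified.\<close>

lemma runs_Smul:
  assumes "m 12 = 0" "m 13 = 1" "a \<notin> {3, 12, 13, x, y}" "x \<noteq> 3" "y \<noteq> 3"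
    "\<bar>m a\<bar> + \<bar>m x * m y\<bar> \<le> B" "\<And>v. Q (m(a := m a + m x * m y, 3 := v))"
    "4 + 3 * \<bar>m y\<bar> \<le> T"
  shows "runs B (Smul a x y) m T Q"
proof (rule runs_bounded)
  assume bd: "bounded_memory B m"
  have by': "\<bar>m y\<bar> \<le> B" using bd by (simp add: bounded_memory_def)
  show ?thesis
  proof (cases "m y > 0")
    case True
    show ?thesis unfolding Smul_def
      apply (rule runs_Seq[where c=1], rule runs_Add)
      subgoal using by' assms(1) by simp
      apply (rule runs_Seq[where c="1 + 3 * \<bar>m y\<bar>"])
       apply (rule runs_addition_loop[where add=True])
      using assms True apply (simp_all)
      apply (rule runs_Seq[where c=1], rule runs_Sub)
      using by' apply simp
      apply (rule runs_addition_loop[where add=False])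
      using bd assms(7)[of "- m y"] apply (simp_all add: max_def min_def bounded_memory_def)
      done
  next
    case False
    show ?thesis unfolding Smul_def
      apply (rule runs_Seq[where c=1], rule runs_Add)
      subgoal using by' assms(1) by simp
      apply (rule runs_Seq[where c="1"])
       apply (rule runs_addition_loop[where add=True])
      using assms False apply (simp_all)
      apply (rule runs_Seq[where c=1], rule runs_Sub)
      using by' apply simp
      apply (rule runs_addition_loop[where add=False])
      using bd assms(7)[of "0"] apply (simp_all add: max_def min_def)
      done
  qed
qed

text \<open>The inequalities say that \<open>c\<close> is the ceiling of \<open>m a / m d\<close>,
  cut off at 0. The statement serves the main loop on the dividend as well as the correction loop on
  register 3.\<close>

lemma runs_quotient_loop:
  fixes add :: bool and c :: nat
  defines "\<sigma> \<equiv> if add then 1 else - 1"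
  assumes "m 13 = 1" "q \<notin> {13, a, d}" "a \<notin> {13, d}" "0 < m d"
    "m a \<le> m d * int c" "0 < c \<Longrightarrow> m d * (int c - 1) < m a" "\<And>l. l \<le> c \<Longrightarrow> \<bar>m q + \<sigma> * int l\<bar> \<le> B"
    "Q (m(q := m q + \<sigma> * int c, a := m a - m d * int c))" "1 + 3 * int c \<le> T"
    "upd = (if add then Add q q 13 else Sub q q 13)"
  shows "runs B (WhilePos a (Seq (Sub a a d) upd)) m T Q"
proof -
  define f where "f l = m(q := m q + \<sigma> * int l, a := m a - m d * int l)" for l
  define Inv where "Inv k m' \<longleftrightarrow> (\<exists>l. l + k = c \<and> m' = f l)" for k m'
  show ?thesis
  proof (rule runs_bounded, rule runs_While[of Inv c _ _ _ _ 2])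
    assume bd: "bounded_memory B m"
    fix k m' assume "Inv k m'" and pos: "m' a > 0"
    then obtain l where l: "l + k = c" "m' = f l" unfolding Inv_def by blast
    have k: "0 < k"
    proof (rule ccontr)
      assume "\<not> 0 < k"
      then show False using pos l assms(6) by (auto simp: f_def)
    qed
    have "m d * int l \<le> m d * (int c - 1)" using l k assms(5) by (intro mult_left_mono) auto
    then have ma: "0 < m a - m d * int l" using assms(7) k l by auto
    have ba: "\<bar>m a\<bar> \<le> B" and "\<bar>m d\<bar> \<le> B" using bd by (auto simp: bounded_memory_def)
    moreover have "0 \<le> m d * int l" using assms(5) by simp
    \<comment> \<open>The value before the subtraction is positive, so the new one lies between
      \<open>- m d\<close> and \<open>m a\<close>.\<close>
    ultimately have b1: "\<bar>m a - m d * int (Suc l)\<bar> \<le> B"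
      using ma assms(5) unfolding of_nat_Suc distrib_left by linarith
    have b2: "\<bar>m q + \<sigma> * int (Suc l)\<bar> \<le> B"
      by (rule assms(8)) (use l k in auto)
    have upd: "runs B upd m' 1 Q" if "Q (m'(q := m q + \<sigma> * int (Suc l)))" "m' 13 = 1" "m' q = m q + \<sigma> * int l" for Q m'
      unfolding assms(11) using that(1,2) b2
      by (cases add) (auto intro!: runs_Add runs_Sub simp: \<sigma>_def that(3) algebra_simps)
    have fS: "m'(a := m a - m d * int (Suc l), q := m q + \<sigma> * int (Suc l)) = f (Suc l)"
      unfolding l(2) f_def fun_eq_iff using assms(2-5) by auto
    have sub: "runs B (Sub a a d) m' 1 Q" if "Q (m'(a := m a - m d * int (Suc l)))" for Q
    proof (rule runs_Sub)
      have "m' a - m' d = m a - m d * int (Suc l)"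
        using l assms(3,4) by (auto simp: f_def algebra_simps)
      then show "\<bar>m' a - m' d\<bar> \<le> B" "Q (m'(a := m' a - m' d))" using that b1 by auto
    qed simp
    have "runs B (Seq (Sub a a d) upd) m' 2 (Inv (k - 1))"
    proof (intro runs_Seq[where c=1] sub, simp, rule upd, goal_cases)
      case 1
      have "Inv (k - 1) (f (Suc l))" using l k unfolding Inv_def by (intro exI[of _ "Suc l"]) auto
      then show ?case using fS by simp
    qed (use assms(1-5) l in \<open>auto simp: f_def\<close>)
    then show "0 < k \<and> runs B (Seq (Sub a a d) upd) m' 2 (Inv (k - 1))" using k by simp
  next
    fix k m' assume "Inv k m'" and neg: "m' a \<le> 0"
    then obtain l where l: "l + k = c" "m' = f l" unfolding Inv_def by blast
    have "k = 0"
    proof (rule ccontr)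
      assume k: "k \<noteq> 0"
      have "m d * int l \<le> m d * (int c - 1)" using l k assms(5) by (intro mult_left_mono) auto
      then show False using neg l assms(7) k by (auto simp: f_def)
    qed
    then show "Q m'" using assms l by (simp add: f_def)
  next
    show "Inv c m" unfolding Inv_def by (intro exI[of _ 0]) (auto simp: f_def)
  qed (use assms in auto)
qed

lemma obtain_ceiling_div:
  fixes D x :: int
  assumes "0 < D"
  obtains c :: nat where "x \<le> D * int c" "0 < c \<Longrightarrow> D * (int c - 1) < x" "int c \<le> max 0 x"
proof (cases "0 < x")
  case True
  define c where "c = nat ((x + D - 1) div D)"
  have c: "int c = (x + D - 1) div D" using True assms by (simp add: c_def pos_imp_zdiv_nonneg_iff)
  have e: "D * int c + (x + D - 1) mod D = x + D - 1" unfolding c by simp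
  have 1: "x \<le> D * int c" using e pos_mod_bound[OF assms, of "x + D - 1"] by linarith
  have 2: "D * (int c - 1) < x" using e pos_mod_sign[OF assms, of "x + D - 1"] by (simp add: algebra_simps)
  have "int c \<le> x"
  proof (cases "c \<le> 1")
    case False
    then have "1 * (int c - 1) \<le> D * (int c - 1)" using assms by (intro mult_right_mono) auto
    then show ?thesis using 2 by simp
  qed (use True in linarith)
  then show ?thesis using that[of c] 1 2 by simp
next
  case False
  then show ?thesis using that[of 0] by simp
qed

text \<open>If the first loop runs, it leaves a value above \<open>- D\<close> and at most 0, and
  the correction runs at most once. Otherwise the correction alone counts down to the floor. Hence
  at most two passes more than the absolute value of the quotient.\<close>

lemma runs_Divmod:
  assumes "m 12 = 0" "m 13 = 1" "q \<notin> {3, 12, 13, a, d}" "a \<notin> {3, 12, 13, d}" "d \<noteq> 3" "0 < m d"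
    "\<And>v. Q (m(q := m a div m d, a := m a mod m d, 3 := v))"
    "11 + 3 * \<bar>m a div m d\<bar> \<le> T"
  shows "runs B (Divmod q a d) m T Q"
proof (rule runs_bounded)
  assume bd: "bounded_memory B m"
  define D where "D = m d"
  have D: "0 < D" using assms by (simp add: D_def)
  have ba: "\<bar>m a\<bar> \<le> B" and b_d: "D \<le> B"
    using bd unfolding bounded_memory_def D_def by (auto simp: abs_le_iff)
  obtain c where c: "m a \<le> D * int c" "0 < c \<Longrightarrow> D * (int c - 1) < m a" "int c \<le> max 0 (m a)"
    using obtain_ceiling_div[OF D] by metis
  define X where "X = D * int c - m a"
  obtain e where e: "X \<le> D * int e" "0 < e \<Longrightarrow> D * (int e - 1) < X" "int e \<le> max 0 X"
    using obtain_ceiling_div[OF D] by metis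
  have X: "0 \<le> X" using c by (simp add: X_def)
  have Xc: "X < D" if "0 < c" using c(2)[OF that] by (simp add: X_def algebra_simps)
  have e1: "e \<le> 1" if "0 < c"
  proof (rule ccontr)
    assume "\<not> e \<le> 1"
    then have "D * 1 \<le> D * (int e - 1)" using D by (intro mult_left_mono) auto
    then show False using e(2) Xc[OF that] \<open>\<not> e \<le> 1\<close> by auto
  qed
  define r where "r = D * int e - X"
  have r: "0 \<le> r" "r < D"
    using e D X by (cases "e = 0"; auto simp: r_def algebra_simps)+
  have eq: "m a = D * (int c - int e) + r" by (simp add: r_def X_def algebra_simps)
  have dm: "m a div D = int c - int e" "m a mod D = r"
    using int_div_pos_eq[OF eq r] int_mod_pos_eq[OF eq r] by blast+
  have cost: "int c + int e \<le> \<bar>m a div D\<bar> + 2"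
    using e1 dm by (cases "0 < c") auto
  have XB: "X \<le> B" using Xc b_d ba by (cases "0 < c") (auto simp: X_def)
  have bp: "int l \<le> B" if "l \<le> c" for l using that c(3) ba by linarith
  have bq: "\<bar>int c - int l\<bar> \<le> B" if "l \<le> e" for l using that c(3) e(3) ba XB by linarith
  have q: "q \<noteq> a" "q \<noteq> 3" "q \<noteq> 12" "q \<noteq> 13" "q \<noteq> d" "a \<noteq> 3" "a \<noteq> 12" "a \<noteq> 13" "a \<noteq> d" using assms by auto
  have "runs B (Sub a 12 3) (m(q := int c - int e, a := - X, 3 := X - D * int e)) 1 Q"
    by (rule runs_Sub) (use q assms(1) assms(7)[of "- r"] dm r b_d in
        \<open>auto simp: D_def[symmetric] r_def fun_upd_twist\<close>)
  then have "runs B (Seq (WhilePos 3 (Seq (Sub 3 3 d) (Sub q q 13))) (Sub a 12 3))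
     (m(q := int c, a := - X, 3 := X)) (2 + 3 * int e) Q"
    using q assms(1-6) e(1,2) bq
    by (intro runs_Seq[where c="1 + 3 * int e"], intro runs_quotient_loop[where add=False and c=e])
      (simp_all add: D_def[symmetric] fun_upd_twist)
  then have "runs B (Seq (Sub 3 12 a) (Seq (WhilePos 3 (Seq (Sub 3 3 d) (Sub q q 13))) (Sub a 12 3)))
     (m(q := int c, a := - X)) (3 + 3 * int e) Q"
    using q assms(1-6) X XB
    by (intro runs_Seq[where c=1, OF runs_Sub]) (auto simp: D_def[symmetric])
  then have "runs B (Seq (WhilePos a (Seq (Sub a a d) (Add q q 13)))
      (Seq (Sub 3 12 a) (Seq (WhilePos 3 (Seq (Sub 3 3 d) (Sub q q 13))) (Sub a 12 3))))
     (m(q := 0)) (4 + 3 * int c + 3 * int e) Q"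
    using q assms(1-6) c(1,2) bp
    by (intro runs_Seq[where c="1 + 3 * int c"], intro runs_quotient_loop[where add=True and c=c])
      (simp_all add: D_def[symmetric] X_def)
  then have "runs B (Divmod q a d) m (5 + 3 * int c + 3 * int e) Q"
    unfolding Divmod_def using q assms(1-6) ba
    by (intro runs_Seq[where c=1, OF runs_Const]) (auto simp: add.assoc)
  then show "runs B (Divmod q a d) m T Q"
    by (rule runs_mono) (use cost assms(8) in \<open>auto simp: D_def\<close>)
qed

section \<open>Variables and arrays in memory\<close>

text \<open>Registers 2, 3 and 4 are scratch, 5 and 6 hold the addresses of the matrix and of the right-hand
  side, 7 to 11 those of five arrays of length \<open>n + 2\<close>, 12 to 15 the constants 0, 1, \<open>n\<close>, \<open>n + 1\<close>,
  and 16 to 40 the variables. The entries of the matrix above the diagonal are never read, because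
  the variables may occupy their place.\<close>

definition Load_matrix :: "nat \<Rightarrow> nat \<Rightarrow> nat \<Rightarrow> program" where
  "Load_matrix r k i = Seq (Add 2 5 i) (Seq (Smul 2 14 k) (Load r 2))"

definition Load_rhs :: "nat \<Rightarrow> nat \<Rightarrow> program" where
  "Load_rhs r k = Seq (Add 2 6 k) (Load r 2)"

definition Load_array :: "nat \<Rightarrow> nat \<Rightarrow> nat \<Rightarrow> program" where
  "Load_array r q k = Seq (Add 2 (7 + q) k) (Load r 2)"

definition Store_array :: "nat \<Rightarrow> nat \<Rightarrow> nat \<Rightarrow> program" where
  "Store_array q k r = Seq (Add 2 (7 + q) k) (Store 2 r)"

definition For :: "nat \<Rightarrow> nat \<Rightarrow> program \<Rightarrow> program" where
  "For i ub p = Seq (Const i 0) (Seq (Sub 4 ub i)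
     (WhilePos 4 (Seq p (Seq (Add i i 13) (Sub 4 ub i)))))"

locale layout =
  fixes n hb :: nat and H :: "nat \<Rightarrow> nat \<Rightarrow> int" and b :: "nat \<Rightarrow> int" and B :: int
  assumes hb_pos: "1 \<le> hb"
    and matrix_address: "\<And>k i. k \<le> n \<Longrightarrow> i \<le> k \<Longrightarrow> i < n \<Longrightarrow> hb + k * n + i \<notin> {2..40}"
    and rhs_address: "40 < hb + n * (n + 1)"
    and address_bound: "int (hb + n * (n + 1) + (n + 1) + 5 * (n + 2)) \<le> B"
begin

text \<open>The length \<open>n + 2\<close> is dictated by the output: numerator, denominator and
  the \<open>n\<close> entries of the direction.\<close>

definition array_base :: "nat \<Rightarrow> nat" where
  "array_base q = hb + n * (n + 1) + (n + 1) + q * (n + 2)"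

text \<open>The value of a register as an operand; the constants do not depend on the valuation.\<close>

definition val :: "(nat \<Rightarrow> int) \<Rightarrow> nat \<Rightarrow> int" where
  "val R r = (if r = 12 then 0 else if r = 13 then 1 else if r = 14 then int n
     else if r = 15 then int n + 1 else R r)"

text \<open>The scratch registers 2, 3 and 4 are left out on purpose, so that changing them
  preserves the represented state (\<open>rep_hidden\<close>).\<close>

definition rep :: "(nat \<Rightarrow> int) \<Rightarrow> (nat \<Rightarrow> nat \<Rightarrow> int) \<Rightarrow> memory \<Rightarrow> bool" where
  "rep R A m \<longleftrightarrow> (\<forall>r\<in>{12..40}. m r = val R r) \<and> m 5 = int hb \<and> m 6 = int (hb + n * (n + 1)) \<and>
     (\<forall>q<5. m (7 + q) = int (array_base q)) \<and>
     (\<forall>k i. k \<le> n \<and> i \<le> k \<and> i < n \<longrightarrow> m (hb + k * n + i) = H k i) \<and>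
     (\<forall>k\<le>n. m (hb + n * (n + 1) + k) = b k) \<and>
     (\<forall>q k. q < 5 \<and> k < n + 2 \<longrightarrow> m (array_base q + k) = A q k)"

text \<open>Triples on valuations and arrays. Aliasing of addresses is settled once, in
  \<open>rep_register\<close>, \<open>rep_hidden\<close> and \<open>rep_array\<close>; later proofs
  see only function updates.\<close>

definition hruns :: "program \<Rightarrow> (nat \<Rightarrow> int) \<Rightarrow> (nat \<Rightarrow> nat \<Rightarrow> int) \<Rightarrow> int \<Rightarrow>
    ((nat \<Rightarrow> int) \<Rightarrow> (nat \<Rightarrow> nat \<Rightarrow> int) \<Rightarrow> bool) \<Rightarrow> bool" where
  "hruns p R A T Q \<longleftrightarrow>
     (\<forall>m. rep R A m \<longrightarrow> runs B p m T (\<lambda>m'. \<exists>R' A'. rep R' A' m' \<and> Q R' A'))"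

lemma val_simps:
  "val R 12 = 0" "val R 13 = 1" "val R 14 = int n" "val R 15 = int n + 1"
  "16 \<le> r \<Longrightarrow> val R r = R r"
  by (auto simp: val_def)

lemma repD:
  assumes "rep R A m"
  shows "12 \<le> r \<Longrightarrow> r \<le> 40 \<Longrightarrow> m r = val R r" "m 5 = int hb" "m 6 = int (hb + n * (n + 1))"
    "q < 5 \<Longrightarrow> m (7 + q) = int (array_base q)"
    "k \<le> n \<Longrightarrow> i \<le> k \<Longrightarrow> i < n \<Longrightarrow> m (hb + k * n + i) = H k i"
    "k \<le> n \<Longrightarrow> m (hb + n * (n + 1) + k) = b k"
    "q < 5 \<Longrightarrow> k < n + 2 \<Longrightarrow> m (array_base q + k) = A q k"
  using assms unfolding rep_def by auto

lemma rep_constants: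
  assumes "rep R A m"
  shows "m 12 = 0" "m 13 = 1" "m 14 = int n"
  using repD(1)[OF assms, of 12] repD(1)[OF assms, of 13] repD(1)[OF assms, of 14]
  by (simp_all add: val_simps)

lemma matrix_address_less: "k \<le> n \<Longrightarrow> i < n \<Longrightarrow> hb + k * n + i < hb + n * (n + 1)"
proof -
  assume "k \<le> n" "i < n"
  then have "k * n + i < n * n + n" by (intro add_le_less_mono mult_right_mono) auto
  then show ?thesis by (simp add: algebra_simps)
qed

lemma array_base_gt: "hb + n * (n + 1) + n < array_base q + k"
  by (simp add: array_base_def)

lemma array_address_inj:
  assumes "array_base q + k = array_base q' + k'" "k < n + 2" "k' < n + 2"
  shows "q = q' \<and> k = k'"
proof -
  have *: "q * (n + 2) + k = q' * (n + 2) + k'" using assms by (simp add: array_base_def)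
  have "(q * (n + 2) + k) div (n + 2) = q" "(q' * (n + 2) + k') div (n + 2) = q'"
    by (subst div_mult_self3; use assms in simp)+
  then show ?thesis using * by auto
qed

lemma array_address_le:
  assumes "q < 5" "k < n + 2"
  shows "int (array_base q + k) \<le> B"
proof -
  have "q * (n + 2) + k \<le> 4 * (n + 2) + (n + 2)" using assms by (intro add_mono mult_right_mono) auto
  then have "array_base q + k \<le> hb + n * (n + 1) + (n + 1) + 5 * (n + 2)"
    unfolding array_base_def by simp
  then show ?thesis using address_bound by linarith
qed

lemma rep_register:
  assumes "rep R A m" "16 \<le> i" "i \<le> 40"
  shows "rep (R(i := v)) A (m(i := v))"
proof -
  have 1: "hb + k * n + j \<noteq> i" if "k \<le> n" "j \<le> k" "j < n" for k j
    using matrix_address[OF that] assms by auto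
  have 2: "hb + n * (n + 1) + k \<noteq> i" for k using rhs_address assms by linarith
  have 3: "array_base q + k \<noteq> i" for q k
    using array_base_gt[of q k] rhs_address assms by linarith
  show ?thesis using assms 1 2 3 unfolding rep_def by (auto simp: val_def)
qed

lemma rep_hidden:
  assumes "rep R A m" "i \<in> {2, 3, 4}"
  shows "rep R A (m(i := v))"
proof -
  have 1: "hb + k * n + j \<noteq> i" if "k \<le> n" "j \<le> k" "j < n" for k j
    using matrix_address[OF that] assms by auto
  have 2: "hb + n * (n + 1) + k \<noteq> i" for k using rhs_address assms by auto
  have 3: "array_base q + k \<noteq> i" for q k
    using array_base_gt[of q k] rhs_address assms by auto
  show ?thesis using assms 1 2 3 unfolding rep_def by auto
qed

lemma rep_array:
  assumes "rep R A m" "q < 5" "k < n + 2"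
  shows "rep R (A(q := (A q)(k := v))) (m(array_base q + k := v))"
proof -
  have 1: "hb + k' * n + j \<noteq> array_base q + k" if "k' \<le> n" "j < n" for k' j
    using matrix_address_less[OF that] array_base_gt[of q k] by linarith
  have 2: "hb + n * (n + 1) + k' \<noteq> array_base q + k" if "k' \<le> n" for k'
    using that array_base_gt[of q k] by linarith
  have 3: "40 < array_base q + k"
    using array_base_gt[of q k] rhs_address by linarith
  have 4: "array_base q' + k' \<noteq> array_base q + k" if "k' < n + 2" "q' \<noteq> q \<or> k' \<noteq> k" for q' k'
    using array_address_inj[of q' k' q k] that assms(3) by blast
  show ?thesis using assms(1) 1 2 3 4 unfolding rep_def
    by (auto simp: fun_upd_def)
qed

lemma rep_bounded: "rep R A m \<Longrightarrow> bounded_memory B m \<Longrightarrow> 12 \<le> r \<Longrightarrow> r \<le> 40 \<Longrightarrow> \<bar>val R r\<bar> \<le> B"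
  using repD(1) unfolding bounded_memory_def by metis

lemma hruns_mono:
  "hruns p R A c Q \<Longrightarrow> c \<le> T \<Longrightarrow> (\<And>R' A'. Q R' A' \<Longrightarrow> Q' R' A') \<Longrightarrow> hruns p R A T Q'"
  unfolding hruns_def by (blast intro: runs_mono)

lemma hruns_Seq:
  "hruns p R A c (\<lambda>R' A'. hruns q R' A' (T - c) Q) \<Longrightarrow> hruns (Seq p q) R A T Q"
  unfolding hruns_def by (intro allI impI runs_Seq[where c=c], rule runs_mono) (blast, simp, blast)

lemma hruns_Skip: "Q R A \<Longrightarrow> 1 \<le> T \<Longrightarrow> hruns Skip R A T Q"
  unfolding hruns_def by (auto intro: runs_Skip)

lemma hruns_Const:
  "16 \<le> i \<Longrightarrow> i \<le> 40 \<Longrightarrow> \<bar>a\<bar> \<le> B \<Longrightarrow> 1 \<le> T \<Longrightarrow> Q (R(i := a)) A \<Longrightarrow> hruns (Const i a) R A T Q"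
  unfolding hruns_def by (auto intro!: runs_Const intro: rep_register)

lemma hruns_Add:
  "16 \<le> i \<Longrightarrow> i \<le> 40 \<Longrightarrow> 12 \<le> j \<Longrightarrow> j \<le> 40 \<Longrightarrow> 12 \<le> k \<Longrightarrow> k \<le> 40 \<Longrightarrow> \<bar>val R j + val R k\<bar> \<le> B \<Longrightarrow>
   1 \<le> T \<Longrightarrow> Q (R(i := val R j + val R k)) A \<Longrightarrow> hruns (Add i j k) R A T Q"
  unfolding hruns_def by (intro allI impI runs_Add) (use rep_register in \<open>fastforce simp: repD(1)\<close>)+

lemma hruns_Sub:
  "16 \<le> i \<Longrightarrow> i \<le> 40 \<Longrightarrow> 12 \<le> j \<Longrightarrow> j \<le> 40 \<Longrightarrow> 12 \<le> k \<Longrightarrow> k \<le> 40 \<Longrightarrow> \<bar>val R j - val R k\<bar> \<le> B \<Longrightarrow>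
   1 \<le> T \<Longrightarrow> Q (R(i := val R j - val R k)) A \<Longrightarrow> hruns (Sub i j k) R A T Q"
  unfolding hruns_def by (intro allI impI runs_Sub) (use rep_register in \<open>fastforce simp: repD(1)\<close>)+

lemma hruns_Smul:
  assumes "16 \<le> a" "a \<le> 40" "12 \<le> x" "x \<le> 40" "12 \<le> y" "y \<le> 40" "a \<noteq> x" "a \<noteq> y"
    "\<bar>R a\<bar> + \<bar>val R x * val R y\<bar> \<le> B" "4 + 3 * \<bar>val R y\<bar> \<le> T" "Q (R(a := R a + val R x * val R y)) A"
  shows "hruns (Smul a x y) R A T Q"
  unfolding hruns_def
proof (intro allI impI runs_Smul)
  fix m v assume m: "rep R A m"
  have eq: "m a = R a" "m x = val R x" "m y = val R y"
    using assms repD(1)[OF m] by (auto simp: val_simps)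
  show "\<exists>R' A'. rep R' A' (m(a := m a + m x * m y, 3 := v)) \<and> Q R' A'"
    using assms(1,2,11) rep_hidden[OF rep_register[OF m]] unfolding eq by blast
  show "\<bar>m a\<bar> + \<bar>m x * m y\<bar> \<le> B" "4 + 3 * \<bar>m y\<bar> \<le> T" using assms unfolding eq by auto
qed (use assms rep_constants in auto)

lemma hruns_Divmod:
  assumes "16 \<le> q" "q \<le> 40" "16 \<le> a" "a \<le> 40" "12 \<le> d" "d \<le> 40" "a \<noteq> d" "q \<noteq> d" "q \<noteq> a"
    "0 < val R d" "11 + 3 * \<bar>R a div val R d\<bar> \<le> T" "Q (R(q := R a div val R d, a := R a mod val R d)) A"
  shows "hruns (Divmod q a d) R A T Q"
  unfolding hruns_def
proof (intro allI impI runs_Divmod)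
  fix m v assume m: "rep R A m"
  have eq: "m a = R a" "m d = val R d"
    using assms repD(1)[OF m] by (auto simp: val_simps)
  show "\<exists>R' A'. rep R' A' (m(q := m a div m d, a := m a mod m d, 3 := v)) \<and> Q R' A'"
    using assms(1-4,12) rep_hidden[OF rep_register[OF rep_register[OF m]]] unfolding eq by blast
  show "0 < m d" "11 + 3 * \<bar>m a div m d\<bar> \<le> T" using assms unfolding eq by auto
qed (use assms rep_constants in auto)

lemma hruns_Load_array:
  assumes "16 \<le> r" "r \<le> 40" "12 \<le> k" "k \<le> 40" "q < 5" "0 \<le> val R k" "val R k < int n + 2" "2 \<le> T"
    "Q (R(r := A q (nat (val R k)))) A"
  shows "hruns (Load_array r q k) R A T Q"
  unfolding hruns_def Load_array_def
proof (intro allI impI)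
  fix m assume m: "rep R A m"
  define k' where "k' = nat (val R k)"
  have k': "val R k = int k'" "k' < n + 2" using assms by (auto simp: k'_def)
  have eq: "m (7 + q) + m k = int (array_base q + k')"
    using assms repD(1,4)[OF m] k' by simp
  let ?m = "m(2 := int (array_base q + k'))"
  have m': "rep R A ?m" using m by (rule rep_hidden) simp
  have "runs B (Load r 2) ?m (T - 1) (\<lambda>m'. \<exists>R' A'. rep R' A' m' \<and> Q R' A')"
  proof (rule runs_Load)
    have "?m (nat (?m 2)) = A q k'"
      using repD(7)[OF m' \<open>q < 5\<close> k'(2)] by (simp only: fun_upd_same nat_int)
    then show "\<exists>R' A'. rep R' A' (?m(r := ?m (nat (?m 2)))) \<and> Q R' A'"
      using rep_register[OF m' assms(1,2)] assms(9) k'_def by metis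
  qed (use assms in simp)
  then show "runs B (Seq (Add 2 (7 + q) k) (Load r 2)) m T (\<lambda>m'. \<exists>R' A'. rep R' A' m' \<and> Q R' A')"
    using array_address_le[OF \<open>q < 5\<close> k'(2)] eq
    by (intro runs_Seq[where c=1] runs_Add) (simp_all add: eq)
qed

lemma hruns_Store_array:
  assumes "12 \<le> r" "r \<le> 40" "12 \<le> k" "k \<le> 40" "q < 5" "0 \<le> val R k" "val R k < int n + 2" "2 \<le> T"
    "Q R (A(q := (A q)(nat (val R k) := val R r)))"
  shows "hruns (Store_array q k r) R A T Q"
  unfolding hruns_def Store_array_def
proof (intro allI impI)
  fix m assume m: "rep R A m"
  define k' where "k' = nat (val R k)"
  have k': "val R k = int k'" "k' < n + 2" using assms by (auto simp: k'_def)
  have eq: "m (7 + q) + m k = int (array_base q + k')"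
    using assms repD(1,4)[OF m] k' by simp
  let ?m = "m(2 := int (array_base q + k'))"
  have m': "rep R A ?m" using m by (rule rep_hidden) simp
  have "runs B (Store 2 r) ?m (T - 1) (\<lambda>m'. \<exists>R' A'. rep R' A' m' \<and> Q R' A')"
  proof (rule runs_Store)
    have "?m (nat (?m 2) := ?m r) = ?m(array_base q + k' := val R r)"
      using repD(1)[OF m' assms(1,2)] by (simp only: fun_upd_same nat_int)
    then show "\<exists>R' A'. rep R' A' (?m (nat (?m 2) := ?m r)) \<and> Q R' A'"
      using rep_array[OF m' \<open>q < 5\<close> k'(2)] assms(9) k'_def by metis
  qed (use assms in simp)
  then show "runs B (Seq (Add 2 (7 + q) k) (Store 2 r)) m T (\<lambda>m'. \<exists>R' A'. rep R' A' m' \<and> Q R' A')"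
    using array_address_le[OF \<open>q < 5\<close> k'(2)] eq
    by (intro runs_Seq[where c=1] runs_Add) (simp_all add: eq)
qed

lemma hruns_Load_rhs:
  assumes "16 \<le> r" "r \<le> 40" "12 \<le> k" "k \<le> 40" "0 \<le> val R k" "val R k \<le> int n" "2 \<le> T"
    "Q (R(r := b (nat (val R k)))) A"
  shows "hruns (Load_rhs r k) R A T Q"
  unfolding hruns_def Load_rhs_def
proof (intro allI impI)
  fix m assume m: "rep R A m"
  define k' where "k' = nat (val R k)"
  have k': "val R k = int k'" "k' \<le> n" using assms by (auto simp: k'_def)
  have eq: "m 6 + m k = int (hb + n * (n + 1) + k')"
    using assms repD(1,3)[OF m] k' by simp
  have le: "int (hb + n * (n + 1) + k') \<le> B" using address_bound k'(2) by linarith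
  let ?m = "m(2 := int (hb + n * (n + 1) + k'))"
  have m': "rep R A ?m" using m by (rule rep_hidden) simp
  have "runs B (Load r 2) ?m (T - 1) (\<lambda>m'. \<exists>R' A'. rep R' A' m' \<and> Q R' A')"
  proof (rule runs_Load)
    have "?m (nat (?m 2)) = b k'" using repD(6)[OF m' k'(2)] by (simp only: fun_upd_same nat_int)
    then show "\<exists>R' A'. rep R' A' (?m(r := ?m (nat (?m 2)))) \<and> Q R' A'"
      using rep_register[OF m' assms(1,2)] assms(8) k'_def by metis
  qed (use assms in simp)
  then show "runs B (Seq (Add 2 6 k) (Load r 2)) m T (\<lambda>m'. \<exists>R' A'. rep R' A' m' \<and> Q R' A')"
    using le eq
    by (intro runs_Seq[where c=1] runs_Add) (simp_all only: eq abs_of_nat)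
qed

text \<open>The row offset is a product and is computed by repeated addition as well, so that one
  access to the matrix costs a multiple of \<open>n\<close>.\<close>

lemma hruns_Load_matrix:
  assumes "16 \<le> r" "r \<le> 40" "12 \<le> k" "k \<le> 40" "12 \<le> i" "i \<le> 40"
    "0 \<le> val R i" "val R i \<le> val R k" "val R k \<le> int n" "val R i < int n" "6 + 3 * int n \<le> T"
    "Q (R(r := H (nat (val R k)) (nat (val R i)))) A"
  shows "hruns (Load_matrix r k i) R A T Q"
  unfolding hruns_def Load_matrix_def
proof (intro allI impI)
  fix m assume m: "rep R A m"
  define k' i' where "k' = nat (val R k)" and "i' = nat (val R i)"
  have k': "val R k = int k'" "k' \<le> n" and i': "val R i = int i'" "i' \<le> k'" "i' < n"
    using assms by (auto simp: k'_def i'_def)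
  have eq: "m 5 + m i = int (hb + i')"
    using assms repD(1,2)[OF m] i' by simp
  have le: "int (hb + k' * n + i') \<le> B"
    using address_bound matrix_address_less[OF k'(2) i'(3)] by linarith
  then have le': "int (hb + i') \<le> B" by (rule order.trans[rotated]) simp
  let ?m1 = "m(2 := int (hb + i'))"
  have Load: "runs B (Load r 2) (?m1(2 := int (hb + k' * n + i'), 3 := v)) (T - 5 - 3 * int n)
      (\<lambda>m'. \<exists>R' A'. rep R' A' m' \<and> Q R' A')" for v
  proof (rule runs_Load)
    let ?m = "?m1(2 := int (hb + k' * n + i'), 3 := v)"
    have m': "rep R A ?m" by (intro rep_hidden m) auto
    have "?m 2 = int (hb + k' * n + i')" by simp
    then have "?m (nat (?m 2)) = H k' i'" using repD(5)[OF m' k'(2) i'(2,3)] by (simp only: nat_int)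
    then show "\<exists>R' A'. rep R' A' (?m(r := ?m (nat (?m 2)))) \<and> Q R' A'"
      using rep_register[OF m' assms(1,2)] assms(12) k'_def i'_def by metis
  qed (use assms in simp)
  have m1: "?m1 12 = 0" "?m1 13 = 1" "?m1 14 = int n" "?m1 k = int k'"
    using repD(1)[OF m] assms k' by (auto simp: val_simps)
  have addr: "?m1 2 + ?m1 14 * ?m1 k = int (hb + k' * n + i')"
    unfolding m1 by (simp add: algebra_simps)
  have "runs B (Seq (Smul 2 14 k) (Load r 2)) ?m1 (T - 1) (\<lambda>m'. \<exists>R' A'. rep R' A' m' \<and> Q R' A')"
  proof (intro runs_Seq[where c="4 + 3 * int n"] runs_Smul)
    show "\<bar>?m1 2\<bar> + \<bar>?m1 14 * ?m1 k\<bar> \<le> B"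
      using addr le unfolding m1 by (simp add: abs_mult mult.commute)
    show "runs B (Load r 2) (?m1(2 := ?m1 2 + ?m1 14 * ?m1 k, 3 := v)) (T - 1 - (4 + 3 * int n))
      (\<lambda>m'. \<exists>R' A'. rep R' A' m' \<and> Q R' A')" for v
      unfolding addr using Load[of v] by (simp add: algebra_simps)
  qed (use m1 assms k' in auto)
  then show "runs B (Seq (Add 2 5 i) (Seq (Smul 2 14 k) (Load r 2))) m T
      (\<lambda>m'. \<exists>R' A'. rep R' A' m' \<and> Q R' A')"
    using le' eq
    by (intro runs_Seq[where c=1, OF runs_Add]) (simp_all only: eq abs_of_nat)
qed

lemma hruns_IfPos:
  assumes "12 \<le> r" "r \<le> 40" "val R r > 0 \<Longrightarrow> hruns p R A (T - 1) Q" "val R r \<le> 0 \<Longrightarrow> hruns q R A (T - 1) Q"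
  shows "hruns (IfPos r p q) R A T Q"
  using assms unfolding hruns_def by (auto intro!: runs_IfPos simp: repD(1))

text \<open>Besides the body, a pass pays for the test, the increment and the recomputation of
  register 4. Because that register is recomputed after the body, nested loops can share it; counter
  and bound must survive the body.\<close>

lemma hruns_For:
  assumes "16 \<le> i" "i \<le> 40" "12 \<le> ub" "ub \<le> 40" "ub \<noteq> i" "val R ub = int N"
    "Inv 0 (R(i := 0)) A"
    "\<And>k R A. k < N \<Longrightarrow> Inv k R A \<Longrightarrow> R i = int k \<Longrightarrow> val R ub = int N \<Longrightarrow>
       hruns p R A c (\<lambda>R' A'. R' i = int k \<and> val R' ub = int N \<and> Inv (Suc k) (R'(i := int (Suc k))) A')"
    "\<And>R A. Inv N R A \<Longrightarrow> R i = int N \<Longrightarrow> Q R A"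
    "0 \<le> c" "3 + int N * (c + 3) \<le> T"
  shows "hruns (For i ub p) R A T Q"
  unfolding hruns_def For_def
proof (intro allI impI, rule runs_bounded)
  fix m assume m: "rep R A m" and bd: "bounded_memory B m"
  let ?P = "\<lambda>m'. \<exists>R' A'. rep R' A' m' \<and> Q R' A'"
  have NB: "int N \<le> B" using rep_bounded[OF m bd, of ub] assms by simp
  then have B: "0 \<le> B" by linarith
  define I where "I l m \<longleftrightarrow> (\<exists>k R A. l + k = N \<and> rep R A m \<and> Inv k R A \<and> R i = int k \<and>
    val R ub = int N \<and> m 4 = int N - int k)" for l m
  have loop: "runs B (WhilePos 4 (Seq p (Seq (Add i i 13) (Sub 4 ub i)))) m (T - 2) ?P"
    if "I N m" for m
  proof (rule runs_While[of I])
    fix l m assume "I l m" and pos: "0 < m 4"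
    then obtain k R A where k: "l + k = N" "rep R A m" "Inv k R A" "R i = int k"
      "val R ub = int N" "m 4 = int N - int k" unfolding I_def by blast
    have "runs B p m c (\<lambda>m. \<exists>R A. rep R A m \<and> R i = int k \<and> val R ub = int N \<and>
        Inv (Suc k) (R(i := int (Suc k))) A)"
      using assms(8)[of k R A] k pos unfolding hruns_def by simp
    then have "runs B (Seq p (Seq (Add i i 13) (Sub 4 ub i))) m (c + 2) (I (l - 1))"
    proof (rule runs_Seq[OF runs_mono[OF _ order.refl]], elim exE conjE)
      fix m R A assume m: "rep R A m" and R: "R i = int k" "val R ub = int N"
        and Inv: "Inv (Suc k) (R(i := int (Suc k))) A"
      have m': "m i = int k" "m 13 = 1" "m ub = int N"
        using repD(1)[OF m] assms R by (auto simp: val_simps)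
      let ?m = "m(i := int (Suc k), 4 := int N - int (Suc k))"
      have kN: "k < N" using pos k by simp
      have "rep (R(i := int (Suc k))) A ?m"
        by (intro rep_hidden rep_register m) (use assms in auto)
      moreover have "val (R(i := int (Suc k))) ub = int N" using R assms by (auto simp: val_def)
      ultimately have "I (l - 1) ?m" unfolding I_def using k kN assms(1) Inv
        by (intro exI[of _ "Suc k"] exI[of _ "R(i := int (Suc k))"] exI[of _ A]) auto
      then show "runs B (Seq (Add i i 13) (Sub 4 ub i)) m (c + 2 - c) (I (l - 1))"
        using m' assms(1-5) kN NB by (intro runs_Seq[where c=1] runs_Add runs_Sub) (auto simp: add.commute)
    qed
    then show "0 < l \<and> runs B (Seq p (Seq (Add i i 13) (Sub 4 ub i))) m (c + 2) (I (l - 1))"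
      using pos k by auto
  next
    fix l m assume "I l m" "m 4 \<le> 0"
    then obtain k R A where k: "l + k = N" "rep R A m" "Inv k R A" "R i = int k" "k = N"
      unfolding I_def by force
    then have "Inv N R A" "R i = int N" by auto
    then show "?P m" using assms(9) k(2) by blast
  qed (use that assms in \<open>auto simp: algebra_simps\<close>)
  have m': "m ub = int N" using repD(1)[OF m] assms by auto
  have "rep (R(i := 0)) A (m(i := 0, 4 := int N))"
    by (intro rep_hidden rep_register m) (use assms in auto)
  then have "I N (m(i := 0, 4 := int N))" unfolding I_def
    using assms by (intro exI[of _ 0] exI[of _ "R(i := 0)"] exI[of _ A]) (auto simp: val_def)
  then have "runs B (WhilePos 4 (Seq p (Seq (Add i i 13) (Sub 4 ub i)))) (m(i := 0, 4 := int N)) (T - 2) ?P"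
    by (rule loop)
  then show "runs B (Seq (Const i 0) (Seq (Sub 4 ub i)
     (WhilePos 4 (Seq p (Seq (Add i i 13) (Sub 4 ub i)))))) m T ?P"
    using m' assms(1-5) NB B
    by (intro runs_Seq[where c=1] runs_Const runs_Sub) auto
qed

lemmas seq_Const = hruns_Seq[where c=1, OF hruns_Const]
  and seq_Add = hruns_Seq[where c=1, OF hruns_Add]
  and seq_Sub = hruns_Seq[where c=1, OF hruns_Sub]
  and seq_Load_array = hruns_Seq[where c=2, OF hruns_Load_array]
  and seq_Store_array = hruns_Seq[where c=2, OF hruns_Store_array]
  and seq_Load_rhs = hruns_Seq[where c=2, OF hruns_Load_rhs]
  and seq_Load_matrix = hruns_Seq[where c="6 + 3 * int n", OF hruns_Load_matrix]

lemma seq_Smul: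
  assumes "16 \<le> a" "a \<le> 40" "12 \<le> x" "x \<le> 40" "12 \<le> y" "y \<le> 40" "a \<noteq> x" "a \<noteq> y"
    "\<bar>R a\<bar> + \<bar>val R x * val R y\<bar> \<le> B"
    "hruns q (R(a := R a + val R x * val R y)) A (T - (4 + 3 * \<bar>val R y\<bar>)) Q"
  shows "hruns (Seq (Smul a x y) q) R A T Q"
  by (rule hruns_Seq, rule hruns_Smul) (use assms in simp_all)

lemma seq_Divmod:
  assumes "16 \<le> q" "q \<le> 40" "16 \<le> a" "a \<le> 40" "12 \<le> d" "d \<le> 40" "a \<noteq> d" "q \<noteq> d" "q \<noteq> a"
    "0 < val R d"
    "hruns p (R(q := R a div val R d, a := R a mod val R d)) A (T - (11 + 3 * \<bar>R a div val R d\<bar>)) Q"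
  shows "hruns (Seq (Divmod q a d) p) R A T Q"
  by (rule hruns_Seq, rule hruns_Divmod) (use assms in simp_all)

end

section \<open>The width of the simplex\<close>

lemma pick_remove:
  assumes "a < N" "i \<le> N"
  shows "pick ({..<Suc N} - {i}) a = insert_index i a"
proof -
  let ?e = "insert_index i a"
  have "?e \<in> {..<Suc N} - {i}" using assms by (auto simp: insert_index_def)
  moreover have "{x \<in> {..<Suc N} - {i}. x < ?e} = (if a < i then {..<a} else {..<Suc a} - {i})"
    using assms by (auto simp: insert_index_def)
  then have "card {x \<in> {..<Suc N} - {i}. x < ?e} = a" by auto
  ultimately show ?thesis using pick_card_in_set by metis
qed

lemma pick_lessThan: "a < N \<Longrightarrow> pick {..<N} a = a"
proof -
  assume a: "a < N"
  have "{x \<in> {..<N}. x < a} = {..<a}" using a by auto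
  then have "card {x \<in> {..<N}. x < a} = a" by simp
  then show ?thesis using pick_card_in_set[of a "{..<N}"] a by simp
qed

lemma card_remove: "i \<le> N \<Longrightarrow> card {x. x < Suc N \<and> x \<in> {..<Suc N} - {i}} = N"
proof -
  assume "i \<le> N"
  have "{x. x < Suc N \<and> x \<in> {..<Suc N} - {i}} = {..<Suc N} - {i}" by auto
  then show ?thesis using \<open>i \<le> N\<close> by simp
qed

text \<open>The bridge between the two notions of minor: \<open>max_minor\<close> selects index
  sets, a cofactor deletes one row and one column.\<close>

lemma submatrix_eq_mat_delete:
  assumes "A \<in> carrier_mat (Suc n) (Suc n)" "i \<le> n" "j \<le> n"
  shows "submatrix A ({..<Suc n} - {i}) ({..<Suc n} - {j}) = mat_delete A i j"
proof (rule eq_matI)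
  fix a c assume "a < dim_row (mat_delete A i j)" "c < dim_col (mat_delete A i j)"
  then have ac: "a < n" "c < n" using assms by auto
  have "submatrix A ({..<Suc n} - {i}) ({..<Suc n} - {j}) $$ (a, c) =
      A $$ (insert_index i a, insert_index j c)"
    using assms ac card_remove by (subst submatrix_index) (auto simp: pick_remove)
  then show "submatrix A ({..<Suc n} - {i}) ({..<Suc n} - {j}) $$ (a, c) = mat_delete A i j $$ (a, c)"
    using mat_delete_index[of A n i j a c] assms ac by simp
qed (use assms card_remove in \<open>auto simp: dim_submatrix\<close>)

lemma finite_minors:
  "finite {\<bar>det (submatrix A I J)\<bar> |I J.
     I \<subseteq> {..<dim_row A} \<and> card I = k \<and> J \<subseteq> {..<dim_col A} \<and> card J = k}"
proof (rule finite_subset)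
  show "{\<bar>det (submatrix A I J)\<bar> |I J.
     I \<subseteq> {..<dim_row A} \<and> card I = k \<and> J \<subseteq> {..<dim_col A} \<and> card J = k} \<subseteq>
     (\<lambda>(I, J). \<bar>det (submatrix A I J)\<bar>) ` (Pow {..<dim_row A} \<times> Pow {..<dim_col A})"
    by auto
qed simp

lemma minor_le_max_minor:
  assumes "I \<subseteq> {..<dim_row A}" "card I = k" "J \<subseteq> {..<dim_col A}" "card J = k"
  shows "\<bar>det (submatrix A I J)\<bar> \<le> max_minor k A"
  unfolding max_minor_def by (rule Max_ge[OF finite_minors]) (use assms in auto)

lemma abs_cofactor: "\<bar>cofactor A i j\<bar> = \<bar>det (mat_delete (A :: int mat) i j)\<bar>"
  by (simp add: cofactor_def abs_mult power_abs)

text \<open>Up to the factor \<open>\<beta>\<close> this is the width along the combination of the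
  rows with coefficients \<open>t\<close>, see \<open>width_along_eq\<close>.\<close>

definition oscillation :: "nat \<Rightarrow> (nat \<Rightarrow> int) \<Rightarrow> (nat \<Rightarrow> real) \<Rightarrow> real" where
  "oscillation n y t = Max ((\<lambda>k. t k / y k) ` {..n}) - Min ((\<lambda>k. t k / y k) ` {..n})"

locale hnf_simplex =
  fixes n :: nat and H :: "int mat" and b :: "int vec"
  assumes n_pos: "n \<ge> 1" and H: "H \<in> carrier_mat (n + 1) n" and rank: "int_rank H = n"
    and hnf: "reduced_hnf H" and b: "b \<in> carrier_vec (n + 1)"
    and simplex: "is_simplex n (polyhedron H b)"
begin

abbreviation "h k i \<equiv> H $$ (k, i)"

section \<open>The dependency of the rows and the triangular block\<close>

definition "Aug = augmented H b"

text \<open>Cofactors of the column \<open>b\<close> of the augmented matrix do not involve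
  \<open>b\<close>: they are the maximal minors of \<open>H\<close>, already with the signs of a
  linear dependency.\<close>

definition y :: "nat \<Rightarrow> int" where "y k = cofactor Aug k n"

definition "D = det (mat n n (\<lambda>(i, j). h i j))"

lemma Aug: "Aug \<in> carrier_mat (Suc n) (Suc n)"
  using H by (auto simp: Aug_def augmented_def)

lemma Aug_index: "k \<le> n \<Longrightarrow> i < n \<Longrightarrow> Aug $$ (k, i) = h k i" "k \<le> n \<Longrightarrow> Aug $$ (k, n) = b $ k"
  using H by (auto simp: Aug_def augmented_def)

lemma upper_zero: "i < j \<Longrightarrow> j < n \<Longrightarrow> h i j = 0"
  and off_diagonal: "j < i \<Longrightarrow> i < n \<Longrightarrow> 0 \<le> h i j \<and> h i j < h i i"
  and diagonal_pos: "i < n \<Longrightarrow> 1 \<le> h i i"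
proof -
  have dc: "dim_col H = n" using H by auto
  show "i < j \<Longrightarrow> j < n \<Longrightarrow> h i j = 0" "j < i \<Longrightarrow> i < n \<Longrightarrow> 0 \<le> h i j \<and> h i j < h i i"
    using hnf unfolding reduced_hnf_def Let_def dc by blast+
  obtain s where s: "\<forall>i<s. h i i = 1" "\<forall>i. s \<le> i \<and> i < n \<longrightarrow> 2 \<le> h i i"
    using hnf unfolding reduced_hnf_def Let_def dc by blast
  show "1 \<le> h i i" if "i < n"
  proof (cases "i < s")
    case False
    then have "2 \<le> h i i" using s that by simp
    then show ?thesis by simp
  qed (use s in simp)
qed

lemma D_eq: "D = (\<Prod>i<n. h i i)"
proof -
  have "D = prod_list (diag_mat (mat n n (\<lambda>(i, j). h i j)))"
    unfolding D_def by (rule det_lower_triangular[of n]) (use upper_zero in auto)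
  also have "\<dots> = (\<Prod>i<n. h i i)"
    by (simp add: prod_list_diag_prod lessThan_atLeast0)
  finally show ?thesis .
qed

lemma D_pos: "0 < D"
  unfolding D_eq by (rule prod_pos) (use diagonal_pos in force)

lemma y_n: "y n = D"
proof -
  have "mat_delete Aug n n = mat n n (\<lambda>(i, j). h i j)"
    using Aug Aug_index by (intro eq_matI) (auto simp: mat_delete_def)
  then show ?thesis by (simp add: y_def D_def cofactor_def)
qed

text \<open>An off-diagonal entry of the adjugate times \<open>Aug\<close>, that is, the expansion
  of a determinant with a repeated column.\<close>

lemma sum_y_rows: "i < n \<Longrightarrow> (\<Sum>k\<le>n. y k * h k i) = 0"
proof -
  assume i: "i < n"
  have "(adj_mat Aug * Aug) $$ (n, i) = 0"
    unfolding adj_mat(3)[OF Aug] using i by simp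
  also have "(adj_mat Aug * Aug) $$ (n, i) = (\<Sum>k<Suc n. adj_mat Aug $$ (n, k) * Aug $$ (k, i))"
    using Aug adj_mat(1)[OF Aug] i by (simp add: scalar_prod_def lessThan_atLeast0)
  also have "\<dots> = (\<Sum>k\<le>n. y k * h k i)"
    unfolding lessThan_Suc_atMost using Aug i
    by (intro sum.cong) (auto simp: adj_mat_def y_def Aug_index)
  finally show ?thesis by simp
qed

definition "adj i j = adj_mat (mat n n (\<lambda>(i, j). h i j)) $$ (i, j)"

lemma adj_left: "i < n \<Longrightarrow> j < n \<Longrightarrow> (\<Sum>k<n. adj i k * h k j) = (if i = j then D else 0)"
  and adj_right: "i < n \<Longrightarrow> j < n \<Longrightarrow> (\<Sum>k<n. h i k * adj k j) = (if i = j then D else 0)"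
proof -
  let ?B = "mat n n (\<lambda>(i, j). h i j)"
  have B: "?B \<in> carrier_mat n n" by simp
  assume ij: "i < n" "j < n"
  have "(adj_mat ?B * ?B) $$ (i, j) = (\<Sum>k<n. adj i k * h k j)"
    using ij adj_mat(1)[OF B] by (simp add: scalar_prod_def lessThan_atLeast0 adj_def)
  then show "(\<Sum>k<n. adj i k * h k j) = (if i = j then D else 0)"
    unfolding adj_mat(3)[OF B] using ij by (simp add: D_def split: if_splits)
  have "(?B * adj_mat ?B) $$ (i, j) = (\<Sum>k<n. h i k * adj k j)"
    using ij adj_mat(1)[OF B] by (simp add: scalar_prod_def lessThan_atLeast0 adj_def)
  then show "(\<Sum>k<n. h i k * adj k j) = (if i = j then D else 0)"
    unfolding adj_mat(2)[OF B] using ij by (simp add: D_def split: if_splits)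
qed

text \<open>The product of \<open>c\<close> with the adjugate of the triangular block serves as
  \<open>\<tau>\<close>. This is why coefficients of integer directions become integers after
  scaling by \<open>D\<close>.\<close>

lemma left_solution: "\<exists>\<tau> :: nat \<Rightarrow> int. \<forall>i<n. (\<Sum>k<n. \<tau> k * h k i) = D * c i"
proof (intro exI allI impI)
  fix i assume i: "i < n"
  have "(\<Sum>k<n. (\<Sum>j<n. c j * adj j k) * h k i) = (\<Sum>j<n. c j * (\<Sum>k<n. adj j k * h k i))"
    unfolding sum_distrib_left sum_distrib_right by (subst sum.swap) (simp add: mult.assoc)
  also have "\<dots> = (\<Sum>j<n. c j * (if j = i then D else 0))"
    using i by (intro sum.cong) (auto simp: adj_left)
  finally show "(\<Sum>k<n. (\<Sum>j<n. c j * adj j k) * h k i) = D * c i"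
    using i by (simp add: mult.commute if_distrib[of "\<lambda>x. _ * x"] cong: if_cong)
qed

lemma right_solution: "\<exists>x :: nat \<Rightarrow> real. \<forall>k<n. (\<Sum>i<n. real_of_int (h k i) * x i) = z k"
proof (intro exI allI impI)
  fix k assume k: "k < n"
  have "(\<Sum>i<n. real_of_int (h k i) * ((\<Sum>j<n. real_of_int (adj i j) * z j) / D)) =
      (\<Sum>j<n. (\<Sum>i<n. real_of_int (h k i) * real_of_int (adj i j)) * z j / D)"
    unfolding sum_distrib_left sum_distrib_right sum_divide_distrib
    by (subst sum.swap) (simp add: mult.assoc)
  also have "\<dots> = (\<Sum>j<n. (if k = j then real_of_int D else 0) * z j / D)"
  proof (intro sum.cong refl)
    fix j assume "j \<in> {..<n}"
    then have "real_of_int (\<Sum>i<n. h k i * adj i j) = (if k = j then real_of_int D else 0)"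
      using k by (simp add: adj_right)
    then show "(\<Sum>i<n. real_of_int (h k i) * real_of_int (adj i j)) * z j / D =
        (if k = j then real_of_int D else 0) * z j / D" by simp
  qed
  also have "\<dots> = (\<Sum>j<n. if k = j then z j else 0)"
    using D_pos by (intro sum.cong) auto
  also have "\<dots> = z k" using k by simp
  finally show "(\<Sum>i<n. real_of_int (h k i) * ((\<Sum>j<n. real_of_int (adj i j) * z j) / D)) = z k" .
qed

section \<open>Points described by the values of the constraint rows\<close>

definition g :: "real vec \<Rightarrow> nat \<Rightarrow> real" where
  "g x k = (\<Sum>i<n. real_of_int (h k i) * x $ i)"

lemma mem_polyhedron:
  "x \<in> polyhedron H b \<longleftrightarrow> x \<in> carrier_vec n \<and> (\<forall>k\<le>n. g x k \<le> real_of_int (b $ k))"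
proof -
  have "(map_mat real_of_int H *\<^sub>v x) $ k = g x k" if "k \<le> n" "x \<in> carrier_vec n" for k
    using that H by (auto simp: g_def scalar_prod_def lessThan_atLeast0 intro!: sum.cong)
  then show ?thesis using H b
    by (auto simp: polyhedron_def less_eq_vec_def carrier_matD less_Suc_eq_le)
qed

lemma sum_y_g: "(\<Sum>k\<le>n. real_of_int (y k) * g x k) = 0"
proof -
  have "(\<Sum>k\<le>n. real_of_int (y k) * g x k) =
      (\<Sum>i<n. (\<Sum>k\<le>n. real_of_int (y k) * real_of_int (h k i)) * x $ i)"
    unfolding g_def sum_distrib_left sum_distrib_right by (subst sum.swap) (simp add: mult.assoc)
  also have "\<dots> = 0"
  proof (intro sum.neutral ballI)
    fix i assume "i \<in> {..<n}"
    then have "real_of_int (\<Sum>k\<le>n. y k * h k i) = 0" using sum_y_rows by simp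
    then show "(\<Sum>k\<le>n. real_of_int (y k) * real_of_int (h k i)) * x $ i = 0" by simp
  qed
  finally show ?thesis .
qed

text \<open>The triangular block is invertible, so the first \<open>n\<close> values can be
  prescribed; the dependency then forces the last one because \<open>y n = D\<close> is not
  0.\<close>

lemma exists_point:
  assumes "(\<Sum>k\<le>n. real_of_int (y k) * z k) = 0"
  shows "\<exists>x\<in>carrier_vec n. \<forall>k\<le>n. g x k = z k"
proof -
  obtain x0 where x0: "\<forall>k<n. (\<Sum>i<n. real_of_int (h k i) * x0 i) = z k"
    using right_solution by blast
  define x where "x = vec n x0"
  have gx: "g x k = z k" if "k < n" for k using x0 that by (simp add: g_def x_def)
  have "(\<Sum>k<n. real_of_int (y k) * g x k) + real_of_int (y n) * g x n = 0"
    using sum_y_g[of x] by (simp add: lessThan_Suc_atMost[symmetric])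
  moreover have "(\<Sum>k<n. real_of_int (y k) * z k) + real_of_int (y n) * z n = 0"
    using assms by (simp add: lessThan_Suc_atMost[symmetric])
  moreover have "(\<Sum>k<n. real_of_int (y k) * g x k) = (\<Sum>k<n. real_of_int (y k) * z k)"
    by (intro sum.cong) (auto simp: gx)
  ultimately have "real_of_int (y n) * g x n = real_of_int (y n) * z n" by linarith
  then have "g x n = z n" using y_n D_pos by simp
  then have "\<forall>k\<le>n. g x k = z k" using gx le_neq_implies_less by blast
  moreover have "x \<in> carrier_vec n" by (simp add: x_def)
  ultimately show ?thesis by blast
qed

lemma polyhedron_nonempty: "\<exists>x. x \<in> polyhedron H b"
  and polyhedron_bounded: "\<exists>K. \<forall>x\<in>polyhedron H b. \<forall>i<n. \<bar>x $ i\<bar> \<le> K i"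
proof -
  obtain V where V: "V \<noteq> {}" "affinely_independent n V" "polyhedron H b = finite_convex_hull n V"
    using simplex unfolding is_simplex_def by blast
  then have fin: "finite V" by (simp add: affinely_independent_def)
  obtain v where v: "v \<in> V" using V by blast
  have "vec n (\<lambda>i. \<Sum>w\<in>V. (if w = v then 1 else 0) * w $ i) \<in> polyhedron H b"
    unfolding V(3) finite_convex_hull_def using fin v by auto
  then show "\<exists>x. x \<in> polyhedron H b" by blast
  have "\<bar>x $ i\<bar> \<le> (\<Sum>v\<in>V. \<bar>v $ i\<bar>)" if x: "x \<in> polyhedron H b" and i: "i < n" for x i
  proof -
    obtain u where u: "x = vec n (\<lambda>i. \<Sum>v\<in>V. u v * v $ i)" "\<forall>v\<in>V. 0 \<le> u v" "(\<Sum>v\<in>V. u v) = 1"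
      using x unfolding V(3) finite_convex_hull_def by blast
    have u1: "u v \<le> 1" if "v \<in> V" for v
      using member_le_sum[of v V u] that u fin by auto
    have "\<bar>x $ i\<bar> \<le> (\<Sum>v\<in>V. \<bar>u v * v $ i\<bar>)" using u i by (simp add: sum_abs)
    also have "\<dots> \<le> (\<Sum>v\<in>V. \<bar>v $ i\<bar>)"
    proof (intro sum_mono)
      fix v assume v: "v \<in> V"
      have "\<bar>u v * v $ i\<bar> = u v * \<bar>v $ i\<bar>" using u v by (simp add: abs_mult)
      also have "\<dots> \<le> 1 * \<bar>v $ i\<bar>" using u1[OF v] by (intro mult_right_mono) auto
      finally show "\<bar>u v * v $ i\<bar> \<le> \<bar>v $ i\<bar>" by simp
    qed
    finally show ?thesis .
  qed
  then show "\<exists>K. \<forall>x\<in>polyhedron H b. \<forall>i<n. \<bar>x $ i\<bar> \<le> K i"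
    by (intro exI[of _ "\<lambda>i. \<Sum>v\<in>V. \<bar>v $ i\<bar>"]) blast
qed

text \<open>Here boundedness enters: a coefficient \<open>y k \<le> 0\<close> would allow a non-zero
  direction along which no constraint increases, and a non-empty polyhedron with such a direction is
  unbounded.\<close>

lemma y_pos:
  assumes "k \<le> n"
  shows "0 < y k"
proof (rule ccontr)
  assume neg: "\<not> 0 < y k"
  then have "k \<noteq> n" using y_n D_pos by auto
  then have kn: "k < n" using assms by simp
  \<comment> \<open>The value -1 at \<open>k\<close> makes the direction non-zero; the value at
    \<open>n\<close> is what the dependency then demands, and it is at most 0 since
    \<open>y k \<le> 0\<close>.\<close>
  define z where "z l = (if l = k then - 1 else if l = n then real_of_int (y k) / D else 0)" for l
  have "(\<Sum>l\<le>n. real_of_int (y l) * z l) = real_of_int (y k) * z k + real_of_int (y n) * z n"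
  proof -
    have "(\<Sum>l\<le>n. real_of_int (y l) * z l) = (\<Sum>l\<in>{k, n}. real_of_int (y l) * z l)"
      by (rule sum.mono_neutral_right) (use kn in \<open>auto simp: z_def\<close>)
    then show ?thesis using kn by simp
  qed
  also have "\<dots> = 0" using kn D_pos by (simp add: z_def y_n)
  finally have "\<exists>d\<in>carrier_vec n. \<forall>l\<le>n. g d l = z l" by (rule exists_point)
  then obtain d where d: "d \<in> carrier_vec n" "\<And>l. l \<le> n \<Longrightarrow> g d l = z l" by blast
  have z: "z l \<le> 0" for l using neg D_pos by (auto simp: z_def divide_nonpos_pos)
  have "\<exists>i<n. d $ i \<noteq> 0"
  proof (rule ccontr)
    assume "\<not> (\<exists>i<n. d $ i \<noteq> 0)"
    then have "g d k = 0" unfolding g_def by (intro sum.neutral) simp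
    moreover have "g d k = - 1" using d(2)[OF assms] unfolding z_def by simp
    ultimately show False by simp
  qed
  then obtain i where i: "i < n" "d $ i \<noteq> 0" by blast
  obtain x where x: "x \<in> polyhedron H b" using polyhedron_nonempty by blast
  then have xc: "x \<in> carrier_vec n" by (simp add: mem_polyhedron)
  obtain K where "\<forall>x\<in>polyhedron H b. \<forall>i<n. \<bar>x $ i\<bar> \<le> K i" using polyhedron_bounded by blast
  then have K: "\<And>x i. x \<in> polyhedron H b \<Longrightarrow> i < n \<Longrightarrow> \<bar>x $ i\<bar> \<le> K i" by blast
  \<comment> \<open>Far enough along \<open>d\<close> for coordinate \<open>i\<close> to exceed
    \<open>K i\<close> in absolute value.\<close>
  define s where "s = (K i + \<bar>x $ i\<bar> + 1) / \<bar>d $ i\<bar>"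
  have Ki: "0 \<le> K i" using K[OF x i(1)] by linarith
  have s: "0 \<le> s" using Ki by (simp add: s_def)
  have xd: "x + s \<cdot>\<^sub>v d \<in> polyhedron H b"
    unfolding mem_polyhedron
  proof (intro conjI allI impI)
    show "x + s \<cdot>\<^sub>v d \<in> carrier_vec n" using xc d(1) by simp
    fix l assume l: "l \<le> n"
    have "g (x + s \<cdot>\<^sub>v d) l = (\<Sum>i<n. real_of_int (h l i) * x $ i + s * (real_of_int (h l i) * d $ i))"
      unfolding g_def using xc d(1) by (intro sum.cong) (auto simp: algebra_simps)
    also have "\<dots> = g x l + s * g d l"
      unfolding g_def sum.distrib sum_distrib_left ..
    also have "\<dots> \<le> b $ l + s * 0"
      using x l z[of l] s d(2)[OF l] by (intro add_mono mult_left_mono) (auto simp: mem_polyhedron)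
    finally show "g (x + s \<cdot>\<^sub>v d) l \<le> real_of_int (b $ l)" by simp
  qed
  have "\<bar>x $ i + s * d $ i\<bar> \<le> K i"
    using K[OF xd i(1)] xc d(1) i by simp
  moreover have "\<bar>s * d $ i\<bar> = K i + \<bar>x $ i\<bar> + 1"
    using i s Ki by (simp add: abs_mult s_def)
  ultimately show False by linarith
qed

definition "\<beta> = (\<Sum>k\<le>n. y k * b $ k)"

text \<open>Any point of the polyhedron shows it, by weighting its slacks with \<open>y\<close>. A
  single point also counts as a simplex and has \<open>\<beta> = 0\<close>, so
  \<open>\<beta>\<close> never serves as a divisor later.\<close>

lemma beta_nonneg: "0 \<le> \<beta>"
proof -
  obtain x where x: "x \<in> polyhedron H b" using polyhedron_nonempty by blast
  have "0 = (\<Sum>k\<le>n. real_of_int (y k) * g x k)" using sum_y_g by simp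
  also have "\<dots> \<le> (\<Sum>k\<le>n. real_of_int (y k) * real_of_int (b $ k))"
    using x y_pos by (intro sum_mono mult_left_mono) (force simp: mem_polyhedron)+
  also have "\<dots> = real_of_int \<beta>" by (simp add: \<beta>_def)
  finally show ?thesis by simp
qed

text \<open>The slack of facet \<open>j\<close> at the opposite vertex is \<open>\<beta> / y j\<close>.\<close>

lemma vertex:
  assumes "j \<le> n"
  obtains x where "x \<in> polyhedron H b"
    "\<And>k. k \<le> n \<Longrightarrow> g x k = b $ k - (if k = j then real_of_int \<beta> / y j else 0)"
proof -
  have "(\<Sum>k\<le>n. real_of_int (y k) * (b $ k - (if k = j then real_of_int \<beta> / y j else 0))) =
      (\<Sum>k\<le>n. real_of_int (y k * b $ k) - (if k = j then real_of_int \<beta> else 0))"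
    using y_pos[OF assms] by (intro sum.cong) (auto simp: right_diff_distrib)
  also have "\<dots> = 0" using assms by (simp only: sum_subtractf of_int_sum[symmetric] \<beta>_def[symmetric]) simp
  finally have "\<exists>x\<in>carrier_vec n. \<forall>k\<le>n. g x k = b $ k - (if k = j then real_of_int \<beta> / y j else 0)"
    by (rule exists_point)
  then obtain x where x: "x \<in> carrier_vec n"
    "\<forall>k\<le>n. g x k = b $ k - (if k = j then real_of_int \<beta> / y j else 0)" by blast
  moreover have "0 \<le> real_of_int \<beta> / y j" using beta_nonneg y_pos[OF assms] by simp
  ultimately have "x \<in> polyhedron H b" unfolding mem_polyhedron by auto
  then show ?thesis using that x by blast
qed

lemma sum_shift:
  fixes t z :: "nat \<Rightarrow> real" and \<mu> :: real
  shows "(\<Sum>k\<le>n. (t k - \<mu> * y k) * z k) = (\<Sum>k\<le>n. t k * z k) - \<mu> * (\<Sum>k\<le>n. real_of_int (y k) * z k)"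
  by (simp add: sum_subtractf sum_distrib_left algebra_simps)

text \<open>Linear programming duality with explicit certificates. Subtracting \<open>Min U\<close>
  times the dependency leaves coefficients that are not negative, so the constraints bound
  \<open>f\<close> termwise from above; \<open>Max U\<close> gives the bound from below in the same
  way. Both bounds are attained at vertices.\<close>

lemma width_along_eq:
  fixes t :: "nat \<Rightarrow> real"
  assumes c: "c \<in> carrier_vec n" and t: "\<And>i. i < n \<Longrightarrow> real_of_int (c $ i) = (\<Sum>k\<le>n. t k * h k i)"
  shows "width_along (polyhedron H b) c = \<beta> * oscillation n y t"
proof -
  define f where "f x = (\<Sum>k\<le>n. t k * g x k)" for x
  define F where "F = (\<Sum>k\<le>n. t k * real_of_int (b $ k))"
  have cx: "map_vec real_of_int c \<bullet> x = f x" if "x \<in> polyhedron H b" for x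
  proof -
    have "map_vec real_of_int c \<bullet> x = (\<Sum>i<n. (\<Sum>k\<le>n. t k * h k i) * x $ i)"
      using that c t by (auto simp: scalar_prod_def mem_polyhedron lessThan_atLeast0 intro!: sum.cong)
    also have "\<dots> = f x"
      unfolding f_def g_def sum_distrib_left sum_distrib_right
      by (subst sum.swap) (simp add: mult.assoc)
    finally show ?thesis .
  qed
  define U where "U = (\<lambda>k. t k / real_of_int (y k)) ` {..n}"
  have U: "finite U" "U \<noteq> {}" by (auto simp: U_def)
  have at_vertex: "\<exists>x\<in>polyhedron H b. f x = F - \<beta> * u" if "u \<in> U" for u :: real
  proof -
    obtain j where j: "j \<le> n" "u = t j / y j" using \<open>u \<in> U\<close> by (auto simp: U_def)
    obtain x where x: "x \<in> polyhedron H b"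
      "\<And>k. k \<le> n \<Longrightarrow> g x k = b $ k - (if k = j then real_of_int \<beta> / y j else 0)"
      using vertex[OF j(1)] by blast
    have "f x = (\<Sum>k\<le>n. t k * b $ k - (if k = j then t j * (real_of_int \<beta> / y j) else 0))"
      unfolding f_def by (intro sum.cong) (auto simp: x(2) right_diff_distrib)
    also have "\<dots> = F - t j * (real_of_int \<beta> / y j)"
      using j unfolding sum_subtractf F_def by simp
    finally have "f x = F - t j * (real_of_int \<beta> / y j)" .
    then show ?thesis using x(1) j by (intro bexI[of _ x]) (auto simp: mult.commute)
  qed
  have "(SUP x\<in>polyhedron H b. map_vec real_of_int c \<bullet> x) = F - \<beta> * Min U"
  proof (rule cSup_eq_maximum)
    show "F - \<beta> * Min U \<in> (\<lambda>x. map_vec real_of_int c \<bullet> x) ` polyhedron H b"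
      using at_vertex[OF Min_in[OF U]] cx by force
    fix w assume "w \<in> (\<lambda>x. map_vec real_of_int c \<bullet> x) ` polyhedron H b"
    then obtain x where x: "x \<in> polyhedron H b" "w = f x" using cx by auto
    have "f x = (\<Sum>k\<le>n. (t k - Min U * y k) * g x k)" unfolding sum_shift sum_y_g f_def by simp
    also have "\<dots> \<le> (\<Sum>k\<le>n. (t k - Min U * y k) * b $ k)"
    proof (intro sum_mono mult_left_mono)
      fix k assume k: "k \<in> {..n}"
      then have "Min U \<le> t k / y k" using U by (intro Min_le) (auto simp: U_def)
      then show "0 \<le> t k - Min U * y k" using y_pos[of k] k by (simp add: pos_le_divide_eq)
    qed (use x in \<open>auto simp: mem_polyhedron\<close>)
    also have "\<dots> = F - \<beta> * Min U" unfolding sum_shift F_def \<beta>_def by simp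
    finally show "w \<le> F - \<beta> * Min U" using x by simp
  qed
  moreover have "(INF x\<in>polyhedron H b. map_vec real_of_int c \<bullet> x) = F - \<beta> * Max U"
  proof (rule cInf_eq_minimum)
    show "F - \<beta> * Max U \<in> (\<lambda>x. map_vec real_of_int c \<bullet> x) ` polyhedron H b"
      using at_vertex[OF Max_in[OF U]] cx by force
    fix w assume "w \<in> (\<lambda>x. map_vec real_of_int c \<bullet> x) ` polyhedron H b"
    then obtain x where x: "x \<in> polyhedron H b" "w = f x" using cx by auto
    have "F - \<beta> * Max U = (\<Sum>k\<le>n. (t k - Max U * y k) * b $ k)" unfolding sum_shift F_def \<beta>_def by simp
    also have "\<dots> \<le> (\<Sum>k\<le>n. (t k - Max U * y k) * g x k)"
    proof (intro sum_mono mult_left_mono_neg)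
      fix k assume k: "k \<in> {..n}"
      then have "t k / y k \<le> Max U" using U by (intro Max_ge) (auto simp: U_def)
      then show "t k - Max U * y k \<le> 0" using y_pos[of k] k by (simp add: pos_divide_le_eq)
    qed (use x in \<open>auto simp: mem_polyhedron\<close>)
    also have "\<dots> = f x" unfolding sum_shift sum_y_g f_def by simp
    finally show "F - \<beta> * Max U \<le> w" using x by simp
  qed
  ultimately show ?thesis unfolding width_along_def oscillation_def U_def[symmetric] by (simp add: algebra_simps)
qed

section \<open>Bounds on the data in terms of minors\<close>

lemma y_le_Delta: "k \<le> n \<Longrightarrow> y k \<le> Delta H"
proof -
  assume k: "k \<le> n"
  let ?I = "{..<Suc n} - {k}"
  have "submatrix H ?I {..<n} = submatrix Aug ?I ({..<Suc n} - {n})"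
  proof (rule eq_matI)
    fix i j assume "i < dim_row (submatrix Aug ?I ({..<Suc n} - {n}))"
      "j < dim_col (submatrix Aug ?I ({..<Suc n} - {n}))"
    then have ij: "i < n" "j < n" using Aug k card_remove by (auto simp: dim_submatrix)
    have e: "{..<Suc n} - {n} = {..<n}" by auto
    have "insert_index k i \<le> n" using ij by (auto simp: insert_index_def)
    moreover have c: "card {a. a < n \<and> a \<in> {..<n}} = n" "card {a. a < Suc n \<and> a \<in> {..<n}} = n"
    proof -
      have "{a. a < n \<and> a \<in> {..<n}} = {..<n}" "{a. a < Suc n \<and> a \<in> {..<n}} = {..<n}" by auto
      then show "card {a. a < n \<and> a \<in> {..<n}} = n" "card {a. a < Suc n \<and> a \<in> {..<n}} = n" by simp_all
    qed
    ultimately show "submatrix H ?I {..<n} $$ (i, j) = submatrix Aug ?I ({..<Suc n} - {n}) $$ (i, j)"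
      unfolding e using H Aug ij k card_remove[OF k]
      by (subst (1 2) submatrix_index) (auto simp: pick_remove pick_lessThan Aug_index carrier_matD)
  qed (use H Aug k card_remove[of n n] in \<open>auto simp: dim_submatrix intro!: arg_cong[of _ _ card]\<close>)
  then have "y k \<le> \<bar>det (submatrix H ?I {..<n})\<bar>"
    using submatrix_eq_mat_delete[OF Aug k, of n] abs_cofactor[of Aug k n] by (simp add: y_def)
  also have "\<dots> \<le> Delta H"
    unfolding Delta_def rank by (rule minor_le_max_minor) (use H k in auto)
  finally show ?thesis .
qed

lemma cofactor_le: "k \<le> n \<Longrightarrow> i \<le> n \<Longrightarrow> \<bar>cofactor Aug k i\<bar> \<le> Delta_aug H b"
proof -
  assume ki: "k \<le> n" "i \<le> n"
  have "\<bar>cofactor Aug k i\<bar> = \<bar>det (submatrix Aug ({..<Suc n} - {k}) ({..<Suc n} - {i}))\<bar>"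
    by (simp add: abs_cofactor submatrix_eq_mat_delete[OF Aug ki])
  also have "\<dots> \<le> max_minor n Aug"
    by (rule minor_le_max_minor) (use Aug ki in auto)
  finally show ?thesis using H by (simp add: Delta_aug_def Aug_def)
qed

text \<open>An entry of the block is at most the diagonal entry of its row, which is one of the
  positive factors of \<open>D\<close>.\<close>

lemma entry_le: "k < n \<Longrightarrow> i < n \<Longrightarrow> 0 \<le> h k i \<and> h k i \<le> h k k \<and> h k i \<le> D"
proof -
  assume ki: "k < n" "i < n"
  have 1: "0 \<le> h k i \<and> h k i \<le> h k k"
    using upper_zero[of k i] off_diagonal[of i k] diagonal_pos[of k] ki
    by (cases i k rule: linorder_cases) auto
  have "D = h k k * (\<Prod>i\<in>{..<n} - {k}. h i i)"
    unfolding D_eq using ki by (subst prod.remove[of _ k]) auto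
  moreover have "1 \<le> (\<Prod>i\<in>{..<n} - {k}. h i i)" by (rule prod_ge_1) (use diagonal_pos in auto)
  ultimately have "h k k \<le> D"
    using diagonal_pos[OF ki(1)] mult_left_mono[of 1 "\<Prod>i\<in>{..<n} - {k}. h i i" "h k k"] by simp
  then show ?thesis using 1 by linarith
qed

text \<open>Solve the dependency for the last row, whose coefficient is \<open>D\<close>; the
  entries of the block are at most \<open>D\<close>, so this factor cancels.\<close>

lemma last_row_le: "i < n \<Longrightarrow> \<bar>h n i\<bar> \<le> int n * Delta H"
proof -
  assume i: "i < n"
  have "D * h n i = - (\<Sum>k<n. y k * h k i)"
    using sum_y_rows[OF i] by (simp add: lessThan_Suc_atMost[symmetric] y_n)
  then have "D * \<bar>h n i\<bar> = \<bar>\<Sum>k<n. y k * h k i\<bar>" using D_pos by (metis abs_minus abs_mult abs_of_pos)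
  also have "\<dots> \<le> (\<Sum>k<n. \<bar>y k * h k i\<bar>)" by (rule sum_abs)
  also have "\<dots> \<le> (\<Sum>k<n. Delta H * D)"
  proof (intro sum_mono)
    fix k assume k: "k \<in> {..<n}"
    then have "0 < y k" "y k \<le> Delta H" using y_pos y_le_Delta by auto
    moreover have "0 \<le> h k i" "h k i \<le> D" using entry_le k i by auto
    ultimately show "\<bar>y k * h k i\<bar> \<le> Delta H * D" by (simp add: abs_mult mult_mono)
  qed
  finally have "D * \<bar>h n i\<bar> \<le> D * (int n * Delta H)" by (simp add: ac_simps)
  then show ?thesis using D_pos by simp
qed

lemma Delta_pos: "1 \<le> Delta H" "D \<le> Delta H"
  using y_le_Delta[of n] D_pos y_n by auto

lemma row_le: "k \<le> n \<Longrightarrow> i < n \<Longrightarrow> \<bar>h k i\<bar> \<le> int n * Delta H"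
proof (cases "k = n")
  case False
  assume "k \<le> n" "i < n"
  then have "\<bar>h k i\<bar> \<le> D" using entry_le[of k i] False by auto
  also have "D \<le> 1 * Delta H" using Delta_pos by simp
  also have "\<dots> \<le> int n * Delta H" using n_pos Delta_pos by (intro mult_right_mono) auto
  finally show ?thesis .
qed (use last_row_le in auto)

lemma Delta_le_Delta_aug: "k \<le> n \<Longrightarrow> y k \<le> Delta_aug H b"
  using cofactor_le[of k n] by (simp add: y_def)

text \<open>Expanding row \<open>k\<close> against the cofactors of another row \<open>k'\<close>
  gives 0. This expresses \<open>b $ k * y k'\<close> by entries of \<open>H\<close> and bounded
  cofactors, and \<open>y k' \<ge> 1\<close>.\<close>

lemma rhs_le:
  assumes "k \<le> n"
  shows "\<bar>b $ k\<bar> \<le> int n * (int n * Delta H) * Delta_aug H b"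
proof -
  \<comment> \<open>Any row other than \<open>k\<close> would do; one exists because
    \<open>n \<ge> 1\<close>.\<close>
  define k' where "k' = (if k = n then 0 else n)"
  have k': "k' \<le> n" "k' \<noteq> k" using n_pos assms by (auto simp: k'_def)
  have "(Aug * adj_mat Aug) $$ (k, k') = 0"
    unfolding adj_mat(2)[OF Aug] using k' assms by simp
  moreover have "(Aug * adj_mat Aug) $$ (k, k') = (\<Sum>i<Suc n. Aug $$ (k, i) * adj_mat Aug $$ (i, k'))"
    using Aug adj_mat(1)[OF Aug] k' assms by (simp add: scalar_prod_def lessThan_atLeast0)
  moreover have "\<dots> = (\<Sum>i<Suc n. Aug $$ (k, i) * cofactor Aug k' i)"
    using Aug k' by (intro sum.cong) (auto simp: adj_mat_def)
  ultimately have "b $ k * y k' = - (\<Sum>i<n. h k i * cofactor Aug k' i)"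
    using assms by (simp add: Aug_index y_def)
  then have eq: "\<bar>b $ k * y k'\<bar> = \<bar>\<Sum>i<n. h k i * cofactor Aug k' i\<bar>" by (metis abs_minus)
  have "\<bar>b $ k\<bar> * 1 \<le> \<bar>b $ k\<bar> * y k'" using y_pos[OF k'(1)] by (intro mult_left_mono) auto
  also have "\<dots> = \<bar>b $ k * y k'\<bar>" using y_pos[OF k'(1)] by (simp add: abs_mult)
  also have "\<dots> \<le> (\<Sum>i<n. \<bar>h k i * cofactor Aug k' i\<bar>)" unfolding eq by (rule sum_abs)
  also have "\<dots> \<le> (\<Sum>i<n. (int n * Delta H) * Delta_aug H b)"
    unfolding abs_mult using row_le assms cofactor_le k' Delta_pos
    by (intro sum_mono mult_mono) auto
  finally show ?thesis by (simp add: mult.assoc)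
qed

end

section \<open>Enumeration of the candidate directions\<close>

text \<open>The arithmetic of candidates, separated from the polyhedron and from \<open>b\<close>,
  so that the geometric argument and the verification of the program rest on the same facts.\<close>

locale dependent_rows =
  fixes n :: nat and h :: "nat \<Rightarrow> nat \<Rightarrow> int" and y :: "nat \<Rightarrow> int" and D :: int
  assumes n_pos: "1 \<le> n"
    and upper_zero: "\<And>i j. i < j \<Longrightarrow> j < n \<Longrightarrow> h i j = 0"
    and diagonal_pos: "\<And>i. i < n \<Longrightarrow> 1 \<le> h i i"
    and y_pos: "\<And>k. k \<le> n \<Longrightarrow> 0 < y k"
    and sum_y_rows: "\<And>i. i < n \<Longrightarrow> (\<Sum>k\<le>n. y k * h k i) = 0"
    and y_n: "y n = D"
    and D_eq: "D = (\<Prod>i<n. h i i)"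
    and left_solution: "\<And>c :: nat \<Rightarrow> int. \<exists>\<tau> :: nat \<Rightarrow> int. \<forall>i<n. (\<Sum>k<n. \<tau> k * h k i) = D * c i"
begin

lemma D_pos: "0 < D"
  using y_n y_pos by force

section \<open>Back substitution in the triangular block\<close>

definition tail :: "(nat \<Rightarrow> int) \<Rightarrow> nat \<Rightarrow> int" where
  "tail w i = (\<Sum>k\<in>{Suc i..n}. w k * h k i)"

definition column :: "(nat \<Rightarrow> int) \<Rightarrow> nat \<Rightarrow> int" where
  "column w i = (\<Sum>k\<le>n. w k * h k i)"

lemma column_from: "i < n \<Longrightarrow> column w i = (\<Sum>k\<in>{i..n}. w k * h k i)"
  unfolding column_def using upper_zero by (intro sum.mono_neutral_right) auto

lemma column_eq: "i < n \<Longrightarrow> column w i = w i * h i i + tail w i"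
  unfolding column_from tail_def by (simp add: sum.atLeast_Suc_atMost)

lemma tail_cong: "(\<And>k. i < k \<Longrightarrow> k \<le> n \<Longrightarrow> v k = w k) \<Longrightarrow> tail v i = tail w i"
  unfolding tail_def by (intro sum.cong) auto

text \<open>Induction from row \<open>n\<close> down to \<open>i0\<close>: in column
  \<open>k\<close> the contribution of the rows after \<open>k\<close> is already known, and
  \<open>h k k\<close> is not 0.\<close>

lemma triangular_unique:
  assumes "\<And>i. i0 \<le> i \<Longrightarrow> i < n \<Longrightarrow> column v i = column w i" "v n = w n" "i0 \<le> k" "k \<le> n"
  shows "v k = w k"
  using assms(3,4)
proof (induction "n - k" arbitrary: k rule: less_induct)
  case less
  show ?case
  proof (cases "k = n")
    case False
    then have k: "k < n" using less by simp
    have "tail v k = tail w k" by (rule tail_cong) (use less k in auto)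
    then have "v k * h k k = w k * h k k"
      using assms(1)[of k] column_eq[OF k] less k by simp
    then show ?thesis using diagonal_pos[OF k] by simp
  qed (use assms in simp)
qed

text \<open>The form in which the program computes the dependency, starting from
  \<open>y n = D\<close>; the division is exact.\<close>

lemma y_back_substitution: "i < n \<Longrightarrow> y i = (- tail y i) div h i i"
proof -
  assume i: "i < n"
  have "- tail y i = y i * h i i"
    using column_eq[OF i, of y] sum_y_rows[OF i] by (simp add: column_def)
  then show ?thesis using diagonal_pos[OF i] by simp
qed

section \<open>Residue classes of directions\<close>

text \<open>The coefficients \<open>w k / D\<close> combine the rows to an integer vector.\<close>

definition valid :: "(nat \<Rightarrow> int) \<Rightarrow> bool" where
  "valid w \<longleftrightarrow> (\<forall>i<n. D dvd column w i)"

text \<open>Mixed radix decoding of an index below \<open>D\<close>, row \<open>n - Suc l\<close> in step \<open>l\<close>.\<close>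

primrec decode :: "int \<Rightarrow> nat \<Rightarrow> int \<times> (nat \<Rightarrow> int)" where
  "decode a 0 = (a, \<lambda>_. 0)"
| "decode a (Suc l) = (let (x, w) = decode a l; i = n - Suc l in
     (x div h i i, w(i := ((- tail w i) mod D + D * (x mod h i i)) div h i i)))"

definition class_rep :: "int \<Rightarrow> nat \<Rightarrow> int" where
  "class_rep a = snd (decode a n)"

lemma decode_stable:
  assumes "l \<le> l'" "l' \<le> n" "n - l \<le> k"
  shows "snd (decode a l') k = snd (decode a l) k"
  using assms
proof (induction l' rule: dec_induct)
  case (step l')
  then show ?case by (auto simp: Let_def split: prod.splits)
qed simp

lemma class_rep_step:
  assumes "l < n" "i = n - Suc l"
  shows "class_rep a i = ((- tail (class_rep a) i) mod D + D * (fst (decode a l) mod h i i)) div h i i"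
proof -
  have "class_rep a i = snd (decode a (Suc l)) i"
    unfolding class_rep_def by (rule decode_stable) (use assms in auto)
  moreover have "tail (class_rep a) i = tail (snd (decode a l)) i"
    unfolding class_rep_def by (intro tail_cong decode_stable) (use assms in auto)
  ultimately show ?thesis using assms by (simp add: Let_def split: prod.splits)
qed

lemma class_rep_n: "class_rep a n = 0"
  unfolding class_rep_def using decode_stable[of 0 n n a] by simp

text \<open>The point is that the division in \<open>decode\<close> is exact for every digit.
  Prescribe an integer vector that agrees with the part already built in the columns after
  \<open>i\<close> and has the desired value in column \<open>i\<close>. Scaled by \<open>D\<close>
  it is an integer combination \<open>\<tau>\<close> of the rows, and \<open>\<tau>\<close> extends
  the part already built by \<open>triangular_unique\<close>; so \<open>\<tau> i\<close> is the
  quotient.\<close>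

lemma class_rep_exact:
  assumes l: "l < n" "i = n - Suc l"
  shows "class_rep a i * h i i = (- tail (class_rep a) i) mod D + D * (fst (decode a l) mod h i i) \<and>
    D dvd column (class_rep a) i"
  using l
proof (induction l arbitrary: i rule: less_induct)
  case (less l)
  then have i: "i < n" by simp
  let ?w = "class_rep a"
  have above: "D dvd column ?w i'" if "i < i'" "i' < n" for i'
    using less.IH[of "n - Suc i'" i'] that less.prems by auto
  define r where "r = (- tail ?w i) mod D + D * (fst (decode a l) mod h i i)"
  have Dr: "D dvd r + tail ?w i"
  proof -
    have "D dvd (- tail ?w i) mod D - (- tail ?w i)"
      by (rule mod_eq_dvd_iff[THEN iffD1]) simp
    then have "D dvd ((- tail ?w i) mod D - (- tail ?w i)) + D * (fst (decode a l) mod h i i)"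
      by (rule dvd_add) simp
    then show ?thesis by (simp add: r_def algebra_simps)
  qed
  \<comment> \<open>The columns before \<open>i\<close> do not influence the coefficients from
    \<open>i\<close> on, so 0 is as good as any value.\<close>
  define c where "c i' = (if i' < i then 0 else if i' = i then (r + tail ?w i) div D else column ?w i' div D)" for i'
  obtain \<tau>0 where \<tau>0: "\<forall>i<n. (\<Sum>k<n. \<tau>0 k * h k i) = D * c i" using left_solution by blast
  define \<tau> where "\<tau> k = (if k < n then \<tau>0 k else 0)" for k
  have col: "column \<tau> i' = D * c i'" if "i' < n" for i'
    using \<tau>0 that by (simp add: column_def \<tau>_def lessThan_Suc_atMost[symmetric])
  have "\<tau> k = ?w k" if "Suc i \<le> k" "k \<le> n" for k
  proof (rule triangular_unique[OF _ _ that])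
    fix i' assume i': "Suc i \<le> i'" "i' < n"
    then show "column \<tau> i' = column ?w i'" using col[of i'] above[of i'] by (simp add: c_def)
  qed (simp add: class_rep_n \<tau>_def)
  then have "tail \<tau> i = tail ?w i" by (intro tail_cong) auto
  then have "\<tau> i * h i i = r"
    using col[OF i] column_eq[OF i, of \<tau>] Dr by (simp add: c_def)
  then have "h i i dvd r" by (rule subst) simp
  then have "?w i * h i i = r"
    using class_rep_step[OF less.prems] by (simp add: r_def)
  moreover from this have "D dvd column ?w i" using Dr column_eq[OF i, of ?w] by simp
  ultimately show ?case by (simp add: r_def)
qed

lemma class_rep_valid: "valid (class_rep a)"
  unfolding valid_def
proof (intro allI impI)
  fix i assume "i < n"
  then show "D dvd column (class_rep a) i" using class_rep_exact[of "n - Suc i" i a] by auto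
qed

lemma class_rep_range: "k \<le> n \<Longrightarrow> 0 \<le> class_rep a k \<and> class_rep a k < D"
proof (cases "k = n")
  case False
  assume "k \<le> n"
  then have k: "k < n" using False by simp
  define x where "x = fst (decode a (n - Suc k)) mod h k k"
  have h: "1 \<le> h k k" using diagonal_pos[OF k] .
  have x: "0 \<le> x" "x \<le> h k k - 1" using h unfolding x_def by auto
  define r where "r = (- tail (class_rep a) k) mod D + D * x"
  have r: "class_rep a k * h k k = r"
    using class_rep_exact[of "n - Suc k" k a] k by (simp add: r_def x_def)
  have "0 \<le> r" using x D_pos by (simp add: r_def)
  then have 1: "0 \<le> class_rep a k" using h r by (auto simp: zero_le_mult_iff)
  have "D * x \<le> D * (h k k - 1)" using x D_pos by (intro mult_left_mono) auto
  then have "r < D * h k k" using pos_mod_bound[OF D_pos, of "- tail (class_rep a) k"]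
    by (simp add: r_def algebra_simps)
  then have "class_rep a k * h k k < D * h k k" using r by simp
  then have "class_rep a k < D" using h mult_less_cancel_right_pos[of "h k k" "class_rep a k" D] by linarith
  then show ?thesis using 1 by simp
qed (use class_rep_n D_pos in simp)

text \<open>In \<open>v i * h i i\<close> the remainder modulo \<open>D\<close> is forced by the
  rows after \<open>i\<close>; the quotient by \<open>D\<close> is a free digit below
  \<open>h i i\<close>. The product of these radices is \<open>D\<close>.\<close>

lemma class_rep_complete:
  assumes v: "valid v" "v n = 0" "\<And>k. k < n \<Longrightarrow> 0 \<le> v k \<and> v k < D"
  obtains a where "0 \<le> a" "a < D" "\<And>k. k \<le> n \<Longrightarrow> class_rep a k = v k"
proof -
  define d where "d i = (v i * h i i) div D" for i
  have dr: "v i * h i i = (- tail v i) mod D + D * d i" and d: "0 \<le> d i" "d i < h i i" if i: "i < n" for i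
  proof -
    have "D dvd column v i" using v(1) i by (simp add: valid_def)
    then have "D dvd v i * h i i - (- tail v i)" using column_eq[OF i, of v] by simp
    then have "(v i * h i i) mod D = (- tail v i) mod D" by (simp add: mod_eq_dvd_iff)
    then show "v i * h i i = (- tail v i) mod D + D * d i"
      using mod_mult_div_eq[of "v i * h i i" D] by (simp add: d_def)
    have h: "1 \<le> h i i" using diagonal_pos[OF i] .
    show "0 \<le> d i" unfolding d_def using v(3)[OF i] h D_pos by (simp add: pos_imp_zdiv_nonneg_iff)
    have "v i * h i i < h i i * D" using v(3)[OF i] h by (simp add: mult.commute)
    moreover have "D * d i \<le> v i * h i i"
      unfolding d_def using mult_div_mod_eq[of D "v i * h i i"] pos_mod_sign[OF D_pos, of "v i * h i i"] by linarith
    ultimately have "D * d i < D * h i i" by (simp add: mult.commute)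
    then show "d i < h i i" using D_pos by simp
  qed
  \<comment> \<open>Horner evaluation of the digits. Row \<open>n - 1\<close> is least significant,
    because \<open>decode\<close> reads it first.\<close>
  define Z where "Z = rec_nat 0 (\<lambda>i z. d i + h i i * z)"
  have Z0: "Z 0 = 0" and ZS: "Z (Suc i) = d i + h i i * Z i" for i by (simp_all add: Z_def)
  have Zb: "i \<le> n \<Longrightarrow> 0 \<le> Z i \<and> Z i < (\<Prod>k<i. h k k)" for i
  proof (induction i)
    case (Suc i)
    then have IH: "0 \<le> Z i" "Z i + 1 \<le> (\<Prod>k<i. h k k)" by auto
    have i: "i < n" using Suc by simp
    have h: "1 \<le> h i i" using diagonal_pos[OF i] .
    have "h i i * (Z i + 1) \<le> h i i * (\<Prod>k<i. h k k)" using IH h by (intro mult_left_mono) auto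
    then show ?case using d[OF i] IH h by (simp add: ZS algebra_simps)
  qed (simp add: Z0)
  have dec: "fst (decode (Z n) l) = Z (n - l) \<and> (\<forall>k. n - l \<le> k \<and> k \<le> n \<longrightarrow> snd (decode (Z n) l) k = v k)"
    if "l \<le> n" for l
    using that
  proof (induction l)
    case 0
    then show ?case using v(2) by auto
  next
    case (Suc l)
    define i where "i = n - Suc l"
    have i: "i < n" "n - l = Suc i" using Suc.prems by (auto simp: i_def)
    obtain x w where xw: "decode (Z n) l = (x, w)" by fastforce
    have x: "x = Z (Suc i)" and w: "\<And>k. i < k \<Longrightarrow> k \<le> n \<Longrightarrow> w k = v k"
      using Suc xw i by auto
    have "x div h i i = Z i" "x mod h i i = d i"
      using d[OF i(1)] unfolding x ZS by simp_all
    moreover have "tail w i = tail v i" by (rule tail_cong) (rule w)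
    ultimately have "decode (Z n) (Suc l) = (Z i, w(i := (v i * h i i) div h i i))"
      using dr[OF i(1)] xw by (simp add: i_def Let_def)
    then show ?case using w diagonal_pos[OF i(1)] by (auto simp: i_def[symmetric])
  qed
  show ?thesis
  proof (rule that)
    show "0 \<le> Z n" "Z n < D" using Zb[of n] by (auto simp: D_eq)
    show "class_rep (Z n) k = v k" if "k \<le> n" for k
      using dec[of n] that by (simp add: class_rep_def)
  qed
qed

text \<open>For a direction better than all rows and with residues \<open>w\<close>, \<open>low w j\<close> is the only possible value
  of the entry \<open>j\<close> of least ratio, and \<open>cand w j\<close> consists of the least representatives of the other
  residues whose ratios are not smaller.\<close>

definition low :: "(nat \<Rightarrow> int) \<Rightarrow> nat \<Rightarrow> int" where
  "low w j = (if 0 < w j then w j - D else w j)"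

definition fits :: "(nat \<Rightarrow> int) \<Rightarrow> nat \<Rightarrow> nat \<Rightarrow> bool" where
  "fits w j i \<longleftrightarrow> 0 \<le> (w i - D) * y j - low w j * y i"

definition cand :: "(nat \<Rightarrow> int) \<Rightarrow> nat \<Rightarrow> nat \<Rightarrow> int" where
  "cand w j i = (if fits w j i then w i - D else w i)"

text \<open>The difference of the ratios at \<open>i\<close> and \<open>j\<close>, multiplied by
  \<open>y i * y j\<close> to stay in integers.\<close>

definition gap :: "(nat \<Rightarrow> int) \<Rightarrow> nat \<Rightarrow> nat \<Rightarrow> int" where
  "gap w j i = cand w j i * y j - low w j * y i"

lemma gap_eq: "gap w j i = (if fits w j i then (w i - D) * y j - low w j * y i
    else (w i - D) * y j - low w j * y i + D * y j)"
  by (simp add: gap_def cand_def algebra_simps)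

lemma valid_cand:
  assumes "valid w"
  shows "valid (cand w j)"
  unfolding valid_def
proof (intro allI impI)
  fix i assume i: "i < n"
  have "column (cand w j) i = column w i - D * (\<Sum>k\<le>n. (if fits w j k then 1 else 0) * h k i)"
    unfolding column_def cand_def sum_distrib_left sum_subtractf[symmetric]
    by (intro sum.cong) (auto simp: algebra_simps)
  then show "D dvd column (cand w j) i" using assms i by (simp add: valid_def)
qed

lemma gap_nonneg:
  assumes "0 \<le> w i" "w j < D" "i \<le> n" "j \<le> n" "0 \<le> w j"
  shows "0 \<le> gap w j i"
proof (cases "fits w j i")
  case False
  have "low w j \<le> 0" using assms by (auto simp: low_def)
  then have "low w j * y i \<le> 0" using y_pos[OF assms(3)] by (simp add: mult_nonpos_nonneg)
  moreover have "0 \<le> w i * y j" using assms y_pos[OF assms(4)] by simp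
  ultimately show ?thesis using False by (simp add: gap_def cand_def)
qed (simp add: gap_def cand_def fits_def)

text \<open>At the index \<open>j\<close> the rule of \<open>cand\<close> returns exactly
  \<open>low w j\<close>; with \<open>gap_nonneg\<close> the least ratio of the candidate is
  therefore attained at \<open>j\<close>.\<close>

lemma gap_self:
  assumes "0 \<le> w j" "j \<le> n"
  shows "gap w j j = 0"
proof -
  have "fits w j j \<longleftrightarrow> 0 < w j"
    using assms y_pos[OF assms(2)] D_pos
    by (auto simp: fits_def low_def left_diff_distrib[symmetric] zero_le_mult_iff)
  then show ?thesis by (auto simp: gap_def cand_def low_def)
qed

abbreviation osc :: "(nat \<Rightarrow> int) \<Rightarrow> real" where
  "osc v \<equiv> oscillation n y (\<lambda>k. real_of_int (v k))"

lemma ratio_diff_le_osc: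
  assumes "i \<le> n" "k \<le> n"
  shows "v i / y i - v k / y k \<le> osc v"
proof -
  let ?U = "(\<lambda>k. real_of_int (v k) / y k) ` {..n}"
  have "v i / y i \<le> Max ?U" "Min ?U \<le> v k / y k" using assms by (auto intro: Max_ge Min_le)
  then show ?thesis by (simp add: oscillation_def)
qed

lemma osc_attained:
  obtains i j where "i \<le> n" "j \<le> n" "osc v = v i / y i - v j / y j"
    "\<And>k. k \<le> n \<Longrightarrow> v j / y j \<le> v k / y k" "\<And>k. k \<le> n \<Longrightarrow> v k / y k \<le> v i / y i"
proof -
  let ?U = "(\<lambda>k. real_of_int (v k) / y k) ` {..n}"
  have U: "finite ?U" "?U \<noteq> {}" by auto
  obtain i where i: "i \<le> n" "Max ?U = v i / y i" using Max_in[OF U] by (rule imageE) simp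
  obtain j where j: "j \<le> n" "Min ?U = v j / y j" using Min_in[OF U] by (rule imageE) simp
  show ?thesis
  proof (rule that[OF i(1) j(1)])
    show "osc v = v i / y i - v j / y j" by (simp add: oscillation_def i j)
  qed (use U i(2)[symmetric] j(2)[symmetric] in \<open>auto intro: Max_ge Min_le\<close>)
qed

lemma osc_nonneg: "0 \<le> osc v"
  using ratio_diff_le_osc[of 0 0 v] by simp

text \<open>As the least ratio is at \<open>j\<close>, the oscillation is the largest gap ratio
  divided by \<open>y j\<close>. The alternative \<open>p = 0\<close> is the start value of that
  maximum, which remains if no gap is positive.\<close>

lemma osc_cand:
  assumes w: "\<And>k. k \<le> n \<Longrightarrow> 0 \<le> w k \<and> w k < D" and j: "j \<le> n"
    and r: "0 < q" "\<And>i. i \<le> n \<Longrightarrow> gap w j i * q \<le> p * y i"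
      "p = 0 \<or> (\<exists>i\<le>n. p = gap w j i \<and> q = y i)"
  shows "osc (cand w j) = p / (q * y j)"
proof -
  have yj: "0 < y j" using y_pos[OF j] .
  have ratio: "cand w j i / y i = low w j / y j + gap w j i / (y i * y j)" if "i \<le> n" for i
    using y_pos[OF that] yj by (simp add: gap_def field_simps)
  have lj: "cand w j j / y j = low w j / y j" using ratio[OF j] gap_self[of w j] w j by simp
  obtain i where i: "i \<le> n" "real_of_int p / q = gap w j i / y i"
    using r(3) gap_self[of w j] w j by auto
  have le: "gap w j k / (y k * y j) \<le> p / (q * y j)" if k: "k \<le> n" for k
  proof -
    have "real_of_int (gap w j k * q) \<le> real_of_int (p * y k)" using r(2)[OF k] by (simp only: of_int_le_iff)
    then have "gap w j k / real_of_int (y k) \<le> p / real_of_int q"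
      using y_pos[OF k] r(1) by (simp add: field_simps)
    then have "gap w j k / real_of_int (y k) / y j \<le> p / real_of_int q / y j"
      using yj by (intro divide_right_mono) auto
    then show ?thesis by simp
  qed
  obtain k l where kl: "k \<le> n" "l \<le> n" "osc (cand w j) = cand w j k / y k - cand w j l / y l"
    by (rule osc_attained[of "cand w j"], rule that)
  have "0 \<le> gap w j l / (y l * y j)"
    using gap_nonneg[of w l j] w kl j y_pos[OF kl(2)] yj by simp
  then have "osc (cand w j) \<le> p / (q * y j)"
    using ratio[OF kl(1)] ratio[OF kl(2)] le[OF kl(1)] kl(3) by linarith
  moreover have "p / (q * y j) \<le> osc (cand w j)"
  proof -
    have "real_of_int p / q / y j = gap w j i / y i / y j" using i by simp
    then show ?thesis using ratio_diff_le_osc[OF i(1) j, of "cand w j"] ratio[OF i(1)] lj by simp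
  qed
  ultimately show ?thesis by simp
qed

text \<open>From \<open>v n = 0\<close> and the small spread follows \<open>- D < v k < D\<close>,
  so \<open>v k\<close> is its residue or the residue minus \<open>D\<close>. Lowering
  \<open>v k\<close> by \<open>D\<close> would fall below the least ratio (\<open>spread\<close>);
  hence \<open>v k\<close> is the least representative that does not, which is what
  \<open>cand\<close> selects.\<close>

lemma cand_complete:
  assumes v: "valid v" "v n = 0" and small: "\<And>k. k \<le> n \<Longrightarrow> osc v < D / y k"
  obtains a j where "0 \<le> a" "a < D" "j \<le> n" "\<And>k. k \<le> n \<Longrightarrow> cand (class_rep a) j k = v k"
proof -
  obtain i j where ij: "i \<le> n" "j \<le> n" "osc v = v i / y i - v j / y j"
    "\<And>k. k \<le> n \<Longrightarrow> v j / y j \<le> v k / y k" "\<And>k. k \<le> n \<Longrightarrow> v k / y k \<le> v i / y i"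
    by (rule osc_attained[of v], rule that)
  have yr: "0 < real_of_int (y k)" if "k \<le> n" for k using y_pos[OF that] by simp
  have vj0: "v j \<le> 0"
    using ij(4)[of n] v(2) yr[OF ij(2)] by (simp add: divide_le_0_iff)
  have vi0: "0 \<le> real_of_int (v i) / y i" using ij(5)[of n] v(2) by simp
  have vj_lower: "- D / y k < v j / y j" if "k \<le> n" for k
    using small[OF that] ij(3) vi0 by simp
  have lower: "- D < v k" if k: "k \<le> n" for k
  proof -
    have "- D / real_of_int (y k) < v k / y k" using vj_lower[OF k] ij(4)[OF k] by simp
    then have "- real_of_int D < real_of_int (v k)"
      using yr[OF k] by (simp only: divide_less_cancel) auto
    then show ?thesis by simp
  qed
  have spread: "(v k - D) / y k < v j / y j" if k: "k \<le> n" for k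
    using small[OF k] ij(3) ij(5)[OF k] by (simp add: diff_divide_distrib)
  have upper: "v k < D" if k: "k \<le> n" for k
  proof -
    have "real_of_int (v j) / y j \<le> 0" using vj0 yr[OF ij(2)] by (simp add: divide_le_0_iff)
    then have "real_of_int (v k - D) / y k < 0" using spread[OF k] by linarith
    then show ?thesis using yr[OF k] by (simp add: divide_less_0_iff)
  qed
  define w where "w k = v k mod D" for k
  have w_eq: "w k = (if v k < 0 then v k + D else v k)" if k: "k \<le> n" for k
  proof (cases "v k < 0")
    case True
    have "w k = (v k + D) mod D" by (simp add: w_def)
    also have "\<dots> = v k + D" using True lower[OF k] by (intro mod_pos_pos_trivial) auto
    finally show ?thesis using True by simp
  next
    case False
    then show ?thesis using upper[OF k] by (simp add: w_def)
  qed
  have "valid w" unfolding valid_def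
  proof (intro allI impI)
    fix i assume i: "i < n"
    have "column w i = column v i - D * (\<Sum>k\<le>n. (v k div D) * h k i)"
      unfolding column_def w_def sum_distrib_left sum_subtractf[symmetric]
      by (intro sum.cong) (auto simp: minus_mult_div_eq_mod[symmetric] algebra_simps)
    then show "D dvd column w i" using v(1) i by (simp add: valid_def)
  qed
  moreover have "w n = 0" using v(2) by (simp add: w_def)
  moreover have "0 \<le> w k \<and> w k < D" for k using D_pos by (simp add: w_def)
  ultimately obtain a where a: "0 \<le> a" "a < D" "\<And>k. k \<le> n \<Longrightarrow> class_rep a k = w k"
    using class_rep_complete[of w] by metis
  have low: "low (class_rep a) j = v j"
    using a(3)[OF ij(2)] w_eq[OF ij(2)] vj0 lower[OF ij(2)] by (auto simp: low_def)
  have "cand (class_rep a) j k = v k" if k: "k \<le> n" for k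
  proof -
    have fits: "fits (class_rep a) j k \<longleftrightarrow> real_of_int (v j) / y j \<le> real_of_int (w k - D) / y k"
    proof -
      have "fits (class_rep a) j k \<longleftrightarrow> real_of_int (v j * y k) \<le> real_of_int ((w k - D) * y j)"
        unfolding fits_def low a(3)[OF k] of_int_le_iff by simp
      then show ?thesis using yr[OF k] yr[OF ij(2)] by (simp add: divide_le_eq pos_le_divide_eq)
    qed
    show ?thesis
    proof (cases "v k < 0")
      case True
      then have "w k - D = v k" using w_eq[OF k] by simp
      then show ?thesis using fits ij(4)[OF k] a(3)[OF k] by (simp add: cand_def)
    next
      case False
      then have "w k = v k" using w_eq[OF k] by simp
      then show ?thesis using fits spread[OF k] a(3)[OF k] by (simp add: cand_def)
    qed
  qed
  then show ?thesis using that[OF a(1,2) ij(2)] by blast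
qed

lemma osc_pos:
  assumes "v n = 0" "k \<le> n" "v k \<noteq> 0"
  shows "0 < osc v"
proof (rule ccontr)
  assume "\<not> 0 < osc v"
  then have "osc v = 0" using osc_nonneg[of v] by simp
  then have "v k / y k \<le> 0" "0 \<le> v k / y k"
    using ratio_diff_le_osc[of k n v] ratio_diff_le_osc[of n k v] assms by auto
  then show False using assms y_pos[OF assms(2)] by (auto simp: divide_le_0_iff zero_le_divide_iff)
qed

text \<open>If all columns vanish, uniqueness of back substitution makes \<open>v\<close>
  proportional to \<open>y\<close>, and then all ratios agree.\<close>

lemma column_nonzero:
  assumes "0 < osc v"
  shows "\<exists>i<n. column v i \<noteq> 0"
proof (rule ccontr)
  assume *: "\<not> ?thesis"
  define u where "u k = D * v k" for k
  define z where "z k = v n * y k" for k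
  have "u k = z k" if "k \<le> n" for k
  proof (rule triangular_unique[of 0])
    fix i assume i: "i < n"
    have "column u i = D * column v i" by (simp add: column_def u_def sum_distrib_left mult.assoc)
    moreover have "column z i = v n * column y i" by (simp add: column_def z_def sum_distrib_left mult.assoc)
    ultimately show "column u i = column z i" using * i sum_y_rows[OF i] by (simp add: column_def)
  qed (use that in \<open>simp_all add: u_def z_def y_n\<close>)
  then have "v k / y k = real_of_int (v n) / D" if "k \<le> n" for k
  proof -
    have "real_of_int (D * v k) = real_of_int (v n * y k)"
      using that \<open>\<And>k. k \<le> n \<Longrightarrow> u k = z k\<close>[OF that] by (simp only: u_def z_def)
    then show ?thesis using y_pos[OF that] D_pos by (simp add: field_simps)
  qed
  moreover obtain i j where "i \<le> n" "j \<le> n" "osc v = v i / y i - v j / y j"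
    by (rule osc_attained[of v], rule that)
  ultimately show False using assms by simp
qed

text \<open>The real number \<open>P / Q\<close> is the least oscillation met so far, attained by \<open>v\<close>.\<close>

definition best :: "int \<Rightarrow> int \<Rightarrow> (nat \<Rightarrow> int) \<Rightarrow> (int \<times> nat) set \<Rightarrow> bool" where
  "best P Q v F \<longleftrightarrow> 0 < P \<and> 0 < Q \<and> valid v \<and> osc v = P / Q \<and> (\<forall>k\<le>n. P / Q \<le> D / y k) \<and>
     (\<forall>(a, j)\<in>F. 0 < osc (cand (class_rep a) j) \<longrightarrow> P / Q \<le> osc (cand (class_rep a) j))"

text \<open>\<open>D\<close> at the single place \<open>m\<close> stands for the row
  \<open>m\<close> itself; the largest \<open>y m\<close> gives the best row.\<close>

lemma best_init:
  assumes "m \<le> n" "\<And>k. k \<le> n \<Longrightarrow> y k \<le> y m"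
  shows "best D (y m) (\<lambda>k. if k = m then D else 0) {}"
proof -
  let ?v = "\<lambda>k. if k = m then D else 0"
  have ym: "0 < y m" using y_pos[OF assms(1)] .
  have "column ?v i = D * h m i" for i
    using assms(1) by (simp add: column_def if_distrib[of "\<lambda>x. x * _"] cong: if_cong)
  then have "valid ?v" by (simp add: valid_def)
  moreover have "osc ?v = D / y m"
  proof (rule antisym)
    obtain i j where ij: "i \<le> n" "j \<le> n" "osc ?v = ?v i / y i - ?v j / y j"
      by (rule osc_attained[of ?v], rule that)
    have "0 \<le> ?v j / real_of_int (y j)" using D_pos ym by simp
    moreover have "?v i / real_of_int (y i) \<le> D / y m" using D_pos ym by simp
    ultimately show "osc ?v \<le> D / y m" using ij(3) by linarith
    \<comment> \<open>A second index, where the vector is 0, so that the spread really reaches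
      \<open>D / y m\<close>.\<close>
    define k where "k = (if m = 0 then n else 0)"
    have k: "k \<le> n" "k \<noteq> m" using n_pos by (auto simp: k_def)
    show "D / y m \<le> osc ?v" using ratio_diff_le_osc[OF assms(1) k(1), of ?v] k by simp
  qed
  moreover have "D / real_of_int (y m) \<le> D / y k" if "k \<le> n" for k
    using assms(2)[OF that] y_pos[OF that] D_pos by (intro divide_left_mono) auto
  ultimately show ?thesis using D_pos ym by (simp add: best_def)
qed

text \<open>Covers also candidates of oscillation 0, which represent the zero direction and need no
  comparison.\<close>

lemma best_keep:
  assumes "best P Q v F" "0 < osc (cand (class_rep a) j) \<Longrightarrow> P / Q \<le> osc (cand (class_rep a) j)"
  shows "best P Q v (insert (a, j) F)"
  using assms unfolding best_def by auto

lemma best_improve: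
  assumes "best P Q v F" "0 < P'" "0 < Q'" "osc (cand (class_rep a) j) = P' / Q'" "P' * Q \<le> P * Q'"
    "\<And>k. k \<le> n \<Longrightarrow> v' k = cand (class_rep a) j k"
  shows "best P' Q' v' (insert (a, j) F)"
proof -
  have PQ: "0 < P" "0 < Q" using assms by (auto simp: best_def)
  have "real_of_int (P' * Q) \<le> real_of_int (P * Q')" using assms(5) by (simp only: of_int_le_iff)
  then have le: "P' / real_of_int Q' \<le> P / Q" using PQ assms by (simp add: field_simps)
  have col: "column v' i = column (cand (class_rep a) j) i" for i
    using assms(6) by (simp add: column_def)
  have "valid v'" using valid_cand[OF class_rep_valid] by (simp add: valid_def col)
  moreover have "osc v' = osc (cand (class_rep a) j)"
  proof -
    have "(\<lambda>k. real_of_int (v' k) / y k) ` {..n} = (\<lambda>k. real_of_int (cand (class_rep a) j k) / y k) ` {..n}"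
      using assms(6) by (intro image_cong) auto
    then show ?thesis by (simp add: oscillation_def)
  qed
  ultimately show ?thesis using assms(1-4) le unfolding best_def by (fastforce intro: order.trans)
qed

text \<open>An oscillation below \<open>P / Q\<close> would be below every \<open>D / y k\<close>
  too, so \<open>cand_complete\<close> finds \<open>u\<close> among the candidates already
  compared.\<close>

lemma best_optimal:
  assumes "best P Q v ({0..<D} \<times> {..n})" "valid u" "u n = 0" "k \<le> n" "u k \<noteq> 0"
  shows "P / Q \<le> osc u"
proof (rule ccontr)
  assume less: "\<not> P / Q \<le> osc u"
  then have "osc u < D / y k" if "k \<le> n" for k
    using assms(1) that unfolding best_def by force
  then obtain a j where aj: "0 \<le> a" "a < D" "j \<le> n" "\<And>k. k \<le> n \<Longrightarrow> cand (class_rep a) j k = u k"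
    using cand_complete[OF assms(2,3)] by metis
  have "(\<lambda>k. real_of_int (cand (class_rep a) j k) / y k) ` {..n} = (\<lambda>k. real_of_int (u k) / y k) ` {..n}"
    using aj(4) by (intro image_cong) auto
  then have "osc (cand (class_rep a) j) = osc u" by (simp add: oscillation_def)
  then have "P / Q \<le> osc u"
    using assms(1) aj(1-3) osc_pos[OF assms(3-5)] unfolding best_def by force
  then show False using less by simp
qed

end

section \<open>The main program\<close>

text \<open>Variables: 16: \<open>D\<close>, 18: row or column index, 20: sum, 24: index of the residue class, 25: \<open>j\<close>,
  26: \<open>low w j\<close>, 27: \<open>y j\<close>, 29 and 30: largest gap ratio, 31 and 32: least oscillation so far,
  33: \<open>\<beta>\<close>. Arrays: 0: residues, 1: \<open>y\<close>, 2: candidate, 3: best candidate so far, 4: output.\<close>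

definition Tail :: "nat \<Rightarrow> nat \<Rightarrow> program" where
  "Tail q k0 = Seq (Const 20 0) (For 19 15 (Seq (Sub 21 19 k0) (Seq (Add 21 21 13)
     (IfPos 21 (Seq (Load_array 21 q 19) (Seq (Load_matrix 22 19 18) (Smul 20 22 21))) Skip))))"

text \<open>\<open>dl\<close> stands for Delta of the matrix. In \<open>bound\<close> the fourth
  power accommodates the cross multiplication of two oscillations, and the term with
  \<open>bb\<close> the product of \<open>\<beta>\<close> with the best numerator.\<close>

locale simplex_program = dependent_rows n h y D + layout n hb h b B
  for n hb :: nat and h :: "nat \<Rightarrow> nat \<Rightarrow> int" and b y :: "nat \<Rightarrow> int" and D B :: int +
  fixes dl bb :: int
  assumes y_le: "\<And>k. k \<le> n \<Longrightarrow> y k \<le> dl"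
    and entry_le: "\<And>k i. k \<le> n \<Longrightarrow> i < n \<Longrightarrow> \<bar>h k i\<bar> \<le> int n * dl"
    and rhs_le: "\<And>k. k \<le> n \<Longrightarrow> \<bar>b k\<bar> \<le> bb"
    and bound: "10 * (int n * dl) ^ 4 + 10 * (int n * dl) ^ 3 * bb \<le> B"
begin

section \<open>Word bounds and sums over a column\<close>

definition z :: int where "z = int n * dl"

lemma D_le: "D \<le> dl"
  using y_le[of n] y_n by simp

lemma dl_pos: "1 \<le> dl"
  using D_le D_pos by simp

lemma n_pos': "1 \<le> int n"
  using n_pos by simp

lemma z_ge: "1 \<le> z" "dl \<le> z" "int n \<le> z"
  using mult_mono[of 1 "int n" 1 dl] mult_right_mono[of 1 "int n" dl] mult_left_mono[of 1 dl "int n"]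
    n_pos' dl_pos by (auto simp: z_def)

lemma bb_nonneg: "0 \<le> bb"
  using rhs_le[of 0] by simp

lemma z_power_le: "z ^ Suc k \<ge> z ^ k"
  using z_ge by (simp add: mult_right_mono[of 1 z])

lemma bound_z: "10 * z ^ 4 + 10 * z ^ 3 * bb \<le> B" "10 * z ^ 4 \<le> B" "10 * z ^ 3 \<le> B" "10 * z ^ 2 \<le> B" "10 * z \<le> B" "10 \<le> B"
proof -
  show 1: "10 * z ^ 4 + 10 * z ^ 3 * bb \<le> B" using bound by (simp add: z_def)
  have "0 \<le> z ^ 3 * bb" using z_ge bb_nonneg by simp
  then show 4: "10 * z ^ 4 \<le> B" using 1 by simp
  show 3: "10 * z ^ 3 \<le> B" using 4 z_power_le[of 3] by (simp add: numeral_eq_Suc)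
  show 2: "10 * z ^ 2 \<le> B" using 3 z_power_le[of 2] by (simp add: numeral_eq_Suc)
  show 1: "10 * z \<le> B" using 2 z_power_le[of 1] by (simp add: numeral_eq_Suc)
  show "10 \<le> B" using 1 z_ge by simp
qed

lemma n_B: "4 * int n + 4 \<le> B"
  using bound_z(5) z_ge by linarith

lemma const_B: "0 \<le> B" "1 \<le> B"
  using bound_z(6) by auto

lemma abs_div_le:
  fixes u d m :: int
  assumes "\<bar>u\<bar> \<le> d * m" "0 < d"
  shows "\<bar>u div d\<bar> \<le> m"
proof -
  have "u div d \<le> (d * m) div d" by (rule zdiv_mono1) (use assms in auto)
  moreover have "(d * (- m)) div d \<le> u div d" by (rule zdiv_mono1) (use assms in auto)
  moreover have "(d * m) div d = m" "(d * (- m)) div d = - m"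
    using assms(2) by (intro nonzero_mult_div_cancel_left; simp)+
  ultimately show ?thesis by linarith
qed

definition same_except :: "nat set \<Rightarrow> (nat \<Rightarrow> int) \<Rightarrow> (nat \<Rightarrow> int) \<Rightarrow> bool" where
  "same_except X R R' \<longleftrightarrow> (\<forall>r. r \<notin> X \<longrightarrow> R' r = R r)"

lemma same_except_val: "same_except X R R' \<Longrightarrow> r \<notin> X \<Longrightarrow> val R' r = val R r"
  by (simp add: same_except_def val_def)

lemma val_upd: "r \<noteq> i \<Longrightarrow> val (R(i := v)) r = val R r"
  by (simp add: val_def)

lemma abs_entry_mult_le:
  assumes "k \<le> n" "i < n" "\<bar>w\<bar> \<le> M"
  shows "\<bar>w * h k i\<bar> \<le> M * z"
  unfolding abs_mult using assms entry_le[OF assms(1,2)] by (intro mult_mono) (auto simp: z_def)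

lemma partial_sum_le:
  assumes "i < n" "\<And>k. k0 \<le> k \<Longrightarrow> k \<le> n \<Longrightarrow> \<bar>w k\<bar> \<le> M" "m \<le> Suc n" "0 \<le> M"
  shows "\<bar>\<Sum>k\<in>{k0..<m}. w k * h k i\<bar> \<le> int m * (M * z)"
proof -
  have "\<bar>\<Sum>k\<in>{k0..<m}. w k * h k i\<bar> \<le> (\<Sum>k\<in>{k0..<m}. \<bar>w k * h k i\<bar>)" by (rule sum_abs)
  also have "\<dots> \<le> (\<Sum>k\<in>{k0..<m}. M * z)"
    using assms by (intro sum_mono abs_entry_mult_le) auto
  also have "\<dots> = int (m - k0) * (M * z)" by simp
  also have "\<dots> \<le> int m * (M * z)"
    using z_ge assms(4) by (intro mult_right_mono) auto
  finally show ?thesis .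
qed

text \<open>The loop visits all rows and skips those before \<open>l\<close>. Since
  \<open>IfPos\<close> tests for a positive value, 1 is added to the difference so that row
  \<open>l\<close> itself is included.\<close>

lemma hruns_Tail:
  assumes R: "R 18 = int i" "i < n" "val R k0 = int l" "i \<le> l" "l \<le> Suc n" "k0 \<notin> {19, 20, 21, 22}" "12 \<le> k0" "k0 \<le> 40"
    and q: "q < 5" and w: "\<And>k. l \<le> k \<Longrightarrow> k \<le> n \<Longrightarrow> \<bar>A q k\<bar> \<le> M" and M: "0 \<le> M" "M \<le> 2 * dl"
    and T: "4 + (int n + 1) * (18 + 3 * int n + 3 * M) \<le> T"
    and Q: "\<And>R'. same_except {19, 20, 21, 22} R R' \<Longrightarrow> R' 20 = (\<Sum>k\<in>{l..n}. A q k * h k i) \<Longrightarrow> Q R' A"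
  shows "hruns (Tail q k0) R A T Q"
proof -
  define s where "s m = (\<Sum>k\<in>{l..<m}. A q k * h k i)" for m
  have sS: "s (Suc m) = (if l \<le> m then s m + A q m * h m i else s m)" for m
    by (simp add: s_def)
  have n1: "val R' 15 = int (Suc n)" for R' by (simp add: val_def)
  have ab: "\<bar>s k\<bar> + \<bar>h k i * A q k\<bar> \<le> B" if "l \<le> k" "k < Suc n" for k
  proof -
    have "\<bar>s k\<bar> \<le> int k * (M * z)"
      unfolding s_def by (rule partial_sum_le) (use R w M that in auto)
    moreover have "\<bar>h k i * A q k\<bar> \<le> M * z"
      using abs_entry_mult_le[of k i "A q k" M] R w[of k] that by (simp add: mult.commute)
    ultimately have "\<bar>s k\<bar> + \<bar>h k i * A q k\<bar> \<le> (int k + 1) * (M * z)" by (simp add: algebra_simps)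
    also have "\<dots> \<le> (2 * int n) * ((2 * dl) * z)"
      using that n_pos M z_ge by (intro mult_mono) auto
    also have "\<dots> = 4 * z ^ 2" by (simp add: z_def power2_eq_square)
    also have "\<dots> \<le> 10 * z ^ 2" by simp
    finally show ?thesis using bound_z(4) by linarith
  qed
  show ?thesis
    unfolding Tail_def
    apply (rule seq_Const; (simp add: const_B)?)
    apply (rule hruns_For[where N="Suc n" and c="15 + 3 * int n + 3 * M" and
       Inv="\<lambda>k R' A'. A' = A \<and> same_except {19, 20, 21, 22} R R' \<and> R' 20 = s k"]; (simp add: val_def; fail)?)
    subgoal by (simp add: same_except_def s_def)
    subgoal premises p for k R' A'
    proof -
      have R': "R' 18 = int i" "val R' k0 = int l" "R' 19 = int k" "R' 20 = s k" "A' = A" "same_except {19, 20, 21, 22} R R'"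
        using p R same_except_val[of "{19, 20, 21, 22}" R R' k0] by (auto simp: same_except_def)
      show ?thesis
        apply (intro seq_Sub seq_Add hruns_IfPos seq_Load_array seq_Load_matrix hruns_Smul hruns_Skip)
        using R R' p(1) q M ab[of k] w[of k] n_B sS[of k]
        by (simp_all add: val_simps val_upd same_except_def)
    qed
    subgoal premises p for R' A'
      using p Q[of R'] by (auto simp: s_def atLeastLessThanSuc_atLeastAtMost)
    subgoal using M by simp
    subgoal using T by (simp add: algebra_simps)
    done
qed

end

section \<open>Programs for determinant, dependency, best row and class representative\<close>

definition Determinant :: program where
  "Determinant = Seq (Const 16 1) (For 17 14 (Seq (Load_matrix 22 17 17) (Seq (Const 21 0)
     (Seq (Smul 21 16 22) (Add 16 21 12)))))"

definition Dependency :: program where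
  "Dependency = Seq (Store_array 1 14 16) (For 17 14 (Seq (Sub 18 14 17) (Seq (Sub 18 18 13)
     (Seq (Add 37 18 13) (Seq (Tail 1 37) (Seq (Sub 20 12 20) (Seq (Load_matrix 22 18 18)
     (Seq (Divmod 21 20 22) (Store_array 1 18 21)))))))))"

definition Beta :: program where
  "Beta = Seq (Const 33 0) (For 19 15 (Seq (Load_array 21 1 19) (Seq (Load_rhs 22 19) (Smul 33 22 21))))"

definition Argmax :: program where
  "Argmax = Seq (Const 25 0) (For 19 15 (Seq (Load_array 21 1 19) (Seq (Load_array 22 1 25)
     (Seq (Sub 21 21 22) (IfPos 21 (Add 25 19 12) Skip)))))"

definition Decode :: program where
  "Decode = Seq (Add 23 24 12) (For 17 14 (Seq (Sub 18 14 17) (Seq (Sub 18 18 13)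
     (Seq (Add 37 18 13) (Seq (Tail 0 37) (Seq (Sub 20 12 20) (Seq (Divmod 21 20 16)
     (Seq (Load_matrix 22 18 18) (Seq (Divmod 21 23 22) (Seq (Smul 20 16 23) (Seq (Add 23 21 12)
     (Seq (Divmod 21 20 22) (Store_array 0 18 21)))))))))))))"

context simplex_program
begin

lemma nz: "1 \<le> int n * z" "z \<le> int n * z" "int n \<le> int n * z"
  using mult_mono[of 1 "int n" 1 z] mult_right_mono[of 1 "int n" z] mult_left_mono[of 1 z "int n"]
    n_pos' z_ge by auto

lemma nnz: "int n * z \<le> int n * (int n * z)"
  using mult_right_mono[of 1 "int n" "int n * z"] n_pos' nz by auto

lemma seq_Tail:
  assumes R: "R 18 = int i" "i < n" "val R k0 = int l" "i \<le> l" "l \<le> Suc n" "k0 \<notin> {19, 20, 21, 22}" "12 \<le> k0" "k0 \<le> 40"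
    and q: "q < 5" and w: "\<And>k. l \<le> k \<Longrightarrow> k \<le> n \<Longrightarrow> \<bar>A q k\<bar> \<le> dl"
    and Q: "\<And>R'. same_except {19, 20, 21, 22} R R' \<Longrightarrow> R' 20 = (\<Sum>k\<in>{l..n}. A q k * h k i) \<Longrightarrow>
      hruns p R' A (T - 52 * (int n * z)) Q"
  shows "hruns (Seq (Tail q k0) p) R A T Q"
proof (rule hruns_Seq, rule hruns_Tail[where i=i and l=l and M=dl])
  have "(int n + 1) * (18 + 3 * int n + 3 * dl) \<le> (2 * int n) * (24 * z)"
    using n_pos' z_ge dl_pos by (intro mult_mono) auto
  then show "4 + (int n + 1) * (18 + 3 * int n + 3 * dl) \<le> 52 * (int n * z)" using nz by simp
qed (use R q w dl_pos Q in auto)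

lemma tail_le:
  assumes "i < n" "\<And>k. k \<le> n \<Longrightarrow> \<bar>w k\<bar> \<le> M" "0 \<le> M" "l \<le> n"
  shows "\<bar>\<Sum>k\<in>{l..n}. w k * h k i\<bar> \<le> 2 * (int n * (M * z))"
proof -
  have "\<bar>\<Sum>k\<in>{l..<Suc n}. w k * h k i\<bar> \<le> int (Suc n) * (M * z)"
    by (rule partial_sum_le) (use assms in auto)
  also have "\<dots> \<le> (2 * int n) * (M * z)"
    using n_pos' assms(3) z_ge by (intro mult_right_mono) auto
  finally show ?thesis by (simp add: atLeastLessThanSuc_atLeastAtMost)
qed

lemma dl_B: "4 * dl \<le> B" "2 * (int n * (dl * z)) \<le> B"
proof -
  show "4 * dl \<le> B" using bound_z z_ge by linarith
  have "2 * (int n * (dl * z)) = 2 * z ^ 2" by (simp add: z_def power2_eq_square)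
  then show "2 * (int n * (dl * z)) \<le> B" using bound_z(4) zero_le_power2[of z] by linarith
qed

lemma y_abs_le: "k \<le> n \<Longrightarrow> \<bar>y k\<bar> \<le> dl"
  using y_le[of k] y_pos[of k] by simp

lemma diagonal_le: "i < n \<Longrightarrow> h i i \<le> D"
proof -
  assume i: "i < n"
  have "D = h i i * (\<Prod>k\<in>{..<n} - {i}. h k k)"
    unfolding D_eq using i by (subst prod.remove[of _ i]) auto
  moreover have "1 \<le> (\<Prod>k\<in>{..<n} - {i}. h k k)" by (rule prod_ge_1) (use diagonal_pos in auto)
  ultimately show "h i i \<le> D"
    using diagonal_pos[OF i] mult_left_mono[of 1 "\<Prod>k\<in>{..<n} - {i}. h k k" "h i i"] by simp
qed

lemma hruns_Determinant:
  assumes T: "25 * (int n * z) \<le> T" and Q: "\<And>R'. R' 16 = D \<Longrightarrow> Q R' A"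
  shows "hruns Determinant R A T Q"
proof -
  \<comment> \<open>The diagonal factors still to come are at least 1, so no partial product exceeds
    \<open>D\<close>.\<close>
  have step: "1 \<le> (\<Prod>i<k. h i i)" "(\<Prod>i<k. h i i) * h k k \<le> D" if k: "k < n" for k
  proof -
    show 1: "1 \<le> (\<Prod>i<k. h i i)" by (rule prod_ge_1) (use diagonal_pos k in auto)
    have e: "{..<n} = insert k {..<k} \<union> {Suc k..<n}" using k by auto
    have "D = ((\<Prod>i<k. h i i) * h k k) * (\<Prod>i\<in>{Suc k..<n}. h i i)"
      unfolding D_eq e by (subst prod.union_disjoint) (auto simp: mult.commute)
    moreover have "1 \<le> (\<Prod>i\<in>{Suc k..<n}. h i i)" by (rule prod_ge_1) (use diagonal_pos in auto)
    ultimately show "(\<Prod>i<k. h i i) * h k k \<le> D"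
      using 1 diagonal_pos[OF k] mult_left_mono[of 1 "\<Prod>i\<in>{Suc k..<n}. h i i" "(\<Prod>i<k. h i i) * h k k"] by simp
  qed
  show ?thesis
    unfolding Determinant_def
    apply (rule seq_Const; (simp add: const_B)?)
    apply (rule hruns_For[where N=n and c="18 * z" and
       Inv="\<lambda>k R' A'. A' = A \<and> R' 16 = (\<Prod>i<k. h i i)"]; (simp add: val_def; fail)?)
    subgoal premises p for k R' A'
      apply (intro seq_Load_matrix seq_Const seq_Smul hruns_Add)
      using p step[of k] diagonal_pos[of k] diagonal_le[of k] D_le dl_B z_ge bound_z(6)
      by (simp_all add: val_simps abs_mult)
    subgoal premises p for R' A' using p Q[of R'] D_eq by simp
    subgoal using z_ge by simp
    subgoal using T nz by (simp add: algebra_simps)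
    done
qed

lemma hruns_Dependency:
  assumes R: "R 16 = D" and T: "100 * (int n * (int n * z)) \<le> T"
    and Q: "\<And>R' A'. R' 16 = D \<Longrightarrow> (\<And>q. q \<noteq> 1 \<Longrightarrow> A' q = A q) \<Longrightarrow> (\<And>k. k \<le> n \<Longrightarrow> A' 1 k = y k) \<Longrightarrow> Q R' A'"
  shows "hruns Dependency R A T Q"
proof -
  show ?thesis
    unfolding Dependency_def
    apply (rule seq_Store_array; simp add: val_simps R)
    apply (rule hruns_For[where N=n and c="90 * (int n * z)" and
       Inv="\<lambda>l R' A'. R' 16 = D \<and> (\<forall>q. q \<noteq> 1 \<longrightarrow> A' q = A q) \<and> (\<forall>k. n - l \<le> k \<and> k \<le> n \<longrightarrow> A' 1 k = y k)"]; (simp add: val_def R; fail)?)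
    subgoal using y_n by (auto simp: R)
    subgoal premises p for l R' A'
    proof -
      define i where "i = n - Suc l"
      have i: "i < n" "n - l = Suc i" "int n - int l - 1 = int i" "i \<le> n" "n - Suc l = i"
        using p(1) by (auto simp: i_def)
      have tl: "(\<Sum>k = Suc i..n. A' (Suc 0) k * h k i) = tail y i"
        unfolding tail_def using p(2) i by (intro sum.cong) auto
      have t: "\<bar>tail y i\<bar> \<le> B"
        using tail_le[of i y dl "Suc i"] i y_abs_le dl_pos dl_B by (simp add: tail_def)
      have yi: "(- tail y i) div h i i = y i" "0 < y i" "y i \<le> dl" "0 < h i i"
        using y_back_substitution[OF i(1)] y_pos[of i] y_le[of i] diagonal_pos[of i] i by auto
      show ?thesis
        apply (intro seq_Sub seq_Add)
        using p i n_B apply (simp_all add: val_simps)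
        apply (rule seq_Tail[where i=i and l="Suc i"]; (simp add: val_simps i; fail)?)
        subgoal for k using p i y_abs_le by simp
        subgoal premises q for R2
        proof -
          have R2: "R2 16 = D" "R2 17 = int l" "R2 18 = int i" "R2 20 = tail y i"
            using q p tl by (auto simp: same_except_def)
          show ?thesis
            apply (intro seq_Sub seq_Load_matrix seq_Divmod hruns_Store_array)
            using R2 i t yi apply (simp_all add: val_simps)
            subgoal using nz z_ge by linarith
            subgoal using p i by auto
            done
        qed
        done
    qed
    subgoal for R' A' using Q[of R' A'] by auto
    subgoal using nz by simp
    subgoal using T nz nnz by (simp add: algebra_simps)
    done
qed

text \<open>In \<open>Smul 33 22 21\<close> the counter is \<open>y k\<close> and not
  \<open>b k\<close>, which keeps the number of instructions independent of the size of the
  right-hand side.\<close>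

lemma hruns_Beta:
  assumes R: "R 16 = D" and A: "\<And>k. k \<le> n \<Longrightarrow> A 1 k = y k" and T: "40 * (int n * z) \<le> T"
    and Q: "\<And>R'. R' 16 = D \<Longrightarrow> R' 33 = (\<Sum>k\<le>n. y k * b k) \<Longrightarrow> Q R' A"
  shows "hruns Beta R A T Q"
proof -
  define s where "s m = (\<Sum>k<m. y k * b k)" for m
  have yb: "\<bar>y k * b k\<bar> \<le> dl * bb" if "k \<le> n" for k
    unfolding abs_mult using y_abs_le[OF that] rhs_le[OF that] dl_pos by (intro mult_mono) auto
  have ab: "\<bar>s k\<bar> + \<bar>b k * y k\<bar> \<le> B" if "k < Suc n" for k
  proof -
    have "\<bar>s k\<bar> \<le> (\<Sum>k<k. \<bar>y k * b k\<bar>)" unfolding s_def by (rule sum_abs)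
    also have "\<dots> \<le> (\<Sum>k<k. dl * bb)" using that by (intro sum_mono yb) auto
    finally have "\<bar>s k\<bar> \<le> int k * (dl * bb)" by simp
    then have "\<bar>s k\<bar> + \<bar>b k * y k\<bar> \<le> (int k + 1) * (dl * bb)"
      using yb[of k] that unfolding mult.commute[of "b k" "y k"] distrib_right by linarith
    also have "\<dots> \<le> (2 * int n) * (dl * bb)"
      using that n_pos bb_nonneg dl_pos by (intro mult_right_mono) auto
    also have "\<dots> = 2 * (z * bb)" by (simp add: z_def)
    also have "\<dots> \<le> 2 * (z ^ 3 * bb)"
      using bb_nonneg power_increasing[of 1 3 z] z_ge by (intro mult_left_mono mult_right_mono) auto
    also have "\<dots> \<le> 10 * z ^ 4 + 10 * z ^ 3 * bb" using bb_nonneg z_ge by simp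
    finally show ?thesis using bound_z(1) by linarith
  qed
  show ?thesis
    unfolding Beta_def
    apply (rule seq_Const; (simp add: const_B)?)
    apply (rule hruns_For[where N="Suc n" and c="12 * z" and
       Inv="\<lambda>k R' A'. A' = A \<and> R' 16 = D \<and> R' 33 = s k"]; (simp add: val_def R s_def; fail)?)
    subgoal premises p for k R' A'
      apply (intro seq_Load_array seq_Load_rhs hruns_Smul)
      using p A[of k] ab[of k] y_abs_le[of k] z_ge dl_pos apply (simp_all add: val_simps)
      subgoal by (simp add: s_def mult.commute)
      done
    subgoal premises p for R' A' using p Q[of R'] by (simp add: s_def lessThan_Suc_atMost)
    subgoal using z_ge by simp
    subgoal using T nz by (simp add: algebra_simps)
    done
qed

lemma hruns_Argmax:
  assumes R: "R 16 = D" "R 33 = \<beta>" and A: "\<And>k. k \<le> n \<Longrightarrow> A 1 k = y k" and T: "40 * (int n * z) \<le> T"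
    and Q: "\<And>R' m. R' 16 = D \<Longrightarrow> R' 33 = \<beta> \<Longrightarrow> R' 25 = int m \<Longrightarrow> m \<le> n \<Longrightarrow>
      (\<And>k. k \<le> n \<Longrightarrow> y k \<le> y m) \<Longrightarrow> Q R' A"
  shows "hruns Argmax R A T Q"
  unfolding Argmax_def
  apply (rule seq_Const; (simp add: const_B)?)
  apply (rule hruns_For[where N="Suc n" and c="7" and
     Inv="\<lambda>l R' A'. A' = A \<and> R' 16 = D \<and> R' 33 = \<beta> \<and> (\<exists>m. R' 25 = int m \<and> m \<le> n \<and> (\<forall>k<l. y k \<le> y m))"];
     (simp add: val_def R; fail)?)
  subgoal premises p for l R' A'
  proof -
    obtain m where m: "R' 25 = int m" "m \<le> n" "\<forall>k<l. y k \<le> y m" using p by blast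
    have yb: "\<bar>y l - y m\<bar> \<le> B" using y_abs_le[of l] y_abs_le[OF m(2)] dl_B dl_pos p by auto
    have "int l \<le> B" using p n_B by simp
    then show ?thesis
      apply (intro seq_Load_array seq_Sub hruns_IfPos hruns_Add hruns_Skip)
      using p m A yb apply (simp_all add: val_simps)
      subgoal by (metis less_Suc_eq less_imp_le order.trans order_refl)
      subgoal by (auto simp: less_Suc_eq)
      done
  qed
  subgoal premises p for R' A' using p Q[of R'] by auto
  subgoal using T nz by (simp add: algebra_simps)
  done

end

context simplex_program
begin

lemma hruns_Decode:
  assumes R: "R 16 = D" "R 24 = a" "0 \<le> a" "a < D" and A: "A 0 n = 0" and T: "200 * (int n * (int n * z)) \<le> T"
    and Q: "\<And>R' A'. same_except {17, 18, 19, 20, 21, 22, 23, 37} R R' \<Longrightarrow> (\<And>q. q \<noteq> 0 \<Longrightarrow> A' q = A q) \<Longrightarrow>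
       (\<And>k. k \<le> n \<Longrightarrow> A' 0 k = class_rep a k) \<Longrightarrow> Q R' A'"
  shows "hruns Decode R A T Q"
proof -
  have aB: "a \<le> B" using R D_le dl_B dl_pos by simp
  have dec_range: "0 \<le> fst (decode a l) \<and> fst (decode a l) < D" if "l \<le> n" for l
    using that
  proof (induction l)
    case (Suc l)
    define x i where "x = fst (decode a l)" and "i = n - Suc l"
    have x: "0 \<le> x" "x < D" using Suc by (auto simp: x_def)
    have i: "1 \<le> h i i" using diagonal_pos[of i] Suc by (simp add: i_def)
    have "x div h i i \<le> x" using x i zdiv_mono2[of x 1 "h i i"] by simp
    moreover have "0 \<le> x div h i i" using x i by (simp add: pos_imp_zdiv_nonneg_iff)
    ultimately show ?case using x by (cases "decode a l") (simp add: Let_def x_def i_def)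
  qed (use R in simp)
  show ?thesis
    unfolding Decode_def
    apply (rule seq_Add; simp add: val_simps R aB)
    apply (rule hruns_For[where N=n and c="180 * (int n * z)" and
       Inv="\<lambda>l R' A'. same_except {17, 18, 19, 20, 21, 22, 23, 37} R R' \<and> (\<forall>q. q \<noteq> 0 \<longrightarrow> A' q = A q) \<and>
         R' 23 = fst (decode a l) \<and> (\<forall>k. n - l \<le> k \<and> k \<le> n \<longrightarrow> A' 0 k = class_rep a k)"]; (simp add: val_def R; fail)?)
    subgoal using class_rep_n A by (auto simp: R same_except_def)
    subgoal premises p for l R' A'
    proof -
      define i where "i = n - Suc l"
      have i: "i < n" "n - l = Suc i" "int n - int l - 1 = int i" "i \<le> n" "n - Suc l = i"
        using p(1) by (auto simp: i_def)
      define x where "x = fst (decode a l)"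
      let ?w = "class_rep a"
      have x: "0 \<le> x" "x < D" "R' 23 = x" using dec_range[of l] p by (auto simp: x_def)
      have h: "0 < h i i" "h i i \<le> D" using diagonal_pos[OF i(1)] diagonal_le[OF i(1)] by auto
      have dec: "fst (decode a (Suc l)) = x div h i i" by (simp add: x_def Let_def i split: prod.splits)
      have tl: "(\<Sum>k = Suc i..n. A' 0 k * h k i) = tail ?w i"
        unfolding tail_def using p(2) i by (intro sum.cong) auto
      have w: "\<bar>?w k\<bar> \<le> D" "\<bar>?w k\<bar> \<le> dl" if "k \<le> n" for k
        using class_rep_range[OF that, of a] D_le by auto
      have t: "\<bar>tail ?w i\<bar> \<le> B"
        using tail_le[of i ?w dl "Suc i"] i w dl_pos dl_B by (simp add: tail_def)
      \<comment> \<open>This version with \<open>D\<close> instead of \<open>dl\<close> is the one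
        that, divided by \<open>D\<close>, leaves only \<open>2 * (int n * z)\<close> for the number
        of subtractions.\<close>
      have tD: "\<bar>tail ?w i\<bar> \<le> 2 * (int n * (D * z))"
        using tail_le[of i ?w D "Suc i"] i w D_pos by (simp add: tail_def)
      have q: "\<bar>(- tail ?w i) div D\<bar> \<le> 2 * (int n * z)"
        by (rule abs_div_le) (use tD D_pos in \<open>simp_all add: ac_simps\<close>)
      define r where "r = (- tail ?w i) mod D + D * (x mod h i i)"
      have m: "0 \<le> (- tail ?w i) mod D" "(- tail ?w i) mod D < D" using D_pos by auto
      have xm: "0 \<le> x mod h i i" "x mod h i i < h i i" using h by auto
      have xd: "0 \<le> x div h i i" "x div h i i < D" using dec_range[of "Suc l"] dec p(1) by auto
      have wi: "r div h i i = ?w i" using class_rep_step[of l i a] p(1) by (simp add: r_def x_def i_def)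
      have xl: "x mod h i i \<le> dl" using xm D_le h by linarith
      have Dx: "0 \<le> D * (x mod h i i)" "D * (x mod h i i) \<le> dl * dl"
        using xm D_pos D_le dl_pos xl mult_mono[of D dl "x mod h i i" dl] by auto
      have B2: "dl * dl + dl \<le> B"
        using mult_mono[of dl z dl z] z_ge dl_pos bound_z(4) bound_z(5) power2_eq_square[of z] zero_le_power2[of z] by linarith
      have wr: "0 \<le> ?w i" "?w i < D" using class_rep_range[of i a] i by auto
      show ?thesis
        apply (intro seq_Sub seq_Add)
        using p i n_B apply (simp_all add: val_simps)
        apply (rule seq_Tail[where i=i and l="Suc i"]; (simp add: val_simps i; fail)?)
        subgoal for k using p i w by simp
        subgoal premises q2 for R2
        proof -
          have R2: "R2 16 = D" "R2 17 = int l" "R2 18 = int i" "R2 20 = tail ?w i" "R2 23 = x"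
             "same_except {17, 18, 19, 20, 21, 22, 23, 37} R R2"
            using q2 p tl R x by (auto simp: same_except_def)
          show ?thesis
            apply (rule seq_Sub; simp add: val_simps R2(1-5) t)
            apply (rule seq_Divmod; simp add: val_simps R2(1-5) D_pos)
            apply (rule seq_Load_matrix; simp add: val_simps R2(1-5) i)
            apply (rule seq_Divmod; simp add: val_simps R2(1-5) h)
            apply (rule seq_Smul; simp add: val_simps R2(1-5))
            subgoal using Dx B2 D_le m by linarith
            apply (rule seq_Add; simp add: val_simps R2(1-5))
            subgoal using xd D_le dl_B dl_pos by linarith
            apply (rule seq_Divmod; simp add: val_simps R2(1-5) h r_def[symmetric] wi)
            apply (rule hruns_Store_array; simp add: val_simps R2(1-5) i)
            subgoal using i by simp
            subgoal using xd wr q xl xm D_le z_ge nz by linarith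
            subgoal using p R2(6) i(5) by (cases "decode a l") (auto simp: x_def same_except_def)
            done
        qed
        done
    qed
    subgoal premises p for R' A' using p(1) by (intro Q) auto
    subgoal using nz by simp
    subgoal using T nz nnz by (simp add: algebra_simps)
    done
qed

end

section \<open>Evaluation of one candidate\<close>

definition Candidate_row :: program where
  "Candidate_row = Seq (Load_array 21 0 18) (Seq (Sub 21 21 16) (Seq (Load_array 22 1 18)
     (Seq (Const 34 0) (Seq (Smul 34 21 27) (Seq (Sub 35 12 26) (Seq (Smul 34 35 22) (Seq (Add 36 34 13)
     (Seq (IfPos 36 Skip (Seq (Add 34 34 28) (Add 21 21 16))) (Seq (Store_array 2 18 21)
     (Seq (Const 35 0) (Seq (Smul 35 34 30) (Seq (Const 36 0) (Seq (Smul 36 29 22) (Seq (Sub 35 35 36)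
     (IfPos 35 (Seq (Add 29 34 12) (Add 30 22 12)) Skip)))))))))))))))"

context dependent_rows
begin

text \<open>Transitivity of \<open>g' / y i' \<le> p / q < g / y i\<close> without division: a new
  largest gap ratio dominates all earlier ones.\<close>

lemma ratio_trans:
  assumes "g' * q \<le> p * y i'" "p * y i < g * q" "0 < q" "i \<le> n" "i' \<le> n"
  shows "g' * y i \<le> g * y i'"
proof -
  have "(g' * q) * y i \<le> (p * y i') * y i" using assms y_pos[of i] by (intro mult_right_mono) auto
  moreover have "(p * y i) * y i' \<le> (g * q) * y i'" using assms y_pos[of i'] by (intro mult_right_mono) auto
  ultimately have "(g' * y i) * q \<le> (g * y i') * q" by (simp add: algebra_simps)
  then show ?thesis using assms by simp
qed

end

context simplex_program
begin

lemma seq_cut: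
  "hruns p R A c P \<Longrightarrow> (\<And>R' A'. P R' A' \<Longrightarrow> hruns q R' A' (T - c) Q) \<Longrightarrow> hruns (Seq p q) R A T Q"
  by (rule hruns_Seq[where c=c], erule hruns_mono) auto

lemma abs_mult_dl_le: "\<bar>u\<bar> \<le> M \<Longrightarrow> \<bar>v\<bar> \<le> N \<Longrightarrow> \<bar>u * v\<bar> \<le> M * (N :: int)"
  unfolding abs_mult by (intro mult_mono) auto

lemma dl_power_B: "8 * dl ^ 4 \<le> B" "8 * dl ^ 3 \<le> B" "8 * dl ^ 2 \<le> B" "dl ^ 3 \<le> dl ^ 4" "dl \<le> dl ^ 2" "1 \<le> dl ^ 2"
proof -
  have "dl ^ 4 \<le> z ^ 4" using z_ge dl_pos by (intro power_mono) auto
  moreover have "0 \<le> z ^ 4" by simp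
  ultimately show 1: "8 * dl ^ 4 \<le> B" using bound_z(2) by linarith
  have "dl ^ 3 \<le> z ^ 3" using z_ge dl_pos by (intro power_mono) auto
  moreover have "0 \<le> z ^ 3" using z_ge by simp
  ultimately show 2: "8 * dl ^ 3 \<le> B" using bound_z(3) by linarith
  have "dl ^ 2 \<le> z ^ 2" using z_ge dl_pos by (intro power_mono) auto
  moreover have "0 \<le> z ^ 2" by simp
  ultimately show "8 * dl ^ 2 \<le> B" using bound_z(4) by linarith
  show "dl ^ 3 \<le> dl ^ 4" using dl_pos by (intro power_increasing) auto
  show "dl \<le> dl ^ 2" "1 \<le> dl ^ 2" using dl_pos self_le_power[of dl 2] by auto
qed

lemma candidate_bounds:
  assumes w: "\<And>k. k \<le> n \<Longrightarrow> 0 \<le> w k \<and> w k < D" and i: "i \<le> n" and j: "j \<le> n"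
  shows "\<bar>(w i - D) * y j\<bar> \<le> dl ^ 2" "\<bar>low w j * y i\<bar> \<le> dl ^ 2" "\<bar>gap w j i\<bar> \<le> 2 * dl ^ 2"
    "\<bar>cand w j i\<bar> \<le> D" "\<bar>low w j\<bar> \<le> D"
proof -
  show l: "\<bar>low w j\<bar> \<le> D" and c: "\<bar>cand w j i\<bar> \<le> D" using w[OF j] w[OF i] by (auto simp: low_def cand_def)
  have "\<bar>w i - D\<bar> \<le> dl" using w[OF i] D_le by auto
  then show "\<bar>(w i - D) * y j\<bar> \<le> dl ^ 2" unfolding power2_eq_square by (rule abs_mult_dl_le) (rule y_abs_le[OF j])
  have 1: "\<bar>cand w j i * y j\<bar> \<le> dl * dl" by (rule abs_mult_dl_le) (use c D_le y_abs_le[OF j] in auto)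
  have 2: "\<bar>low w j * y i\<bar> \<le> dl * dl" by (rule abs_mult_dl_le) (use l D_le y_abs_le[OF i] in auto)
  show "\<bar>low w j * y i\<bar> \<le> dl ^ 2" using 2 by (simp add: power2_eq_square)
  show "\<bar>gap w j i\<bar> \<le> 2 * dl ^ 2" using 1 2 unfolding gap_def power2_eq_square by linarith
qed

text \<open>Register 34 first receives the quantity tested by \<open>fits\<close>; if it is
  negative, adding \<open>D * y j\<close> turns it into the gap (\<open>gap_eq\<close>). Register 36
  is larger by 1 because the test is for a positive value.\<close>

lemma hruns_Candidate_row:
  assumes R: "R 16 = D" "R 18 = int i" "R 26 = low w j" "R 27 = y j" "R 28 = D * y j" "R 29 = p" "R 30 = q"
    and ij: "i \<le> n" "j \<le> n" and A: "A 0 i = w i" "A 1 i = y i"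
    and w: "\<And>k. k \<le> n \<Longrightarrow> 0 \<le> w k \<and> w k < D"
    and pq: "0 \<le> p" "p \<le> 2 * dl ^ 2" "0 < q" "q \<le> dl"
    and T: "60 * dl \<le> T"
    and Q: "\<And>R'. same_except {21, 22, 29, 30, 34, 35, 36} R R' \<Longrightarrow>
      (if p * y i < gap w j i * q then R' 29 = gap w j i \<and> R' 30 = y i else R' 29 = p \<and> R' 30 = q) \<Longrightarrow>
      Q R' (A(2 := (A 2)(i := cand w j i)))"
  shows "hruns Candidate_row R A T Q"
proof -
  have cb: "\<bar>(w i - D) * y j\<bar> \<le> dl ^ 2" "\<bar>low w j * y i\<bar> \<le> dl ^ 2" "\<bar>gap w j i\<bar> \<le> 2 * dl ^ 2"
    "\<bar>cand w j i\<bar> \<le> D" "\<bar>low w j\<bar> \<le> D"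
    using candidate_bounds[where w=w and i=i and j=j] w ij by blast+
  have A': "A (Suc 0) i = y i" using A(2) by simp
  have yj: "0 < y j" "y j \<le> dl" and yi: "0 < y i" "y i \<le> dl" using y_pos y_le ij by auto
  have wi: "0 \<le> w i" "w i < D" using w[OF ij(1)] by auto
  have Dy: "0 \<le> D * y j" "D * y j \<le> dl ^ 2"
    using D_pos D_le yj mult_mono[of D dl "y j" dl] dl_pos by (auto simp: power2_eq_square)
  have gq: "\<bar>gap w j i * q\<bar> \<le> 2 * dl ^ 2 * dl"
    by (rule abs_mult_dl_le) (use cb pq in auto)
  have py: "\<bar>p * y i\<bar> \<le> 2 * dl ^ 2 * dl"
    by (rule abs_mult_dl_le) (use yi pq in auto)
  have d3: "2 * dl ^ 2 * dl = 2 * dl ^ 3" by (simp add: power2_eq_square power3_eq_cube)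
  define e where "e = (w i - D) * y j - low w j * y i"
  show ?thesis
    unfolding Candidate_row_def
    apply (rule seq_Load_array; simp add: val_simps R A(1) A' ij)
    subgoal using ij by simp
    apply (rule seq_Sub; simp add: val_simps R)
    subgoal using wi D_le dl_B dl_pos by linarith
    apply (rule seq_Load_array; simp add: val_simps R A(1) A' ij)
    subgoal using ij by simp
    apply (rule seq_Const; (simp add: const_B)?)
    apply (rule seq_Smul; simp add: val_simps R)
    subgoal using cb(1) dl_power_B by linarith
    apply (rule seq_Sub; simp add: val_simps R)
    subgoal using cb(5) D_le dl_B dl_pos by linarith
    apply (rule seq_Smul; simp add: val_simps R)
    subgoal using cb(1,2) dl_power_B by linarith
    apply (rule seq_Add; simp add: val_simps R)
    subgoal using cb(1,2) dl_power_B by linarith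
    subgoal
      apply (rule seq_cut[where c=3 and P="\<lambda>R' A'. A' = A \<and> same_except {21, 22, 34, 35, 36} R R' \<and> R' 21 = cand w j i \<and> R' 22 = y i \<and> R' 34 = gap w j i"])
      subgoal
        apply (rule hruns_IfPos; simp add: val_simps)
        subgoal by (rule hruns_Skip) (auto simp: same_except_def gap_eq cand_def fits_def)
        subgoal
          apply (rule seq_Add; simp add: val_simps R)
          subgoal using cb(1,2) Dy dl_power_B by linarith
          apply (rule hruns_Add; simp add: val_simps R)
          subgoal using wi dl_B D_le dl_pos by linarith
          subgoal by (auto simp: same_except_def gap_eq cand_def fits_def)
          done
        done
      subgoal premises p for R' A'
      proof -
        have R': "R' 16 = D" "R' 18 = int i" "R' 29 = p" "R' 30 = q" "R' 21 = cand w j i" "R' 22 = y i" "R' 34 = gap w j i" "A' = A"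
          "same_except {21, 22, 34, 35, 36} R R'"
          using p R by (auto simp: same_except_def)
        have ii: "int i < int n + 2" using ij by simp
        show ?thesis
          apply (rule seq_Store_array; simp add: val_simps R' ii)
          apply (rule seq_Const; (simp add: const_B)?)
          apply (rule seq_Smul; simp add: val_simps R')
          subgoal using gq d3 dl_power_B dl_pos by linarith
          apply (rule seq_Const; (simp add: const_B)?)
          apply (rule seq_Smul; simp add: val_simps R')
          subgoal using py d3 dl_power_B dl_pos by linarith
          apply (rule seq_Sub; simp add: val_simps R')
          subgoal using gq py d3 dl_power_B dl_pos by linarith
          apply (rule hruns_IfPos; simp add: val_simps R')
          subgoal
            apply (rule seq_Add; simp add: val_simps R')
            subgoal using cb(3) dl_power_B by linarith
            apply (rule hruns_Add; simp add: val_simps R')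
            subgoal using yi dl_B by linarith
            subgoal using T yj yi pq dl_pos cb(5) D_le by linarith
            subgoal using Q R'(9) by (simp add: same_except_def)
            done
          subgoal
            apply (rule hruns_Skip)
            subgoal using Q R'(9) R'(3,4) by (simp add: same_except_def R'(8))
            subgoal using T yj yi pq dl_pos cb(5) D_le by linarith
            done
          done
      qed
      done
    done
qed

end

definition Update :: program where
  "Update = IfPos 29 (Seq (Const 21 0) (Seq (Smul 21 30 27) (Seq (Const 22 0) (Seq (Smul 22 29 32)
     (Seq (Const 35 0) (Seq (Smul 35 31 21) (Seq (Sub 35 35 22) (IfPos 35 (Seq (Add 31 29 12)
     (Seq (Add 32 21 12) (For 18 15 (Seq (Load_array 22 2 18) (Store_array 3 18 22))))) Skip)))))))) Skip"

definition Candidate :: program where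
  "Candidate = Seq (Load_array 26 0 25) (Seq (IfPos 26 (Sub 26 26 16) Skip) (Seq (Load_array 27 1 25)
     (Seq (Const 28 0) (Seq (Smul 28 16 27) (Seq (Const 29 0) (Seq (Const 30 1)
     (Seq (For 18 15 Candidate_row) Update)))))))"

context simplex_program
begin

text \<open>Decoding never writes entry \<open>n\<close> of array 0, so its value 0 is an invariant.
  The best fraction is not reduced; its parts carry explicit bounds because comparisons multiply by
  them.\<close>

definition search_inv :: "int \<Rightarrow> (int \<times> nat) set \<Rightarrow> (nat \<Rightarrow> int) \<Rightarrow> (nat \<Rightarrow> nat \<Rightarrow> int) \<Rightarrow> bool" where
  "search_inv \<beta> F R A \<longleftrightarrow> R 16 = D \<and> R 33 = \<beta> \<and> (\<forall>k\<le>n. A 1 k = y k) \<and> A 0 n = 0 \<and>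
     best (R 31) (R 32) (A 3) F \<and> R 31 \<le> 2 * dl ^ 2 \<and> R 32 \<le> dl ^ 2 \<and> (\<forall>k\<le>n. \<bar>A 3 k\<bar> \<le> D)"

text \<open>Comparing two oscillations multiplies by two denominators of size at most
  \<open>dl ^ 2\<close>, whence the term \<open>6 * dl ^ 2\<close>. The outer test skips
  \<open>p = 0\<close>, the zero direction.\<close>

lemma hruns_Update:
  assumes R: "R 24 = a" "R 25 = int j" "R 27 = y j" "R 29 = p" "R 30 = q" and j: "j \<le> n"
    and inv: "search_inv \<beta> F R A"
    and A2: "\<And>k. k \<le> n \<Longrightarrow> A 2 k = cand (class_rep a) j k"
    and pq: "0 \<le> p" "p \<le> 2 * dl ^ 2" "0 < q" "q \<le> dl" "\<And>i. i \<le> n \<Longrightarrow> gap (class_rep a) j i * q \<le> p * y i"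
      "p = 0 \<or> (\<exists>i\<le>n. p = gap (class_rep a) j i \<and> q = y i)"
    and T: "50 * z + 6 * dl ^ 2 \<le> T"
    and Q: "\<And>R' A'. search_inv \<beta> (insert (a, j) F) R' A' \<Longrightarrow> R' 24 = a \<Longrightarrow> R' 25 = int j \<Longrightarrow> A' 0 = A 0 \<Longrightarrow> Q R' A'"
  shows "hruns Update R A T Q"
proof -
  let ?w = "class_rep a"
  have osc: "osc (cand ?w j) = p / (q * y j)"
    by (rule osc_cand) (use class_rep_range j pq in auto)
  have yj: "0 < y j" "y j \<le> dl" using y_pos y_le j by auto
  have P: "0 < R 31" "R 31 \<le> 2 * dl ^ 2" "0 < R 32" "R 32 \<le> dl ^ 2"
    using inv by (auto simp: search_inv_def best_def)
  have qy: "0 < q * y j" "q * y j \<le> dl ^ 2"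
    using pq yj mult_mono[of q dl "y j" dl] dl_pos by (auto simp: power2_eq_square)
  have d4: "2 * dl ^ 2 * dl ^ 2 = 2 * dl ^ 4" by (simp add: power2_eq_square power4_eq_xxxx)
  have pQ: "0 \<le> p * R 32" "p * R 32 \<le> 2 * dl ^ 4"
    using pq(1,2) P mult_mono[of p "2 * dl ^ 2" "R 32" "dl ^ 2"] unfolding d4 by auto
  have Pq: "0 \<le> R 31 * (q * y j)" "R 31 * (q * y j) \<le> 2 * dl ^ 4"
    using qy P mult_mono[of "R 31" "2 * dl ^ 2" "q * y j" "dl ^ 2"] unfolding d4 by auto
  have keep: "search_inv \<beta> (insert (a, j) F) R' A"
    if "same_except {18, 21, 22, 35} R R'" "\<not> (0 < p \<and> p * R 32 < R 31 * (q * y j))" for R'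
  proof -
    have "best (R 31) (R 32) (A 3) (insert (a, j) F)"
    proof (rule best_keep)
      show "best (R 31) (R 32) (A 3) F" using inv by (simp add: search_inv_def)
      assume "0 < osc (cand ?w j)"
      then have "0 < p" using qy(1) unfolding osc by (auto simp: zero_less_divide_iff simp del: of_int_mult)
      then have "R 31 * (q * y j) \<le> p * R 32" using that by auto
      then have "real_of_int (R 31) * real_of_int (q * y j) \<le> real_of_int p * real_of_int (R 32)"
        unfolding of_int_mult[symmetric] of_int_le_iff .
      moreover have "0 < real_of_int (q * y j)" using qy(1) by (simp only: of_int_0_less_iff)
      ultimately show "real_of_int (R 31) / R 32 \<le> osc (cand ?w j)"
        unfolding osc using P by (simp add: divide_le_eq pos_le_divide_eq mult.commute del: of_int_mult)
    qed
    then show ?thesis using inv that(1) by (simp add: search_inv_def same_except_def)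
  qed
  have improve: "search_inv \<beta> (insert (a, j) F) R' A'"
    if "same_except {18, 21, 22, 31, 32, 35} R R'" "R' 31 = p" "R' 32 = q * y j" "0 < p" "p * R 32 < R 31 * (q * y j)"
      "\<And>q. q \<noteq> 3 \<Longrightarrow> A' q = A q" "\<And>k. k \<le> n \<Longrightarrow> A' 3 k = cand ?w j k" for R' A'
  proof -
    have "best p (q * y j) (A' 3) (insert (a, j) F)"
    proof (rule best_improve)
      show "best (R 31) (R 32) (A 3) F" using inv by (simp add: search_inv_def)
    qed (use that qy osc in auto)
    moreover have "\<bar>cand ?w j k\<bar> \<le> D" if "k \<le> n" for k
      using candidate_bounds(4)[of ?w k j] class_rep_range j that by auto
    ultimately show ?thesis using inv that pq(2) qy(2) by (auto simp: search_inv_def same_except_def)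
  qed
  show ?thesis
    unfolding Update_def
    apply (rule hruns_IfPos; simp add: val_simps R)
    subgoal
      apply (rule seq_Const; (simp add: const_B)?)
      apply (rule seq_Smul; simp add: val_simps R)
      subgoal using qy dl_power_B yj pq by linarith
      apply (rule seq_Const; (simp add: const_B)?)
      apply (rule seq_Smul; simp add: val_simps R)
      subgoal using pQ dl_power_B(1) P by linarith
      apply (rule seq_Const; (simp add: const_B)?)
      apply (rule seq_Smul; simp add: val_simps R)
      subgoal using Pq dl_power_B(1) P by linarith
      apply (rule seq_Sub; simp add: val_simps R)
      subgoal using Pq pQ dl_power_B(1) by linarith
      apply (rule hruns_IfPos; simp add: val_simps R)
      subgoal
        apply (rule seq_Add; simp add: val_simps R)
        subgoal using pq dl_power_B by linarith
        apply (rule seq_Add; simp add: val_simps R)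
        subgoal using qy dl_power_B by linarith
        apply (rule hruns_For[where N="Suc n" and c=4 and Inv="\<lambda>k R' A'.
             same_except {18, 21, 22, 31, 32, 35} R R' \<and> R' 31 = p \<and> R' 32 = q * y j \<and>
             (\<forall>q. q \<noteq> 3 \<longrightarrow> A' q = A q) \<and> (\<forall>i<k. A' 3 i = cand ?w j i)"]; (simp add: val_simps; fail)?)
        subgoal by (auto simp: same_except_def)
        subgoal premises p for k R' A'
          apply (rule seq_Load_array; (simp add: val_simps p)?)
          subgoal using p by simp
          apply (rule hruns_Store_array; (simp add: val_simps p)?)
          subgoal using p by simp
          subgoal using p A2[of k] by (auto simp: same_except_def less_Suc_eq)
          done
        subgoal premises p for R' A'
          using p by (intro Q improve) (auto simp: same_except_def R)
        subgoal using T qy P yj pq z_ge by simp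
        done
      subgoal
        apply (rule hruns_Skip)
        subgoal by (intro Q keep) (auto simp: same_except_def R)
        subgoal using T qy P yj pq z_ge by simp
        done
      done
    subgoal
      apply (rule hruns_Skip)
      subgoal by (intro Q keep) (auto simp: same_except_def R)
      subgoal using T z_ge zero_le_power2[of dl] by linarith
      done
    done
qed

end

section \<open>The search over all candidates and the computation of the answer\<close>

definition Search :: program where
  "Search = For 24 16 (Seq Decode (For 25 15 Candidate))"

definition Init :: program where
  "Init = Seq (Store_array 3 25 16) (Seq (Add 31 16 12) (Load_array 32 1 25))"

definition Direction :: program where
  "Direction = For 18 14 (Seq (Tail 3 18) (Seq (Divmod 21 20 16) (Seq (Add 22 18 13)
     (Seq (Add 22 22 13) (Store_array 4 22 21)))))"

definition Width :: program where
  "Width = Seq (Const 21 0) (Seq (Smul 21 33 31) (Seq (Store_array 4 12 21)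
     (Seq (Const 21 0) (Seq (Smul 21 32 16) (Store_array 4 13 21)))))"

definition Main_program :: program where
  "Main_program = Seq Determinant (Seq Dependency (Seq Beta (Seq Argmax (Seq Init (Seq Search
     (Seq Direction Width))))))"

context simplex_program
begin

lemma hruns_Candidate:
  assumes R: "R 24 = a" "R 25 = int j" and j: "j \<le> n"
    and inv: "search_inv \<beta> F R A" and A0: "\<And>k. k \<le> n \<Longrightarrow> A 0 k = class_rep a k"
    and T: "300 * z + 6 * dl ^ 2 \<le> T"
    and Q: "\<And>R' A'. search_inv \<beta> (insert (a, j) F) R' A' \<Longrightarrow> R' 24 = a \<Longrightarrow> R' 25 = int j \<Longrightarrow> A' 0 = A 0 \<Longrightarrow> Q R' A'"
  shows "hruns Candidate R A T Q"
proof -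
  let ?w = "class_rep a"
  have w: "0 \<le> ?w k \<and> ?w k < D" if "k \<le> n" for k using class_rep_range[OF that] .
  have i: "R 16 = D" "\<And>k. k \<le> n \<Longrightarrow> A (Suc 0) k = y k" using inv by (auto simp: search_inv_def)
  have j2: "int j < int n + 2" using j by simp
  have cb: "\<bar>low ?w j\<bar> \<le> D" using candidate_bounds(5)[of ?w j j] w j by blast
  have yj: "0 < y j" "y j \<le> dl" using y_pos y_le j by auto
  have Dy: "0 \<le> D * y j" "D * y j \<le> dl ^ 2"
    using D_pos D_le yj mult_mono[of D dl "y j" dl] dl_pos by (auto simp: power2_eq_square)
  \<comment> \<open>Registers 29 and 30 hold the largest gap ratio of the first \<open>k\<close>
    rows, initially 0 / 1. The last three conditions become the premises of
    \<open>osc_cand\<close>.\<close>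
  define J where "J k R' A' \<longleftrightarrow>
      same_except {18, 21, 22, 26, 27, 28, 29, 30, 34, 35, 36} R R' \<and> R' 26 = low ?w j \<and> R' 27 = y j \<and> R' 28 = D * y j \<and>
      (\<forall>q. q \<noteq> 2 \<longrightarrow> A' q = A q) \<and> (\<forall>i<k. A' 2 i = cand ?w j i) \<and> 0 \<le> R' 29 \<and> R' 29 \<le> 2 * dl ^ 2 \<and>
      0 < R' 30 \<and> R' 30 \<le> dl \<and> (\<forall>i<k. gap ?w j i * R' 30 \<le> R' 29 * y i) \<and>
      (R' 29 = 0 \<or> (\<exists>i\<le>n. R' 29 = gap ?w j i \<and> R' 30 = y i))" for k R' A'
  have "(1 + int n) * (60 * dl + 3) \<le> (2 * int n) * (63 * dl)"
    using n_pos' dl_pos by (intro mult_mono) auto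
  then have loopT: "(1 + int n) * (60 * dl + 3) \<le> 126 * z" by (simp add: z_def)
  show ?thesis
    unfolding Candidate_def
    apply (rule seq_Load_array; simp add: val_simps R A0 j j2)
    apply (rule seq_cut[where c=2 and P="\<lambda>R' A'. A' = A \<and> same_except {26} R R' \<and> R' 26 = low ?w j"])
    subgoal
      apply (rule hruns_IfPos; simp add: val_simps)
      subgoal
        apply (rule hruns_Sub; simp add: val_simps i)
        subgoal using w[OF j] D_le dl_B dl_pos by linarith
        subgoal by (auto simp: same_except_def low_def)
        done
      subgoal by (rule hruns_Skip) (auto simp: same_except_def low_def)
      done
    subgoal premises p for R2 A2
    proof -
      have R2: "R2 24 = a" "R2 25 = int j" "R2 16 = D" "R2 26 = low ?w j" "A2 = A" "same_except {26} R R2"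
        using p R i by (auto simp: same_except_def)
      show ?thesis
        apply (rule seq_Load_array; simp add: val_simps R2 i j j2)
        apply (rule seq_Const; (simp add: const_B)?)
        apply (rule seq_Smul; simp add: val_simps R2)
        subgoal using Dy dl_power_B by linarith
        apply (rule seq_Const; (simp add: const_B)?)
        apply (rule seq_Const; (simp add: const_B)?)
        apply (rule hruns_Seq[where c="3 + int (Suc n) * (60 * dl + 3)"])
        apply (rule hruns_For[where N="Suc n" and c="60 * dl" and Inv=J]; (simp add: val_simps; fail)?)
        subgoal using dl_pos R2(4,6) by (auto simp: J_def same_except_def)
        subgoal premises q for k R' A'
        proof -
          note p = q(1) q(2)[unfolded J_def] q(3,4)
          have k: "k \<le> n" using p by simp
          have Ak: "A' 0 k = ?w k" "A' 1 k = y k" using p A0[OF k] i(2)[OF k] by auto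
          have yk: "0 < y k" "y k \<le> dl" using y_pos[OF k] y_le[OF k] by auto
          have gk: "0 \<le> gap ?w j k" "gap ?w j k \<le> 2 * dl ^ 2"
            using gap_nonneg[of ?w k j] candidate_bounds(3)[of ?w k j] w k j by auto
          have R16: "R' 16 = D" using p i by (auto simp: same_except_def)
          show ?thesis
          proof (rule hruns_Candidate_row[where i=k and j=j and w="?w" and p="R' 29" and q="R' 30"])
            fix R3 assume s: "same_except {21, 22, 29, 30, 34, 35, 36} R' R3" and
              c: "if R' 29 * y k < gap ?w j k * R' 30 then R3 29 = gap ?w j k \<and> R3 30 = y k
                else R3 29 = R' 29 \<and> R3 30 = R' 30"
            have le: "gap ?w j i * R3 30 \<le> R3 29 * y i" if "i < Suc k" for i
            proof (cases "R' 29 * y k < gap ?w j k * R' 30")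
              case True
              then have "gap ?w j i * y k \<le> gap ?w j k * y i" if "i < k"
                using ratio_trans[of "gap ?w j i" "R' 30" "R' 29" i k "gap ?w j k"] p(2) that k by auto
              then show ?thesis using True c \<open>i < Suc k\<close> by (cases "i = k") auto
            next
              case False
              then show ?thesis using c p(2) \<open>i < Suc k\<close> by (cases "i = k") auto
            qed
            have "same_except {18, 21, 22, 26, 27, 28, 29, 30, 34, 35, 36} R (R3(18 := int (Suc k)))"
              using s p(2) by (auto simp: same_except_def)
            moreover have "R3 26 = low ?w j" "R3 27 = y j" "R3 28 = D * y j" "R3 18 = int k" "val R3 15 = int (Suc n)"
              using s p by (auto simp: same_except_def val_simps)
            moreover have "0 \<le> R3 29 \<and> R3 29 \<le> 2 * dl ^ 2 \<and> 0 < R3 30 \<and> R3 30 \<le> dl \<and>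
                (R3 29 = 0 \<or> (\<exists>i\<le>n. R3 29 = gap ?w j i \<and> R3 30 = y i))"
              using c p(2) gk yk k by (auto split: if_splits)
            ultimately show "R3 18 = int k \<and> val R3 15 = int (Suc n) \<and>
              J (Suc k) (R3(18 := int (Suc k))) (A'(2 := (A' 2)(k := cand ?w j k)))"
              unfolding J_def
              using p(2) le by (simp add: less_Suc_eq)
          qed (use p k j Ak w R16 in auto)
        qed
        subgoal premises p for R' A'
          apply (rule hruns_Update[where a=a and j=j and F=F and \<beta>=\<beta> and p="R' 29" and q="R' 30"])
          using p(1) R j inv apply (simp_all add: J_def same_except_def search_inv_def)
          subgoal using T yj z_ge loopT by linarith
          subgoal for R3 A3 using Q[of R3 A3] by (simp add: search_inv_def)
          done
        subgoal using dl_pos by simp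
        done
    qed
    done
qed

lemma z_powers: "int n * z \<le> z ^ 2" "int n * (int n * z) \<le> z ^ 3" "dl * (int n * (int n * z)) \<le> z ^ 3"
    "dl * z ^ 2 \<le> z ^ 3" "int n * dl ^ 2 \<le> z ^ 2" "z ^ 2 \<le> z ^ 3" "z \<le> z ^ 2" "1 \<le> z ^ 2"
proof -
  show 1: "int n * z \<le> z ^ 2" using z_ge by (simp add: power2_eq_square mult_right_mono)
  have "int n * (int n * z) \<le> z * z ^ 2" using 1 z_ge by (intro mult_mono) auto
  then show "int n * (int n * z) \<le> z ^ 3" by (simp add: power2_eq_square power3_eq_cube)
  have "dl * (int n * (int n * z)) = z * (int n * z)" by (simp add: z_def)
  also have "\<dots> \<le> z * z ^ 2" using 1 z_ge by (intro mult_left_mono) auto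
  finally show "dl * (int n * (int n * z)) \<le> z ^ 3" by (simp add: power2_eq_square power3_eq_cube)
  have "dl * z ^ 2 \<le> z * z ^ 2" using z_ge by (intro mult_right_mono) auto
  then show "dl * z ^ 2 \<le> z ^ 3" by (simp add: power2_eq_square power3_eq_cube)
  have "int n * dl ^ 2 = z * dl" by (simp add: z_def power2_eq_square)
  also have "\<dots> \<le> z * z" using z_ge by (intro mult_left_mono) auto
  finally show "int n * dl ^ 2 \<le> z ^ 2" by (simp add: power2_eq_square)
  show "z ^ 2 \<le> z ^ 3" using z_ge by (intro power_increasing) auto
  show "z \<le> z ^ 2" "1 \<le> z ^ 2" using z_ge self_le_power[of z 2] by auto
qed

lemma hruns_Search:
  assumes inv: "search_inv \<beta> {} R A" and T: "900 * z ^ 3 \<le> T"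
    and Q: "\<And>R' A'. search_inv \<beta> ({0..<D} \<times> {..n}) R' A' \<Longrightarrow> Q R' A'"
  shows "hruns Search R A T Q"
proof -
  have R16: "R 16 = D" using inv by (simp add: search_inv_def)
  define c where "c = 200 * (int n * (int n * z)) + 630 * z ^ 2"
  have loopT: "3 + (1 + int n) * (300 * z + 6 * dl ^ 2 + 3) \<le> 630 * z ^ 2"
  proof -
    have "(1 + int n) * (300 * z + 6 * dl ^ 2 + 3) \<le> (2 * int n) * (303 * z + 6 * dl ^ 2)"
      using n_pos' z_ge zero_le_power2[of dl] by (intro mult_mono) (auto intro: add_nonneg_nonneg)
    also have "\<dots> = 606 * (int n * z) + 12 * (int n * dl ^ 2)" by (simp add: algebra_simps)
    also have "\<dots> \<le> 606 * z ^ 2 + 12 * z ^ 2"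
      using z_powers by (intro add_mono mult_left_mono) auto
    finally show ?thesis using z_powers by linarith
  qed
  \<comment> \<open>There are \<open>D \<le> dl\<close> classes. Since \<open>dl * n\<close> is
    \<open>z\<close>, decoding all of them costs a multiple of \<open>z * (n * z)\<close>, and the
    comparisons a multiple of \<open>dl * z ^ 2\<close>; both are at most cubic in
    \<open>z\<close>.\<close>
  have totalT: "3 + D * (c + 3) \<le> 900 * z ^ 3"
  proof -
    have "0 \<le> c" using z_ge by (simp add: c_def)
    then have "D * (c + 3) \<le> dl * (c + 3)" using D_le by (intro mult_right_mono) auto
    also have "\<dots> = 200 * (dl * (int n * (int n * z))) + 630 * (dl * z ^ 2) + 3 * dl"
      by (simp add: c_def algebra_simps)
    also have "\<dots> \<le> 200 * z ^ 3 + 630 * z ^ 3 + 3 * z ^ 3"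
      using z_powers z_ge by (intro add_mono mult_left_mono) auto
    finally show ?thesis using z_powers by linarith
  qed
  show ?thesis
    unfolding Search_def
    apply (rule hruns_For[where N="nat D" and c=c and Inv="\<lambda>m R' A'. search_inv \<beta> ({0..<int m} \<times> {..n}) R' A'"])
    apply (simp_all add: val_simps R16 less_imp_le[OF D_pos])
    subgoal using inv by (simp add: search_inv_def)
    subgoal premises p for m R1 A1
    proof -
      have R1: "R1 16 = D" "R1 24 = int m" "A1 0 n = 0" "0 \<le> int m" "int m < D"
        using p by (auto simp: search_inv_def)
      show ?thesis
        apply (rule seq_cut[where c="200 * (int n * (int n * z))" and P="\<lambda>R' A'.
            search_inv \<beta> ({0..<int m} \<times> {..n}) R' A' \<and> R' 24 = int m \<and> (\<forall>k\<le>n. A' 0 k = class_rep (int m) k)"])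
        subgoal
          apply (rule hruns_Decode[where a="int m"])
          using R1 apply (simp_all)
          subgoal premises q for R' A'
            using q p(2) class_rep_n[of "int m"] by (auto simp: search_inv_def same_except_def)
          done
        subgoal premises q for R2 A2
          apply (rule hruns_For[where N="Suc n" and c="300 * z + 6 * dl ^ 2" and Inv="\<lambda>l R' A'.
            search_inv \<beta> (({0..<int m} \<times> {..n}) \<union> ({int m} \<times> {..<l})) R' A' \<and> R' 24 = int m \<and>
            (\<forall>k\<le>n. A' 0 k = class_rep (int m) k)"]; (simp add: val_simps; fail)?)
          subgoal using q by (simp add: search_inv_def)
          subgoal premises r for l R3 A3
          proof (rule hruns_Candidate[where a="int m" and j=l])
            fix R' A'
            assume *: "search_inv \<beta> (insert (int m, l) ({0..<int m} \<times> {..n} \<union> {int m} \<times> {..<l})) R' A'"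
              "R' 24 = int m" "R' 25 = int l" "A' 0 = A3 0"
            have "insert (int m, l) ({0..<int m} \<times> {..n} \<union> {int m} \<times> {..<l}) =
                {0..<int m} \<times> {..n} \<union> {int m} \<times> {..<Suc l}" by auto
            then show "R' 25 = int l \<and> val R' 15 = int (Suc n) \<and>
              (search_inv \<beta> ({0..<int m} \<times> {..n} \<union> {int m} \<times> {..<Suc l}) (R'(25 := int (Suc l))) A' \<and>
               (R'(25 := int (Suc l))) 24 = int m \<and> (\<forall>k\<le>n. A' 0 k = class_rep (int m) k))"
              using * r by (simp add: search_inv_def val_simps)
          qed (use r in auto)
          subgoal premises r for R3 A3
          proof -
            have "{0..<int m} \<times> {..n} \<union> {int m} \<times> {..<Suc n} = {0..<1 + int m} \<times> {..n}" by auto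
            then show ?thesis using r by (simp add: search_inv_def)
          qed
          subgoal using z_ge by simp
          subgoal using loopT by (simp add: c_def)
          done
        done
    qed
    subgoal premises p for R' A' using p D_pos by (intro Q) simp
    subgoal using z_ge by (simp add: c_def)
    subgoal using totalT T D_pos by simp
    done
qed

text \<open>\<open>Tail\<close> started at row \<open>i\<close> yields the whole column, because
  earlier rows vanish there (\<open>column_from\<close>).\<close>

lemma hruns_Direction:
  assumes R: "R 16 = D" and A: "\<And>k. k \<le> n \<Longrightarrow> \<bar>A 3 k\<bar> \<le> D" and T: "100 * (int n * (int n * z)) \<le> T"
    and Q: "\<And>R' A'. same_except {18, 19, 20, 21, 22} R R' \<Longrightarrow> (\<And>i. i < n \<Longrightarrow> A' 4 (2 + i) = column (A 3) i div D) \<Longrightarrow> Q R' A'"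
  shows "hruns Direction R A T Q"
  unfolding Direction_def
  apply (rule hruns_For[where N=n and c="90 * (int n * z)" and
     Inv="\<lambda>l R' A'. same_except {18, 19, 20, 21, 22} R R' \<and> A' 3 = A 3 \<and> (\<forall>i<l. A' 4 (2 + i) = column (A 3) i div D)"];
     (simp add: val_simps same_except_def; fail)?)
  subgoal premises p for i R1 A1
  proof -
    have R1: "R1 18 = int i" "R1 16 = D" "A1 3 = A 3" using p R by (auto simp: same_except_def)
    have sum: "(\<Sum>k\<in>{i..n}. A 3 k * h k i) = column (A 3) i" using column_from p(1) by simp
    have le: "\<bar>column (A 3) i\<bar> \<le> 2 * (int n * (D * z))"
      using tail_le[of i "A 3" D i] A p(1) D_pos by (simp add: sum)
    have q: "\<bar>column (A 3) i div D\<bar> \<le> 2 * (int n * z)"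
      by (rule abs_div_le) (use le D_pos in \<open>simp_all add: ac_simps\<close>)
    show ?thesis
      apply (rule seq_Tail[where i=i and l=i])
      using p(1) A D_le R1 apply (simp_all add: val_simps)
      subgoal for k by (rule order.trans[OF A D_le])
      subgoal premises r for R2
      proof -
        have R2: "R2 18 = int i" "R2 16 = D" "R2 20 = column (A 3) i" "same_except {18, 19, 20, 21, 22} R R2"
          using r R1 p sum by (auto simp: same_except_def)
        show ?thesis
          apply (rule seq_Divmod; simp add: val_simps R2 D_pos)
          apply (rule seq_Add; simp add: val_simps R2)
          subgoal using p(1) n_B by simp
          apply (rule seq_Add; simp add: val_simps R2)
          subgoal using p(1) n_B by simp
          apply (rule hruns_Store_array; simp add: val_simps R2)
          subgoal using p(1) by simp
          subgoal using q nz by linarith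
          subgoal using p(2) R2(4) R1(3) by (auto simp: same_except_def less_Suc_eq nat_add_distrib)
          done
      qed
      done
  qed
  subgoal premises p for R' A' using p by (intro Q) auto
  subgoal using nz by simp
  subgoal using T nz nnz by (simp add: algebra_simps)
  done

end

context simplex_program
begin

text \<open>The additional \<open>D\<close> in the denominator undoes the scaling of the
  coefficients. Registers 12 and 13, which hold 0 and 1, serve as array indices.\<close>

lemma hruns_Width:
  assumes R: "R 16 = D" "R 33 = (\<Sum>k\<le>n. y k * b k)" "0 < R 31" "R 31 \<le> 2 * dl ^ 2" "0 < R 32" "R 32 \<le> dl ^ 2"
    and T: "30 * z ^ 3 \<le> T"
    and Q: "\<And>A'. A' 4 0 = (\<Sum>k\<le>n. y k * b k) * R 31 \<Longrightarrow> A' 4 1 = R 32 * D \<Longrightarrow>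
       (\<And>i. A' 4 (2 + i) = A 4 (2 + i)) \<Longrightarrow> (\<And>R'. Q R' A')"
  shows "hruns Width R A T Q"
proof -
  let ?\<beta> = "\<Sum>k\<le>n. y k * b k"
  have "\<bar>?\<beta>\<bar> \<le> (\<Sum>k\<le>n. \<bar>y k * b k\<bar>)" by (rule sum_abs)
  also have "\<dots> \<le> (\<Sum>k\<le>n. dl * bb)"
    by (intro sum_mono abs_mult_dl_le y_abs_le rhs_le) auto
  also have "\<dots> = (int n + 1) * (dl * bb)" by simp
  also have "\<dots> \<le> (2 * int n) * (dl * bb)"
    using n_pos' dl_pos bb_nonneg by (intro mult_right_mono) auto
  also have "\<dots> = 2 * z * bb" by (simp add: z_def)
  finally have \<beta>: "\<bar>?\<beta>\<bar> \<le> 2 * z * bb" .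
  have dz: "dl ^ 2 \<le> z ^ 2" using z_ge dl_pos by (intro power_mono) auto
  have "\<bar>R 31\<bar> \<le> 2 * z ^ 2" using R dz by linarith
  then have "\<bar>?\<beta> * R 31\<bar> \<le> (2 * z * bb) * (2 * z ^ 2)" by (rule abs_mult_dl_le[OF \<beta>])
  also have "\<dots> = 4 * (z ^ 3 * bb)" by (simp add: power2_eq_square power3_eq_cube)
  finally have bP: "\<bar>?\<beta> * R 31\<bar> \<le> B"
    using bound_z(1) z_ge bb_nonneg zero_le_mult_iff[of "z ^ 3" bb] zero_le_power[of z 3] zero_le_power[of z 4] by linarith
  have "\<bar>R 32 * D\<bar> \<le> dl ^ 2 * dl"
    using R D_le D_pos by (intro abs_mult_dl_le) auto
  then have QD: "\<bar>R 32 * D\<bar> \<le> B"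
    using dl_power_B(2) dl_pos zero_le_power[of dl 3] by (simp add: power2_eq_square power3_eq_cube)
  have dz3: "dl ^ 2 \<le> z ^ 3" "dl \<le> z ^ 3" "1 \<le> z ^ 3" using dz z_powers z_ge by linarith+
  show ?thesis
    unfolding Width_def
    apply (rule seq_Const; (simp add: const_B)?)
    apply (rule seq_Smul; simp add: val_simps R)
    subgoal using bP by simp
    apply (rule seq_Store_array; simp add: val_simps)
    apply (rule seq_Const; (simp add: const_B)?)
    apply (rule seq_Smul; simp add: val_simps R)
    subgoal using QD by simp
    apply (rule hruns_Store_array; simp add: val_simps R)
    subgoal using T R D_le D_pos dz3 by linarith
    subgoal by (rule Q) (auto simp: R)
    done
qed

lemma hruns_Init:
  assumes R: "R 16 = D" "R 33 = \<beta>" "R 25 = int m" "m \<le> n" and m: "\<And>k. k \<le> n \<Longrightarrow> y k \<le> y m"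
    and A: "\<And>k. k \<le> n \<Longrightarrow> A 1 k = y k" "A 0 n = 0" "\<And>k. k \<le> n \<Longrightarrow> A 3 k = 0" and T: "5 \<le> T"
    and Q: "\<And>R' A'. search_inv \<beta> {} R' A' \<Longrightarrow> Q R' A'"
  shows "hruns Init R A T Q"
proof -
  have mm: "int m < int n + 2" "A (Suc 0) m = y m" using R(4) A(1)[OF R(4)] by auto
  have le: "D \<le> 2 * dl ^ 2" "y m \<le> dl ^ 2" using D_le dl_power_B(5,6) y_le[OF R(4)] by linarith+
  have "best D (y m) ((A 3)(m := D)) {}"
  proof -
    have "best D (y m) (\<lambda>k. if k = m then D else 0) {}" by (rule best_init) (use R m in auto)
    moreover have "column ((A 3)(m := D)) = column (\<lambda>k. if k = m then D else 0)"
      unfolding column_def using A(3) by (intro ext sum.cong) auto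
    moreover have "osc ((A 3)(m := D)) = osc (\<lambda>k. if k = m then D else 0)"
    proof -
      have "(\<lambda>k. real_of_int (((A 3)(m := D)) k) / y k) ` {..n} = (\<lambda>k. real_of_int (if k = m then D else 0) / y k) ` {..n}"
        using A(3) by (intro image_cong) auto
      then show ?thesis by (simp add: oscillation_def)
    qed
    ultimately show ?thesis by (simp add: best_def valid_def)
  qed
  then show ?thesis
    unfolding Init_def
    apply (rule_tac seq_Store_array; simp add: val_simps R mm)
    apply (rule seq_Add; simp add: val_simps R)
    subgoal using D_le D_pos dl_B by simp
    apply (rule hruns_Load_array; simp add: val_simps R mm)
    subgoal using T by simp
    subgoal using A R mm le D_pos by (intro Q) (auto simp: search_inv_def)
    done
qed

lemma hruns_Main_program:
  assumes A: "A 0 n = 0" "\<And>k. k \<le> n \<Longrightarrow> A 3 k = 0" and T: "1300 * z ^ 3 \<le> T"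
    and Q: "\<And>R' A' P q v. best P q v ({0..<D} \<times> {..n}) \<Longrightarrow> A' 4 0 = (\<Sum>k\<le>n. y k * b k) * P \<Longrightarrow> A' 4 1 = q * D \<Longrightarrow>
       (\<And>i. i < n \<Longrightarrow> A' 4 (2 + i) = column v i div D) \<Longrightarrow> Q R' A'"
  shows "hruns Main_program R A T Q"
proof -
  let ?\<beta> = "\<Sum>k\<le>n. y k * b k"
  have z3: "int n * z \<le> z ^ 3" "int n * (int n * z) \<le> z ^ 3" "1 \<le> z ^ 3" using z_powers by linarith+
  show ?thesis
    unfolding Main_program_def
    apply (rule seq_cut[where c="25 * (int n * z)" and P="\<lambda>R' A'. R' 16 = D \<and> A' = A"])
    subgoal by (rule hruns_Determinant) auto
    apply (rule seq_cut[where c="100 * (int n * (int n * z))" and P="\<lambda>R' A'. R' 16 = D \<and> (\<forall>q. q \<noteq> 1 \<longrightarrow> A' q = A q) \<and> (\<forall>k\<le>n. A' 1 k = y k)"])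
    subgoal by (rule hruns_Dependency) auto
    apply (rule seq_cut[where c="40 * (int n * z)" and P="\<lambda>R' A'. R' 16 = D \<and> R' 33 = ?\<beta> \<and> (\<forall>q. q \<noteq> 1 \<longrightarrow> A' q = A q) \<and> (\<forall>k\<le>n. A' 1 k = y k)"])
    subgoal by (rule hruns_Beta) auto
    apply (rule seq_cut[where c="40 * (int n * z)" and P="\<lambda>R' A'. R' 16 = D \<and> R' 33 = ?\<beta> \<and> (\<forall>q. q \<noteq> 1 \<longrightarrow> A' q = A q) \<and> (\<forall>k\<le>n. A' 1 k = y k) \<and>
       (\<exists>m\<le>n. R' 25 = int m \<and> (\<forall>k\<le>n. y k \<le> y m))"])
    subgoal by (rule hruns_Argmax) auto
    apply (rule seq_cut[where c="5" and P="\<lambda>R' A'. search_inv ?\<beta> {} R' A'"])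
    subgoal using A by (elim conjE exE, intro hruns_Init) auto
    apply (rule seq_cut[where c="900 * z ^ 3" and P="\<lambda>R' A'. search_inv ?\<beta> ({0..<D} \<times> {..n}) R' A'"])
    subgoal by (rule hruns_Search) auto
    subgoal premises p for R1 A1 R2 A2 R3 A3 R4 A4 R5 A5 R6 A6
    proof -
      let ?v = "A6 3"
      have s: "R6 16 = D" "R6 33 = ?\<beta>" "best (R6 31) (R6 32) ?v ({0..<D} \<times> {..n})" "R6 31 \<le> 2 * dl ^ 2" "R6 32 \<le> dl ^ 2"
        "\<forall>k\<le>n. \<bar>?v k\<bar> \<le> D"
        using p by (auto simp: search_inv_def)
      have P: "0 < R6 31" "0 < R6 32" using s(3) by (auto simp: best_def)
      show ?thesis
        apply (rule seq_cut[where c="100 * (int n * (int n * z))" and P="\<lambda>R' A'.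
           same_except {18, 19, 20, 21, 22} R6 R' \<and> (\<forall>i<n. A' 4 (2 + i) = column ?v i div D)"])
        subgoal by (rule hruns_Direction) (use s in auto)
        subgoal for R' A'
          apply (rule hruns_Width)
          using s P T z3 apply (simp_all add: same_except_def)
          subgoal premises q for A2 R2
            using Q[OF s(3), of A2 R2] q by simp
          done
        done
    qed
    done
qed

end

lemma oscillation_divide:
  assumes "0 < d"
  shows "oscillation n y (\<lambda>k. t k / d) = oscillation n y t / d"
proof -
  let ?U = "(\<lambda>k. t k / real_of_int (y k)) ` {..n}"
  have U: "finite ?U" "?U \<noteq> {}" by auto
  have e: "(\<lambda>k. t k / d / real_of_int (y k)) ` {..n} = (\<lambda>x. x / d) ` ?U"
    unfolding image_image by (intro image_cong) auto
  have "mono (\<lambda>x. x / d)" using assms by (intro monoI divide_right_mono) auto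
  then show ?thesis
    unfolding oscillation_def e mono_Max_commute[OF _ U, symmetric] mono_Min_commute[OF _ U, symmetric]
    by (simp add: mono_Max_commute[OF _ U, symmetric] mono_Min_commute[OF _ U, symmetric] diff_divide_distrib)
qed

context hnf_simplex
begin

sublocale rows: dependent_rows n "\<lambda>k i. H $$ (k, i)" y D
proof
qed (fact n_pos upper_zero diagonal_pos y_pos sum_y_rows y_n D_eq left_solution)+

lemma width_along_column:
  assumes v: "rows.valid v" and c: "c \<in> carrier_vec n" "\<And>i. i < n \<Longrightarrow> D * c $ i = rows.column v i"
  shows "width_along (polyhedron H b) c = \<beta> * (rows.osc v / D)"
proof -
  have "real_of_int (c $ i) = (\<Sum>k\<le>n. real_of_int (v k) / D * h k i)" if "i < n" for i
  proof -
    have "real_of_int D * c $ i = real_of_int (rows.column v i)"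
      unfolding c(2)[OF that, symmetric] by simp
    then have "real_of_int (c $ i) = real_of_int (rows.column v i) / D"
      using D_pos by (simp add: field_simps)
    then show ?thesis by (simp add: rows.column_def sum_divide_distrib)
  qed
  from width_along_eq[OF c(1) this] show ?thesis
    using D_pos by (simp add: oscillation_divide)
qed

lemma best_flat_direction:
  assumes best: "rows.best P q v ({0..<D} \<times> {..n})"
  shows "lattice_width n (polyhedron H b) = real_of_int (\<beta> * P) / real_of_int (q * D)"
    and "flat_direction n (polyhedron H b) (vec n (\<lambda>i. rows.column v i div D))"
proof -
  define c0 where "c0 = vec n (\<lambda>i. rows.column v i div D)"
  have v: "rows.valid v" "rows.osc v = P / q" "0 < P" "0 < q" using best by (auto simp: rows.best_def)
  have c0: "c0 \<in> carrier_vec n" "\<And>i. i < n \<Longrightarrow> D * c0 $ i = rows.column v i"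
    using v(1) by (auto simp: c0_def rows.valid_def)
  have w0: "width_along (polyhedron H b) c0 = \<beta> * (P / q / D)"
    using width_along_column[OF v(1) c0] v(2) by simp
  have "0 < rows.osc v" using v by simp
  then obtain i where i: "i < n" "rows.column v i \<noteq> 0" using rows.column_nonzero by blast
  then have "c0 $ i \<noteq> 0" using c0(2)[OF i(1)] by auto
  then have "c0 \<noteq> 0\<^sub>v n" using i(1) by auto
  then have nz: "c0 \<in> nonzero_int_vecs n" using c0(1) by (simp add: nonzero_int_vecs_def)
  have "\<beta> * (P / q / D) \<le> width_along (polyhedron H b) c" if c: "c \<in> nonzero_int_vecs n" for c
  proof -
    have c': "c \<in> carrier_vec n" "c \<noteq> 0\<^sub>v n" using c by (auto simp: nonzero_int_vecs_def)
    obtain \<tau> where \<tau>: "\<forall>i<n. (\<Sum>k<n. \<tau> k * h k i) = D * c $ i"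
      using left_solution[of "\<lambda>i. c $ i"] by blast
    \<comment> \<open>Only the first \<open>n\<close> rows are combined; the coefficient 0 of the
      last row is the normalisation that \<open>best_optimal\<close> expects.\<close>
    define u where "u k = (if k < n then \<tau> k else 0)" for k
    have col: "D * c $ i = rows.column u i" if "i < n" for i
      using \<tau> that by (simp add: rows.column_def u_def lessThan_Suc_atMost[symmetric])
    have u: "rows.valid u" unfolding rows.valid_def
    proof (intro allI impI)
      fix i assume "i < n"
      then show "D dvd rows.column u i" by (simp flip: col)
    qed
    have "\<exists>k\<le>n. u k \<noteq> 0"
    proof (rule ccontr)
      assume "\<not> (\<exists>k\<le>n. u k \<noteq> 0)"
      then have "D * c $ i = 0" if "i < n" for i
        using col[OF that] by (simp add: rows.column_def)
      then have "c = 0\<^sub>v n" using c'(1) D_pos by (intro eq_vecI) auto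
      then show False using c'(2) by simp
    qed
    then obtain k where "k \<le> n" "u k \<noteq> 0" by blast
    then have "P / q \<le> rows.osc u"
      using rows.best_optimal[OF best u] by (simp add: u_def)
    then have "\<beta> * (P / q / D) \<le> \<beta> * (rows.osc u / D)"
      using beta_nonneg D_pos by (intro mult_left_mono divide_right_mono) auto
    then show ?thesis using width_along_column[OF u c'(1) col] by simp
  qed
  then have lw: "lattice_width n (polyhedron H b) = \<beta> * (P / q / D)"
    unfolding lattice_width_def using nz w0 by (intro cInf_eq_minimum) force+
  then show "lattice_width n (polyhedron H b) = real_of_int (\<beta> * P) / real_of_int (q * D)" by simp
  show "flat_direction n (polyhedron H b) (vec n (\<lambda>i. rows.column v i div D))"
    using nz w0 lw unfolding flat_direction_def c0_def by simp
qed

end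

section \<open>Input and output\<close>

text \<open>The input occupies an initial segment of the memory, and addresses in a program are constants.
  For \<open>n > 40\<close> the registers 2 to 40 are zeros of the first row of the matrix and thus free; for each
  smaller \<open>n\<close> a straight-line program moves the input to address 2000. The case \<open>n = 1\<close> is recognised
  without any free register: register 2 is zero if \<open>n \<ge> 2\<close> and the negative entry \<open>H\<^sub>1\<^sub>0\<close> if \<open>n = 1\<close>.\<close>

primrec Copies :: "nat \<Rightarrow> program" where
  "Copies 0 = Skip"
| "Copies (Suc k) = Seq (Copies k) (Seq (Const (2000 + k) 0) (Add (2000 + k) (2000 + k) (Suc k)))"

definition Small :: "nat \<Rightarrow> program" where
  "Small k = Seq (Copies ((k + 1) ^ 2)) (Seq (Const 14 (int k)) (Const 5 2000))"

definition Large :: program where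
  "Large = Seq (Const 12 0) (Seq (Add 14 0 12) (Const 5 1))"

primrec Dispatch :: "nat \<Rightarrow> nat \<Rightarrow> program" where
  "Dispatch 0 k = Large"
| "Dispatch (Suc f) k = Seq (Const 2 (int k)) (Seq (Sub 2 0 2) (IfPos 2 (Dispatch f (Suc k)) (Small k)))"

definition Bases :: program where
  "Bases = Seq (Const 12 0) (Seq (Const 13 1) (Seq (Add 15 14 13) (Seq (Add 6 5 12) (Seq (Smul 6 14 15)
     (Seq (Add 7 6 15) (Seq (Add 8 7 15) (Seq (Add 8 8 13) (Seq (Add 9 8 15) (Seq (Add 9 9 13)
     (Seq (Add 10 9 15) (Seq (Add 10 10 13) (Seq (Add 11 10 15) (Add 11 11 13)))))))))))))"

definition Setup :: program where
  "Setup = Seq (Add 0 0 2) (Seq (IfPos 0 (Dispatch 39 2) (Small 1)) Bases)"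

text \<open>The zeros behind the data later provide initialised arrays.\<close>

definition relocated :: "nat \<Rightarrow> nat \<Rightarrow> (nat \<Rightarrow> nat \<Rightarrow> int) \<Rightarrow> (nat \<Rightarrow> int) \<Rightarrow> memory \<Rightarrow> bool" where
  "relocated n hb h b m \<longleftrightarrow>
     (\<forall>k i. k \<le> n \<and> i \<le> k \<and> i < n \<longrightarrow> m (hb + k * n + i) = h k i) \<and>
     (\<forall>k\<le>n. m (hb + n * (n + 1) + k) = b k) \<and>
     (\<forall>a. hb + n * (n + 1) + (n + 1) \<le> a \<longrightarrow> m a = 0)"

text \<open>There is no move instruction and no register known to be 0, so each target is cleared
  and then added to. All sources lie below 2000 and hence outside the targets.\<close>

lemma runs_Copies:
  assumes "k < 1990" "Q (\<lambda>a. if 2000 \<le> a \<and> a < 2000 + k then m (a - 1999) else m a)" "1 + 2 * int k \<le> T" "0 \<le> B"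
  shows "runs B (Copies k) m T Q"
  using assms
proof (induction k arbitrary: T Q)
  case 0
  have "(\<lambda>a. if 2000 \<le> a \<and> a < 2000 + 0 then m (a - 1999) else m a) = m" by auto
  then show ?case using 0 by (simp add: runs_Skip)
next
  case (Suc k)
  show ?case
    unfolding Copies.simps
  proof (rule runs_bounded, rule runs_Seq[where c="1 + 2 * int k"], rule Suc.IH)
    assume bd: "bounded_memory B m"
    define m1 where "m1 = (\<lambda>a. if 2000 \<le> a \<and> a < 2000 + k then m (a - 1999) else m a)"
    have eq: "m1(2000 + k := m (Suc k)) = (\<lambda>a. if 2000 \<le> a \<and> a < 2000 + Suc k then m (a - 1999) else m a)"
      by (auto simp: m1_def fun_eq_iff)
    have v: "m1 (Suc k) = m (Suc k)" using Suc.prems by (simp add: m1_def)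
    have "\<bar>m (Suc k)\<bar> \<le> B" using bd by (simp add: bounded_memory_def)
    then have "runs B (Seq (Const (2000 + k) 0) (Add (2000 + k) (2000 + k) (Suc k))) m1 2 Q"
      using Suc.prems v by (intro runs_Seq[where c=1, OF runs_Const] runs_Add) (auto simp: eq)
    then show "runs B (Seq (Const (2000 + k) 0) (Add (2000 + k) (2000 + k) (Suc k)))
        (\<lambda>a. if 2000 \<le> a \<and> a < 2000 + k then m (a - 1999) else m a) (T - (1 + 2 * int k)) Q"
      unfolding m1_def by (rule runs_mono) (use Suc.prems in auto)
  qed (use Suc.prems in auto)
qed

lemma runs_Small:
  assumes m: "\<And>k i. k \<le> n \<Longrightarrow> i \<le> k \<Longrightarrow> i < n \<Longrightarrow> m (1 + k * n + i) = h k i"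
    "\<And>k. k \<le> n \<Longrightarrow> m (1 + n * (n + 1) + k) = b k"
    "\<And>a. 1 + n * (n + 1) + (n + 1) \<le> a \<Longrightarrow> m a = 0"
    and n: "1 \<le> n" "n \<le> 40" and B: "2000 \<le> B" and T: "4000 \<le> T"
    and Q: "\<And>m'. m' 14 = int n \<Longrightarrow> m' 5 = 2000 \<Longrightarrow> relocated n 2000 h b m' \<Longrightarrow> Q m'"
  shows "runs B (Small n) m T Q"
proof -
  \<comment> \<open>Behind the dimension the input has \<open>(n + 1) ^ 2\<close> words, at most
    1681 here, so it ends before address 2000.\<close>
  have n2: "(n + 1) ^ 2 \<le> 41 ^ 2" using n by (intro power_mono) auto
  have e: "n * (n + 1) + (n + 1) = (n + 1) ^ 2" by (simp add: power2_eq_square)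
  define m1 where "m1 = (\<lambda>a. if 2000 \<le> a \<and> a < 2000 + (n + 1) ^ 2 then m (a - 1999) else m a)"
  have "relocated n 2000 h b (m1(14 := int n, 5 := 2000))"
    unfolding relocated_def
  proof (intro conjI allI impI)
    fix k i assume ki: "k \<le> n \<and> i \<le> k \<and> i < n"
    then have "k * n + i < n * n + n" by (intro add_le_less_mono mult_right_mono) auto
    then have "k * n + i < (n + 1) ^ 2" using e by (simp add: algebra_simps)
    moreover have "2000 + k * n + i - 1999 = 1 + k * n + i" by simp
    ultimately show "(m1(14 := int n, 5 := 2000)) (2000 + k * n + i) = h k i"
      using m(1)[of k i] ki by (simp add: m1_def)
  next
    fix k assume k: "k \<le> n"
    then have "n * (n + 1) + k < (n + 1) ^ 2" using e by linarith
    moreover have "2000 + n * (n + 1) + k - 1999 = 1 + n * (n + 1) + k" by simp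
    ultimately show "(m1(14 := int n, 5 := 2000)) (2000 + n * (n + 1) + k) = b k"
      using m(2)[OF k] by (simp add: m1_def add.assoc)
  next
    fix a assume "2000 + n * (n + 1) + (n + 1) \<le> a"
    then have "2000 + (n + 1) ^ 2 \<le> a" using e by linarith
    moreover have "m a = 0" using calculation e by (intro m(3)) linarith
    ultimately show "(m1(14 := int n, 5 := 2000)) a = 0" by (simp add: m1_def)
  qed
  then have q: "Q (m1(14 := int n, 5 := 2000))" by (intro Q) auto
  show ?thesis
    unfolding Small_def
  proof (rule runs_Seq[where c="1 + 2 * int ((n + 1) ^ 2)"], rule runs_Copies)
    have "int ((n + 1) ^ 2) \<le> int 1681" unfolding of_nat_le_iff using n2 by simp
    then have "3 \<le> T - (1 + 2 * int ((n + 1) ^ 2))" using T by linarith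
    then have "runs B (Seq (Const 14 (int n)) (Const 5 2000)) m1 (T - (1 + 2 * int ((n + 1) ^ 2))) Q"
      using q B n by (intro runs_Seq[where c=1, OF runs_Const] runs_Const) auto
    then show "runs B (Seq (Const 14 (int n)) (Const 5 2000))
       (\<lambda>a. if 2000 \<le> a \<and> a < 2000 + (n + 1)\<^sup>2 then m (a - 1999) else m a) (T - (1 + 2 * int ((n + 1) ^ 2))) Q"
      unfolding m1_def .
  qed (use n2 B in auto)
qed

text \<open>\<open>n\<close> is compared with \<open>k\<close>, \<open>k + 1\<close> and so on by
  subtraction in register 2, the only one written; hence the branches must work for every value
  \<open>v\<close> there.\<close>

lemma runs_Dispatch:
  assumes "m 0 = int n" "k \<le> n" "int (k + f) \<le> B" "int n \<le> B" "4000 + 3 * int f \<le> T"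
    "\<And>v. n < k + f \<Longrightarrow> runs B (Small n) (m(2 := v)) 4000 Q"
    "\<And>v. k + f \<le> n \<Longrightarrow> runs B Large (m(2 := v)) 4000 Q"
    "m 2 = 0"
  shows "runs B (Dispatch f k) m T Q"
proof -
  have "runs B (Dispatch f k) (m(2 := v)) T Q" for v
    using assms(1-7)
  proof (induction f arbitrary: k T v)
    case 0
    have "runs B Large (m(2 := v)) 4000 Q" by (rule 0(7)) (use 0(2) in simp)
    then show ?case unfolding Dispatch.simps by (rule runs_mono) (use 0 in auto)
  next
    case (Suc f)
    have "runs B (IfPos 2 (Dispatch f (Suc k)) (Small k)) (m(2 := int n - int k)) (T - 2) Q"
    proof (rule runs_IfPos)
      assume "0 < (m(2 := int n - int k)) 2"
      then show "runs B (Dispatch f (Suc k)) (m(2 := int n - int k)) (T - 2 - 1) Q"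
        using Suc.prems by (intro Suc.IH) auto
    next
      assume "(m(2 := int n - int k)) 2 \<le> 0"
      then have "n = k" using Suc.prems(2) by simp
      have "runs B (Small n) (m(2 := int n - int k)) 4000 Q"
        by (rule Suc.prems(6)) (use \<open>n = k\<close> in simp)
      then have "runs B (Small k) (m(2 := int n - int k)) 4000 Q" unfolding \<open>n = k\<close> .
      then show "runs B (Small k) (m(2 := int n - int k)) (T - 2 - 1) Q"
        by (rule runs_mono) (use Suc.prems(5) in auto)
    qed
    then have "runs B (IfPos 2 (Dispatch f (Suc k)) (Small k))
        ((m(2 := int k))(2 := (m(2 := int k)) 0 - (m(2 := int k)) 2)) (T - 1 - 1) Q"
      using Suc.prems(1) by simp
    then have "runs B (Seq (Sub 2 0 2) (IfPos 2 (Dispatch f (Suc k)) (Small k))) (m(2 := int k)) (T - 1) Q"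
      using Suc.prems(1-4) by (intro runs_Seq[where c=1, OF runs_Sub]) simp_all
    then have "runs B (Seq (Sub 2 0 2) (IfPos 2 (Dispatch f (Suc k)) (Small k))) ((m(2 := v))(2 := int k)) (T - 1) Q"
      unfolding fun_upd_upd .
    note run = this
    show ?case unfolding Dispatch.simps
    proof (rule runs_Seq[where c=1], rule runs_Const)
      show "runs B (Seq (Sub 2 0 2) (IfPos 2 (Dispatch f (Suc k)) (Small k))) ((m(2 := v))(2 := int k)) (T - 1) Q"
        by (rule run)
    qed (use Suc.prems(3) in simp_all)
  qed
  from this[of 0] show ?thesis using assms(8) by (metis fun_upd_triv)
qed

lemma runs_Large:
  assumes m: "\<And>k i. k \<le> n \<Longrightarrow> i \<le> k \<Longrightarrow> i < n \<Longrightarrow> m (1 + k * n + i) = h k i"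
    "\<And>k. k \<le> n \<Longrightarrow> m (1 + n * (n + 1) + k) = b k"
    "\<And>a. 1 + n * (n + 1) + (n + 1) \<le> a \<Longrightarrow> m a = 0"
    and m0: "m 0 = int n" and n: "40 < n" and B: "int n \<le> B" and T: "3 \<le> T"
    and Q: "\<And>m'. m' 14 = int n \<Longrightarrow> m' 5 = 1 \<Longrightarrow> relocated n 1 h b m' \<Longrightarrow> Q m'"
  shows "runs B Large m T Q"
proof -
  have addr: "1 + k * n + i \<notin> {5, 12, 14}" if "k \<le> n" "i \<le> k" "i < n" for k i
  proof (cases "k = 0")
    case False
    then have "1 * n \<le> k * n" by (intro mult_right_mono) auto
    then have "40 < 1 + k * n + i" using n by linarith
    then show ?thesis by auto
  qed (use that in auto)
  have n1: "40 < 1 + n * (n + 1)" using n mult_le_mono2[of 1 "n + 1" n] by linarith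
  have "relocated n 1 h b (m(12 := 0, 14 := int n, 5 := 1))"
    unfolding relocated_def using m addr n1 by auto
  then have "Q (m(12 := 0, 14 := int n, 5 := 1))" by (intro Q) auto
  then show ?thesis unfolding Large_def using m0 n B T
    by (intro runs_Seq[where c=1, OF runs_Const] runs_Seq[where c=1, OF runs_Add] runs_Const) auto
qed

section \<open>Positions of the data in the encoded instance\<close>

lemma nth_concat_equal_length:
  assumes "\<And>xs. xs \<in> set xss \<Longrightarrow> length xs = n" "k < length xss" "i < n"
  shows "concat xss ! (k * n + i) = xss ! k ! i"
  using assms
proof (induction xss arbitrary: k)
  case (Cons xs xss)
  then show ?case by (cases k) (auto simp: nth_append)
qed simp

lemma length_concat_equal_length:
  "(\<And>xs. xs \<in> set xss \<Longrightarrow> length xs = n) \<Longrightarrow> length (concat xss) = length xss * n"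
  by (induction xss) auto

lemma input_memory_encode:
  assumes H: "H \<in> carrier_mat (n + 1) n" and b: "b \<in> carrier_vec (n + 1)"
  defines "m \<equiv> input_memory (encode_instance H b)"
  shows "m 0 = int n" "\<And>k i. k \<le> n \<Longrightarrow> i < n \<Longrightarrow> m (1 + k * n + i) = H $$ (k, i)"
    "\<And>k. k \<le> n \<Longrightarrow> m (1 + n * (n + 1) + k) = b $ k"
    "\<And>a. 1 + n * (n + 1) + (n + 1) \<le> a \<Longrightarrow> m a = 0"
proof -
  define xss where "xss = map list_of_vec (rows H)"
  have len: "length xss = n + 1" and each: "\<And>xs. xs \<in> set xss \<Longrightarrow> length xs = n"
    using H by (auto simp: xss_def rows_def)
  have lc: "length (concat xss) = n * (n + 1)"
    using length_concat_equal_length[OF each] len by (simp add: mult.commute)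
  have m: "m = input_memory (int n # concat xss @ list_of_vec b)"
    using H by (simp add: m_def encode_instance_def xss_def)
  have lb: "length (list_of_vec b) = n + 1" using b by simp
  show "m 0 = int n" by (simp add: m input_memory_def)
  show "m (1 + k * n + i) = H $$ (k, i)" if "k \<le> n" "i < n" for k i
  proof -
    have lt: "k * n + i < n * (n + 1)"
    proof -
      have "k * n + i < n * n + n" using that by (intro add_le_less_mono mult_right_mono) auto
      then show ?thesis by simp
    qed
    have "concat xss ! (k * n + i) = xss ! k ! i"
      by (rule nth_concat_equal_length) (use each len that in auto)
    also have "\<dots> = H $$ (k, i)" using H that by (simp add: xss_def)
    finally have "(concat xss @ list_of_vec b) ! (k * n + i) = H $$ (k, i)"
      using lt lc by (simp only: nth_append if_True)
    then show ?thesis using lt lc lb by (simp add: m input_memory_def)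
  qed
  show "m (1 + n * (n + 1) + k) = b $ k" if "k \<le> n" for k
  proof -
    have "(concat xss @ list_of_vec b) ! (n * (n + 1) + k) = list_of_vec b ! k"
      unfolding lc[symmetric] by (rule nth_append_length_plus)
    also have "\<dots> = b $ k" using b that by (simp add: list_of_vec_index)
    finally have "(int n # concat xss @ list_of_vec b) ! (1 + n * (n + 1) + k) = b $ k"
      by (simp only: add_Suc nth_Cons_Suc plus_1_eq_Suc)
    moreover have "1 + n * (n + 1) + k < length (int n # concat xss @ list_of_vec b)"
      using lc lb that by simp
    ultimately show ?thesis unfolding m input_memory_def by simp
  qed
  show "m a = 0" if "1 + n * (n + 1) + (n + 1) \<le> a" for a
    using that lc lb by (simp add: m input_memory_def)
qed

text \<open>The two possible places of the instance: copied to 2000, or left at 1 if there are more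
  than 40 columns.\<close>

definition separated :: "nat \<Rightarrow> nat \<Rightarrow> bool" where
  "separated n hb \<longleftrightarrow> hb = 2000 \<or> hb = 1 \<and> 40 < n"

lemma separated_addresses:
  assumes "separated n hb"
  shows "1 \<le> hb" "\<And>k i. k \<le> n \<Longrightarrow> i \<le> k \<Longrightarrow> i < n \<Longrightarrow> hb + k * n + i \<notin> {2..40}" "40 < hb + n * (n + 1)"
proof -
  show "1 \<le> hb" using assms by (auto simp: separated_def)
  show "hb + k * n + i \<notin> {2..40}" if "k \<le> n" "i \<le> k" "i < n" for k i
  proof (cases "hb = 2000 \<or> k = 0")
    case False
    then have "40 < n" "1 * n \<le> k * n" using assms by (auto simp: separated_def)
    then have "40 < hb + k * n + i" by linarith
    then show ?thesis by auto
  qed (use that assms in \<open>auto simp: separated_def\<close>)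
  show "40 < hb + n * (n + 1)"
  proof (cases "hb = 2000")
    case False
    then have "40 < n" using assms by (auto simp: separated_def)
    moreover have "n * 1 \<le> n * (n + 1)" by (rule mult_le_mono2) simp
    ultimately show ?thesis by linarith
  qed simp
qed

lemma relocated_register:
  assumes "relocated n hb h b m" "separated n hb" "r \<in> {2..40}"
  shows "relocated n hb h b (m(r := v))"
proof -
  have 1: "hb + k * n + i \<noteq> r" if "k \<le> n" "i \<le> k" "i < n" for k i
    using separated_addresses(2)[OF assms(2) that] assms(3) by auto
  have 2: "hb + n * (n + 1) + k \<noteq> r" "hb + n * (n + 1) + (n + 1) \<le> r \<Longrightarrow> False" for k
    using separated_addresses(3)[OF assms(2)] assms(3) by auto
  show ?thesis
    using assms(1) 1 2 unfolding relocated_def by (auto simp: fun_upd_def)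
qed

definition prepared :: "nat \<Rightarrow> nat \<Rightarrow> (nat \<Rightarrow> nat \<Rightarrow> int) \<Rightarrow> (nat \<Rightarrow> int) \<Rightarrow> memory \<Rightarrow> bool" where
  "prepared n hb h b m \<longleftrightarrow> relocated n hb h b m \<and> separated n hb \<and>
     m 12 = 0 \<and> m 13 = 1 \<and> m 14 = int n \<and> m 15 = int n + 1 \<and> m 5 = int hb \<and> m 6 = int (hb + n * (n + 1)) \<and>
     (\<forall>q<5. m (7 + q) = int (hb + n * (n + 1) + (n + 1) + q * (n + 2)))"

lemma runs_Bases:
  assumes rel: "relocated n hb h b m" and sep: "separated n hb" and m: "m 14 = int n" "m 5 = int hb"
    and B: "int (hb + n * (n + 1) + (n + 1) + 5 * (n + 2)) \<le> B" and T: "30 + 3 * int n \<le> T"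
    and Q: "\<And>m'. prepared n hb h b m' \<Longrightarrow> Q m'"
  shows "runs B Bases m T Q"
proof -
  define e where "e = int hb + int n * (int n + 1)"
  have eB: "e + (int n + 1) + 5 * (int n + 2) \<le> B" and e0: "0 \<le> int n" "0 \<le> e" "int hb \<le> e" "int n * (int n + 1) \<le> e"
    using B by (simp_all add: e_def algebra_simps)
  have B0: "11 + 6 * int n + e \<le> B" using eB by (simp add: algebra_simps)
  then have B1: "1 \<le> B" "0 \<le> B" using e0(1,2) by auto
  have ee: "int hb + int n * (int n + 1) = e" by (simp add: e_def)
  note st = runs_Seq[where c=1]
  let ?b = "e + (int n + 1)"
  let ?m = "((((((((((m(12 := 0))(13 := 1))(15 := int n + 1))(6 := e))(7 := ?b))(8 := ?b + (int n + 2)))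
      (9 := ?b + 2 * (int n + 2)))(10 := ?b + 3 * (int n + 2)))(11 := ?b + 4 * (int n + 2))))"
  have "relocated n hb h b (?m(3 := v))" for v
    by (intro relocated_register rel sep) auto
  moreover have "\<forall>q<5. (?m(3 := v)) (7 + q) = int (hb + n * (n + 1) + (n + 1) + q * (n + 2))" for v
  proof (intro allI impI)
    fix q :: nat assume "q < 5"
    then consider "q = 0" | "q = 1" | "q = 2" | "q = 3" | "q = 4" by linarith
    then show "(?m(3 := v)) (7 + q) = int (hb + n * (n + 1) + (n + 1) + q * (n + 2))"
      by cases (simp_all add: e_def algebra_simps)
  qed
  ultimately have prep: "prepared n hb h b (?m(3 := v))" for v
    unfolding prepared_def using sep m by (simp add: e_def algebra_simps)
  \<comment> \<open>\<open>Smul\<close> writes register 3 in the middle of the sequence, with an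
    unspecified final value; the updates are reordered so that \<open>prep\<close> applies.\<close>
  have Qm: "Q (m(12 := 0, 13 := 1, 15 := int n + 1, 6 := e, 3 := v, 7 := ?b, 8 := ?b + (int n + 2),
      9 := ?b + 2 * (int n + 2), 10 := ?b + 3 * (int n + 2), 11 := ?b + 4 * (int n + 2)))" for v
  proof -
    have "m(12 := 0, 13 := 1, 15 := int n + 1, 6 := e, 3 := v, 7 := ?b, 8 := ?b + (int n + 2),
      9 := ?b + 2 * (int n + 2), 10 := ?b + 3 * (int n + 2), 11 := ?b + 4 * (int n + 2)) = ?m(3 := v)"
      by (auto simp: fun_eq_iff)
    then show ?thesis using Q[OF prep[of v]] by simp
  qed
  show ?thesis
    unfolding Bases_def
    apply (rule st, rule runs_Const; (simp add: m B1)?)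
    apply (rule st, rule runs_Const; (simp add: m B1)?)
    apply (rule st, rule runs_Add; (simp add: m)?)
    subgoal using B0 e0(1-3) by linarith
    apply (rule st, rule runs_Add; (simp add: m)?)
    subgoal using B0 e0(1-3) by linarith
    apply (rule runs_Seq[where c="4 + 3 * (int n + 1)"], rule runs_Smul; (simp add: m)?)
    subgoal using B0 e0(1-3) ee by simp
    apply (unfold ee)
    subgoal for v
      apply (rule st, rule runs_Add; simp?)
      subgoal using B0 e0(1-3) by linarith
      apply (rule st, rule runs_Add; simp?)
      subgoal using B0 e0(1-3) by linarith
      apply (rule st, rule runs_Add; simp?)
      subgoal using B0 e0(1-3) by linarith
      apply (rule st, rule runs_Add; simp?)
      subgoal using B0 e0(1-3) by linarith
      apply (rule st, rule runs_Add; simp?)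
      subgoal using B0 e0(1-3) by linarith
      apply (rule st, rule runs_Add; simp?)
      subgoal using B0 e0(1-3) by linarith
      apply (rule st, rule runs_Add; simp?)
      subgoal using B0 e0(1-3) by linarith
      apply (rule st, rule runs_Add; simp?)
      subgoal using B0 e0(1-3) by linarith
      apply (rule runs_Add; simp?)
      subgoal using B0 e0(1-3) by linarith
      subgoal by (rule back_subst[of Q, OF Qm[of v]]) (auto simp: fun_eq_iff algebra_simps)
      subgoal using T by linarith
      done
    done
qed

text \<open>The last registers to be written have to hold their own source addresses, hence \<open>Load k k\<close>.\<close>

primrec Increments :: "nat \<Rightarrow> program" where
  "Increments 0 = Skip"
| "Increments (Suc k) = Seq (Increments k) (Add (3 + k) (2 + k) 1)"

primrec Loads :: "nat \<Rightarrow> program" where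
  "Loads 0 = Skip"
| "Loads (Suc k) = Seq (Loads k) (Load k k)"

definition Low_output :: program where
  "Low_output = Seq (Add 0 11 12) (Seq (Const 1 1) (Seq (Add 2 0 1) (Seq (Add 2 2 1)
     (Seq (Increments 38) (Seq (Add 1 0 1) (Loads 41))))))"

definition Output :: program where
  "Output = Seq (Const 16 41) (Seq (Add 17 15 13) (Seq (Sub 17 17 16)
     (Seq (WhilePos 17 (Seq (Add 2 11 16) (Seq (Load 3 2) (Seq (Store 16 3) (Seq (Add 16 16 13)
       (Sub 17 17 13)))))) Low_output)))"

section \<open>Delivery of the result to the low registers\<close>

lemma runs_Increments:
  assumes "m 1 = 1" "0 \<le> m 2" "m 2 + int k \<le> B"
    "Q (\<lambda>a. if 3 \<le> a \<and> a < 3 + k then m 2 + (int a - 2) else m a)" "1 + int k \<le> T"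
  shows "runs B (Increments k) m T Q"
  using assms
proof (induction k arbitrary: T Q)
  case 0
  have "(\<lambda>a. if 3 \<le> a \<and> a < 3 + 0 then m 2 + (int a - 2) else m a) = m" by auto
  then show ?case using 0 by (simp add: runs_Skip)
next
  case (Suc k)
  define m1 where "m1 = (\<lambda>a. if 3 \<le> a \<and> a < 3 + k then m 2 + (int a - 2) else m a)"
  have v: "m1 (2 + k) + m1 1 = m 2 + int (Suc k)" using Suc.prems(1) by (cases k) (auto simp: m1_def numeral_2_eq_2)
  have eq: "m1(3 + k := m 2 + int (Suc k)) = (\<lambda>a. if 3 \<le> a \<and> a < 3 + Suc k then m 2 + (int a - 2) else m a)"
    by (auto simp: m1_def fun_eq_iff)
  have "runs B (Add (3 + k) (2 + k) 1) m1 (T - (1 + int k)) Q"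
  proof (rule runs_Add)
    show "\<bar>m1 (2 + k) + m1 1\<bar> \<le> B" unfolding v using Suc.prems(2,3) by simp
    show "Q (m1(3 + k := m1 (2 + k) + m1 1))" unfolding v eq by (rule Suc.prems(4))
  qed (use Suc.prems(5) in simp)
  then show ?case
    unfolding Increments.simps m1_def using Suc.prems
    by (intro runs_Seq[where c="1 + int k"] Suc.IH) auto
qed

text \<open>All source addresses are at least \<open>k\<close>, so no load destroys the source of a
  later one.\<close>

lemma runs_Loads:
  assumes "\<And>r. r < k \<Longrightarrow> k \<le> nat (m r)"
    "Q (\<lambda>a. if a < k then m (nat (m a)) else m a)" "1 + int k \<le> T"
  shows "runs B (Loads k) m T Q"
proof -
  have "runs B (Loads l) m (1 + int l) Q'" if "l \<le> k" "Q' (\<lambda>a. if a < l then m (nat (m a)) else m a)" for l Q'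
    using that
  proof (induction l arbitrary: Q')
    case 0
    have "(\<lambda>a. if a < 0 then m (nat (m a)) else m a) = m" by auto
    then show ?case using 0 by (simp add: runs_Skip)
  next
    case (Suc l)
    define m1 where "m1 = (\<lambda>a. if a < l then m (nat (m a)) else m a)"
    have "k \<le> nat (m l)" using assms(1) Suc.prems(1) by simp
    then have eq: "m1(l := m1 (nat (m1 l))) = (\<lambda>a. if a < Suc l then m (nat (m a)) else m a)"
      using Suc.prems(1) by (auto simp: m1_def fun_eq_iff less_Suc_eq)
    have "runs B (Load l l) m1 (1 + int (Suc l) - (1 + int l)) Q'"
      by (rule runs_Load) (use Suc.prems in \<open>simp_all add: eq\<close>)
    then show ?case unfolding Loads.simps m1_def using Suc.prems(1)
      by (intro runs_Seq[where c="1 + int l"] Suc.IH) auto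
  qed
  from this[of k Q] show ?thesis using assms(2,3) by (auto intro: runs_mono)
qed

text \<open>Register 1 holds the increment 1 while the chain of addresses is built and receives its
  own address last, from register 0.\<close>

lemma runs_Low_output:
  assumes m: "m 11 = int ab" "m 12 = 0" and ab: "41 \<le> ab" "int ab + 41 \<le> B" and T: "100 \<le> T"
    and Q: "\<And>m'. (\<And>r. r < 41 \<Longrightarrow> m' r = m (ab + r)) \<Longrightarrow> (\<And>r. 41 \<le> r \<Longrightarrow> m' r = m r) \<Longrightarrow> Q m'"
  shows "runs B Low_output m T Q"
proof -
  let ?ab = "int ab"
  let ?m = "(((m(0 := ?ab))(1 := 1))(2 := ?ab + 1))(2 := ?ab + 2)"
  define m2 where "m2 = (\<lambda>a. if 3 \<le> a \<and> a < 3 + 38 then ?m 2 + (int a - 2) else ?m a)"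
  define m3 where "m3 = m2(1 := ?ab + 1)"
  have m3: "m3 r = (if r < 41 then int (ab + r) else m r)" for r
  proof -
    consider "r = 0" | "r = 1" | "r = 2" | "3 \<le> r" "r < 41" | "41 \<le> r" by linarith
    then show ?thesis by cases (auto simp: m3_def m2_def)
  qed
  have "runs B (Loads 41) m3 42 Q"
  proof (rule runs_Loads)
    show "41 \<le> nat (m3 r)" if "r < 41" for r using that ab m3[of r] by simp
    show "Q (\<lambda>a. if a < 41 then m3 (nat (m3 a)) else m3 a)"
      using ab by (intro Q) (auto simp: m3 nat_int_add)
  qed simp
  moreover have "m3 = m2(1 := m2 0 + m2 1)" by (simp add: m3_def m2_def)
  ultimately have "runs B (Seq (Add 1 0 1) (Loads 41)) m2 43 Q"
    using ab by (intro runs_Seq[where c=1, OF runs_Add]) (auto simp: m2_def)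
  then have "runs B (Seq (Increments 38) (Seq (Add 1 0 1) (Loads 41))) ?m 82 Q"
    unfolding m2_def using ab by (intro runs_Seq[where c=39, OF runs_Increments]) auto
  then have "runs B Low_output m 86 Q"
    unfolding Low_output_def using m ab
    by (intro runs_Seq[where c=1, OF runs_Add] runs_Seq[where c=1, OF runs_Const])
      (simp_all add: add.commute[of 2])
  then show ?thesis by (rule runs_mono) (use T in auto)
qed

text \<open>The copying loop occupies registers below 41, so it fills only those from 41 on, and
  straight-line code then fills the low ones. By \<open>n + 2 \<le> ab\<close> the targets of the
  loop end before the sources begin.\<close>

lemma runs_Output:
  assumes m: "m 11 = int ab" "m 12 = 0" "m 13 = 1" "m 15 = int n + 1"
    and ab: "41 \<le> ab" "n + 2 \<le> ab" "int ab + int n + 45 \<le> B" and T: "200 + 6 * int n \<le> T"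
    and Q: "\<And>m'. (\<And>r. r < n + 2 \<Longrightarrow> m' r = m (ab + r)) \<Longrightarrow> Q m'"
  shows "runs B Output m T Q"
proof -
  define Inv where "Inv k m' \<longleftrightarrow> (\<exists>l. int l + int k = max 0 (int n + 2 - 41) \<and> m' 16 = 41 + int l \<and>
    m' 17 = int n + 2 - 41 - int l \<and> m' 11 = int ab \<and> m' 12 = 0 \<and> m' 13 = 1 \<and>
    (\<forall>a\<ge>41. m' a = (if a < 41 + l then m (ab + a) else m a)))" for k m'
  let ?body = "Seq (Add 2 11 16) (Seq (Load 3 2) (Seq (Store 16 3) (Seq (Add 16 16 13) (Sub 17 17 13))))"
  let ?N = "nat (int n + 2 - 41)"
  have loop: "runs B (WhilePos 17 ?body) m1 (1 + 6 * int ?N) (\<lambda>m'. runs B Low_output m' 100 Q)"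
    if "Inv ?N m1" for m1
  proof (rule runs_While[of Inv ?N _ _ _ _ 5])
    fix k m' assume "Inv k m'" and pos: "0 < m' 17"
    then obtain l where l: "int l + int k = max 0 (int n + 2 - 41)" "m' 16 = 41 + int l"
      "m' 17 = int n + 2 - 41 - int l" "m' 11 = int ab" "m' 12 = 0" "m' 13 = 1"
      "\<And>a. 41 \<le> a \<Longrightarrow> m' a = (if a < 41 + l then m (ab + a) else m a)" unfolding Inv_def by blast
    have ln: "41 + l < n + 2" and k: "0 < k" using pos l by auto
    have ld: "m' (ab + (41 + l)) = m (ab + (41 + l))" using l(7)[of "ab + (41 + l)"] ab by simp
    have na: "nat (int ab + (41 + int l)) = ab + (41 + l)" "nat (41 + int l) = 41 + l" by simp_all
    define m5 where "m5 = m'(2 := int ab + (41 + int l), 3 := m (ab + (41 + l)), 41 + l := m (ab + (41 + l)),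
       16 := 42 + int l, 17 := int n + 2 - 41 - int l - 1)"
    have "Inv (k - 1) m5" unfolding Inv_def
    proof (intro exI[of _ "Suc l"] conjI allI impI)
      fix a :: nat assume "41 \<le> a"
      then show "m5 a = (if a < 41 + Suc l then m (ab + a) else m a)"
        using l(7)[of a] by (cases "a = 41 + l") (auto simp: m5_def)
    qed (use l k in \<open>auto simp: m5_def\<close>)
    then have "runs B ?body m' 5 (Inv (k - 1))"
      apply (rule_tac runs_Seq[where c=1, OF runs_Add])
      subgoal using l ln ab by simp
      apply (rule_tac runs_Seq[where c=1, OF runs_Load])
      apply (rule_tac runs_Seq[where c=1, OF runs_Store])
      apply (rule_tac runs_Seq[where c=1, OF runs_Add])
      subgoal using l ln ab by (simp add: na)
      apply (rule_tac runs_Sub)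
      subgoal using l ln ab by (simp add: na)
      using l ab by (simp_all add: na m5_def ld fun_upd_twist)
    then show "0 < k \<and> runs B ?body m' 5 (Inv (k - 1))" using k by simp
  next
    fix k m' assume "Inv k m'" and neg: "m' 17 \<le> 0"
    then obtain l where l: "int l + int k = max 0 (int n + 2 - 41)" "m' 16 = 41 + int l"
      "m' 17 = int n + 2 - 41 - int l" "m' 11 = int ab" "m' 12 = 0" "m' 13 = 1"
      "\<And>a. 41 \<le> a \<Longrightarrow> m' a = (if a < 41 + l then m (ab + a) else m a)" unfolding Inv_def by blast
    have ln: "n + 2 \<le> 41 + l" "41 + l \<le> max 41 (n + 2)" using l neg by auto
    show "runs B Low_output m' 100 Q"
    proof (rule runs_Low_output[where ab=ab])
      fix m3 assume m3: "\<And>r. r < 41 \<Longrightarrow> m3 r = m' (ab + r)" "\<And>r. 41 \<le> r \<Longrightarrow> m3 r = m' r"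
      show "Q m3"
      proof (rule Q)
        fix r assume r: "r < n + 2"
        show "m3 r = m (ab + r)"
        proof (cases "r < 41")
          case True
          then show ?thesis using m3(1) l(7)[of "ab + r"] ab ln by auto
        next
          case False
          then show ?thesis using m3(2)[of r] l(7)[of r] ln r by auto
        qed
      qed
    qed (use l ab in auto)
  qed (use that in auto)
  have "Inv ?N (m(16 := 41, 17 := int n + 2 - 41))"
    unfolding Inv_def using m by (intro exI[of _ 0]) auto
  from loop[OF this] have "runs B (Seq (WhilePos 17 ?body) Low_output) (m(16 := 41, 17 := int n + 2 - 41)) (101 + 6 * int ?N) Q"
    by (intro runs_Seq[where c="1 + 6 * int ?N"]) simp
  then have "runs B Output m (104 + 6 * int ?N) Q"
    unfolding Output_def using m ab
    by (intro runs_Seq[where c=1, OF runs_Const] runs_Seq[where c=1, OF runs_Add] runs_Seq[where c=1, OF runs_Sub])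
      simp_all
  then show ?thesis by (rule runs_mono) (use T in auto)
qed

section \<open>Correctness and complexity\<close>

definition Width_program :: program where
  "Width_program = Seq Setup (Seq Main_program Output)"

context hnf_simplex
begin

section \<open>Word length and running time\<close>

definition "zz = int n * Delta H"

definition "rhs_bound = int n * zz * Delta_aug H b"

text \<open>\<open>zz ^ 3 * rhs_bound\<close> is the same product without the constant; the size of
  the constant makes room for the addresses around 2000.\<close>

definition "word_bound = 10000 * (zz ^ 4 * (int n * Delta_aug H b))"

lemma Delta_aug_pos: "1 \<le> Delta_aug H b"
  using Delta_le_Delta_aug[of n] y_pos[of n] by simp

lemma zz_ge: "1 \<le> zz" "int n \<le> zz" "1 \<le> int n * Delta_aug H b" "Delta_aug H b \<le> int n * Delta_aug H b"
  using n_pos Delta_pos(1) Delta_aug_pos mult_mono[of 1 "int n" 1 "Delta H"] mult_left_mono[of 1 "Delta H" "int n"]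
    mult_mono[of 1 "int n" 1 "Delta_aug H b"] mult_right_mono[of 1 "int n" "Delta_aug H b"]
  by (auto simp: zz_def)

lemma word_bound_ge: "10 * zz ^ 4 + 10 * zz ^ 3 * rhs_bound \<le> word_bound" "9000 * zz ^ 2 \<le> word_bound" "rhs_bound \<le> word_bound"
proof -
  let ?w = "zz ^ 4 * (int n * Delta_aug H b)"
  have p: "zz \<le> zz ^ 4" "zz ^ 2 \<le> zz ^ 4" "1 \<le> zz ^ 4"
    using zz_ge(1) power_increasing[of 1 4 zz] power_increasing[of 2 4 zz] by auto
  have 1: "zz ^ 4 * 1 \<le> ?w" using zz_ge p by (intro mult_left_mono) auto
  have "zz ^ 3 * rhs_bound = ?w" by (simp add: rhs_bound_def power4_eq_xxxx power3_eq_cube)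
  then show "10 * zz ^ 4 + 10 * zz ^ 3 * rhs_bound \<le> word_bound"
    using 1 p unfolding word_bound_def by linarith
  show "9000 * zz ^ 2 \<le> word_bound" using 1 p unfolding word_bound_def by linarith
  have "rhs_bound = zz * (int n * Delta_aug H b)" by (simp add: rhs_bound_def)
  also have "\<dots> \<le> ?w" using zz_ge p by (intro mult_right_mono) auto
  also have "\<dots> \<le> word_bound" using 1 p unfolding word_bound_def by linarith
  finally show "rhs_bound \<le> word_bound" .
qed

lemma address_bound:
  assumes "hb \<le> 2000"
  shows "int (hb + n * (n + 1) + (n + 1) + 5 * (n + 2)) + 50 \<le> word_bound"
proof -
  have "int n * int n \<le> zz * zz" using zz_ge by (intro mult_mono) auto
  moreover have "zz * 1 \<le> zz * zz" "1 * 1 \<le> zz * zz" using zz_ge mult_mono[of 1 zz 1 zz] mult_left_mono[of 1 zz zz] by auto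
  moreover have "9000 * (zz * zz) \<le> word_bound" using word_bound_ge(2) by (simp add: power2_eq_square)
  moreover have "int (hb + n * (n + 1) + (n + 1) + 5 * (n + 2)) = int hb + int n * int n + 7 * int n + 11"
    by (simp add: algebra_simps)
  ultimately show ?thesis using assms zz_ge by linarith
qed

lemma program_locale:
  assumes "separated n hb"
  shows "simplex_program n hb (\<lambda>k i. H $$ (k, i)) (\<lambda>k. b $ k) y D word_bound (Delta H) rhs_bound"
proof unfold_locales
  have hb: "hb \<le> 2000" using assms by (auto simp: separated_def)
  show "int (hb + n * (n + 1) + (n + 1) + 5 * (n + 2)) \<le> word_bound" using address_bound[OF hb] by simp
  show "\<bar>h k i\<bar> \<le> int n * Delta H" if "k \<le> n" "i < n" for k i using row_le[OF that] .
  show "\<bar>b $ k\<bar> \<le> rhs_bound" if "k \<le> n" for k using rhs_le[OF that] by (simp add: rhs_bound_def zz_def)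
  show "10 * (int n * Delta H) ^ 4 + 10 * (int n * Delta H) ^ 3 * rhs_bound \<le> word_bound"
    using word_bound_ge(1) by (simp add: zz_def)
qed (use separated_addresses[OF assms] y_le_Delta in auto)

lemma runs_Main_Output:
  assumes prep: "prepared n hb (\<lambda>k i. H $$ (k, i)) (\<lambda>k. b $ k) m" and T: "1600 * zz ^ 3 \<le> T"
  shows "runs word_bound (Seq Main_program Output) m T (width_output n (polyhedron H b))"
proof -
  have sep: "separated n hb" using prep by (simp add: prepared_def)
  interpret sp: simplex_program n hb "\<lambda>k i. H $$ (k, i)" "\<lambda>k. b $ k" y D word_bound "Delta H" rhs_bound
    by (rule program_locale[OF sep])
  have hb: "hb \<le> 2000" using sep by (auto simp: separated_def)
  have z: "sp.z = zz" by (simp add: sp.z_def zz_def)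
  \<comment> \<open>The memory itself serves as initial valuation, and the arrays are 0 because they
    lie behind the data.\<close>
  have "sp.rep m (\<lambda>_ _. 0) m"
  proof -
    have "m (sp.array_base q + k) = 0" for q k
      using prep unfolding prepared_def relocated_def sp.array_base_def by simp
    then show ?thesis
      using prep unfolding sp.rep_def prepared_def relocated_def sp.val_def sp.array_base_def by simp
  qed
  moreover have "sp.hruns Main_program m (\<lambda>_ _. 0) (1300 * zz ^ 3) (\<lambda>R' A'. \<exists>P q v.
      rows.best P q v ({0..<D} \<times> {..n}) \<and> A' 4 0 = \<beta> * P \<and> A' 4 1 = q * D \<and>
      (\<forall>i<n. A' 4 (2 + i) = rows.column v i div D))"
    by (rule sp.hruns_Main_program) (auto simp: z \<beta>_def)
  ultimately have main: "runs word_bound Main_program m (1300 * zz ^ 3) (\<lambda>m'. \<exists>R' A'. sp.rep R' A' m' \<and> (\<exists>P q v.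
      rows.best P q v ({0..<D} \<times> {..n}) \<and> A' 4 0 = \<beta> * P \<and> A' 4 1 = q * D \<and>
      (\<forall>i<n. A' 4 (2 + i) = rows.column v i div D)))"
    unfolding sp.hruns_def by blast
  show ?thesis
  proof (rule runs_Seq[OF runs_mono[OF main order.refl]], elim exE conjE)
    fix m' R' A' P q v
    assume rep: "sp.rep R' A' m'" and best: "rows.best P q v ({0..<D} \<times> {..n})"
      and A': "A' 4 0 = \<beta> * P" "A' 4 1 = q * D" "\<forall>i<n. A' 4 (2 + i) = rows.column v i div D"
    show "runs word_bound Output m' (T - 1300 * zz ^ 3) (width_output n (polyhedron H b))"
    proof (rule runs_Output[where ab="sp.array_base 4"])
      show "m' 11 = int (sp.array_base 4)" using sp.repD(4)[OF rep, of 4] by simp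
      show "m' 12 = 0" "m' 13 = 1" using sp.rep_constants[OF rep] by auto
      show "m' 15 = int n + 1" using sp.repD(1)[OF rep, of 15] by (simp add: sp.val_def)
      show "41 \<le> sp.array_base 4" using sp.array_base_gt[of 4 0] sp.rhs_address by linarith
      show "n + 2 \<le> sp.array_base 4" using sp.hb_pos by (simp add: sp.array_base_def)
      show "int (sp.array_base 4) + int n + 45 \<le> word_bound"
        using address_bound[OF hb] by (simp add: sp.array_base_def)
      have "int n \<le> zz ^ 3" "1 \<le> zz ^ 3" using zz_ge power_increasing[of 1 3 zz] by auto
      then show "200 + 6 * int n \<le> T - 1300 * zz ^ 3" using T by linarith
      fix m'' assume "\<And>r. r < n + 2 \<Longrightarrow> m'' r = m' (sp.array_base 4 + r)"
      then have out: "m'' r = A' 4 r" if "r < n + 2" for r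
        using sp.repD(7)[OF rep, of 4 r] that by simp
      have "vec n (\<lambda>i. m'' (2 + i)) = vec n (\<lambda>i. rows.column v i div D)"
        using A'(3) out by (intro eq_vecI) auto
      moreover have "0 < q" using best by (simp add: rows.best_def)
      ultimately show "width_output n (polyhedron H b) m''"
        unfolding width_output_def
        using best_flat_direction[OF best] out[of 0] out[of 1] A' D_pos by simp
    qed
  qed
qed

lemma runs_Setup:
  defines "m \<equiv> input_memory (encode_instance H b)"
  shows "runs word_bound Setup m (4300 + 3 * int n) (\<lambda>m'. \<exists>hb. prepared n hb (\<lambda>k i. H $$ (k, i)) (\<lambda>k. b $ k) m')"
    (is "runs _ _ _ _ ?Q")
proof -
  note im = input_memory_encode[OF H b, folded m_def]
  let ?h = "\<lambda>k i. H $$ (k, i)" and ?b = "\<lambda>k. b $ k"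
  have wB: "9000 + zz \<le> word_bound" "int n \<le> word_bound"
  proof -
    have "zz ^ 2 \<ge> 1" "zz ^ 2 \<ge> zz" using zz_ge(1) self_le_power[of zz 2] by auto
    moreover have "9000 * zz ^ 4 \<le> word_bound"
      unfolding word_bound_def using zz_ge mult_left_mono[OF zz_ge(3), of "zz ^ 4"] zero_le_power[of zz 4] by linarith
    moreover have "zz ^ 4 \<ge> zz" using zz_ge(1) self_le_power[of zz 4] by auto
    ultimately show "int n \<le> word_bound" using word_bound_ge(2) zz_ge by linarith
    have "9000 * zz ^ 2 + 1000 * (zz ^ 4 * 1) \<le> word_bound"
    proof -
      have "zz ^ 2 \<le> zz ^ 4" using zz_ge(1) by (intro power_increasing) auto
      moreover have "zz ^ 4 * 1 \<le> zz ^ 4 * (int n * Delta_aug H b)" using zz_ge by (intro mult_left_mono) auto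
      ultimately show ?thesis unfolding word_bound_def using zero_le_power[of zz 4] zz_ge(1) by linarith
    qed
    then show "9000 + zz \<le> word_bound" using \<open>zz ^ 2 \<ge> 1\<close> \<open>zz ^ 4 \<ge> zz\<close> zz_ge(1) by linarith
  qed
  have bases: "runs word_bound Bases m' (30 + 3 * int n) ?Q"
    if "relocated n hb ?h ?b m'" "separated n hb" "m' 14 = int n" "m' 5 = int hb" for hb m'
  proof (rule runs_Bases[OF that])
    show "int (hb + n * (n + 1) + (n + 1) + 5 * (n + 2)) \<le> word_bound"
      using address_bound[of hb] that(2) by (auto simp: separated_def)
  qed auto
  let ?P = "\<lambda>m'. \<exists>hb. relocated n hb ?h ?b m' \<and> separated n hb \<and> m' 14 = int n \<and> m' 5 = int hb"
  have small: "runs word_bound (Small n) m' 4000 ?P"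
    if "\<And>k i. k \<le> n \<Longrightarrow> i \<le> k \<Longrightarrow> i < n \<Longrightarrow> m' (1 + k * n + i) = h k i"
      "\<And>k. k \<le> n \<Longrightarrow> m' (1 + n * (n + 1) + k) = b $ k"
      "\<And>a. 1 + n * (n + 1) + (n + 1) \<le> a \<Longrightarrow> m' a = 0" "n \<le> 40" for m'
  proof (rule runs_Small[OF that(1-3) n_pos that(4)])
    fix m'' assume "m'' 14 = int n" "m'' 5 = 2000" "relocated n 2000 ?h ?b m''"
    then show "?P m''" by (intro exI[of _ 2000]) (auto simp: separated_def)
  qed (use wB zz_ge in auto)
  have sel: "runs word_bound (IfPos 0 (Dispatch 39 2) (Small 1)) (m(0 := m 0 + m 2)) 4200 ?P \<and> \<bar>m 0 + m 2\<bar> \<le> word_bound"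
  proof (cases "n = 1")
    case True
    have m2: "m 2 = h 1 0" using im(2)[of 1 0] True by (simp add: numeral_2_eq_2)
    \<comment> \<open>With only two terms the dependency makes \<open>h 1 0\<close> negative, so the
      tested value \<open>1 + h 1 0\<close> is not positive.\<close>
    have "y 0 * h 0 0 + y 1 * h 1 0 = 0"
      using sum_y_rows[of 0] True by (simp add: atMost_Suc)
    moreover have "0 < y 0 * h 0 0" using y_pos[of 0] diagonal_pos[of 0] True by simp
    ultimately have "y 1 * h 1 0 < 0" by linarith
    then have neg: "h 1 0 < 0" using y_pos[of 1] True by (simp add: mult_less_0_iff)
    have "\<bar>h 1 0\<bar> \<le> zz" unfolding zz_def using row_le[of 1 0] True by simp
    moreover have "m 0 + m 2 \<le> 0" using im(1) m2 neg True by simp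
    moreover have "runs word_bound (Small n) (m(0 := m 0 + m 2)) 4000 ?P"
      by (rule small) (use im True in auto)
    ultimately show ?thesis
      using im(1) m2 True wB by (auto intro!: runs_IfPos intro: runs_mono)
  next
    case False
    then have n2: "2 \<le> n" using n_pos by simp
    have m2: "m 2 = 0" using im(2)[of 0 1] upper_zero[of 0 1] n2 by (simp add: numeral_2_eq_2)
    \<comment> \<open>Register 2 holds the entry in row 0 and column 1, above the diagonal, so the
      dispatcher may overwrite it.\<close>
    have addr: "1 + k * n + i \<noteq> 2" if "i \<le> k" for k i
    proof (cases "k = 0")
      case False
      then have "1 * n \<le> k * n" by (intro mult_right_mono) auto
      then show ?thesis using n2 by linarith
    qed (use that in simp)
    have "n * 1 \<le> n * (n + 1)" by (rule mult_le_mono2) simp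
    then have addr': "2 < 1 + n * (n + 1)" using n2 by linarith
    have entries: "(m(2 := v)) (1 + k * n + i) = h k i" if "k \<le> n" "i \<le> k" "i < n" for k i v
      using im(2)[of k i] addr[of i k] that by simp
    have rhs: "(m(2 := v)) (1 + n * (n + 1) + k) = b $ k" if "k \<le> n" for k v
      using im(3)[OF that] addr' by simp
    have zero: "(m(2 := v)) a = 0" if "1 + n * (n + 1) + (n + 1) \<le> a" for a v
      using im(4)[OF that] addr' that by simp
    have "runs word_bound (Dispatch 39 2) m 4150 ?P"
    proof (rule runs_Dispatch[where n=n])
      show "runs word_bound (Small n) (m(2 := v)) 4000 ?P" if "n < 2 + 39" for v
        by (rule small) (use entries rhs zero that in auto)
      show "runs word_bound Large (m(2 := v)) 4000 ?P" if "2 + 39 \<le> n" for v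
      proof (rule runs_Large[OF entries rhs zero])
        fix m'' assume "m'' 14 = int n" "m'' 5 = 1" "relocated n 1 ?h ?b m''"
        then show "?P m''" using that by (intro exI[of _ 1]) (auto simp: separated_def)
      qed (use im(1) that wB in auto)
    qed (use im(1) n2 wB m2 zz_ge in auto)
    moreover have "m(0 := m 0 + m 2) = m" using m2 by (simp add: fun_eq_iff)
    ultimately show ?thesis
      using im(1) m2 n2 wB by (auto intro!: runs_IfPos intro: runs_mono)
  qed
  have "runs word_bound (Seq (IfPos 0 (Dispatch 39 2) (Small 1)) Bases) (m(0 := m 0 + m 2)) (4299 + 3 * int n) ?Q"
    by (rule runs_Seq[OF runs_mono[OF conjunct1[OF sel] order.refl]])
      (elim exE conjE, rule runs_mono[OF bases], auto)
  then show ?thesis unfolding Setup_def using sel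
    by (intro runs_Seq[where c=1, OF runs_Add]) auto
qed

lemma runs_Width_program:
  "runs word_bound Width_program (input_memory (encode_instance H b)) (6000 * zz ^ 3) (width_output n (polyhedron H b))"
  unfolding Width_program_def
proof (rule runs_Seq[OF runs_mono[OF runs_Setup order.refl]], elim exE)
  fix m' hb assume "prepared n hb (\<lambda>k i. H $$ (k, i)) (\<lambda>k. b $ k) m'"
  then show "runs word_bound (Seq Main_program Output) m' (6000 * zz ^ 3 - (4300 + 3 * int n)) (width_output n (polyhedron H b))"
  proof (rule runs_Main_Output)
    have "int n \<le> zz ^ 3" "1 \<le> zz ^ 3" using zz_ge self_le_power[of zz 3] by auto
    then show "1600 * zz ^ 3 \<le> 6000 * zz ^ 3 - (4300 + 3 * int n)" by linarith
  qed
qed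

lemma bounded_input: "bounded_memory word_bound (input_memory (encode_instance H b))"
  unfolding bounded_memory_def
proof
  fix a
  define m where "m = input_memory (encode_instance H b)"
  note im = input_memory_encode[OF H b, folded m_def]
  have wB: "zz \<le> word_bound" "0 \<le> word_bound"
    using word_bound_ge(2) zz_ge(1) self_le_power[of zz 2] by auto
  consider "a = 0" | "1 \<le> a" "a < 1 + n * (n + 1)" | "1 + n * (n + 1) \<le> a" "a < 1 + n * (n + 1) + (n + 1)"
    | "1 + n * (n + 1) + (n + 1) \<le> a" by linarith
  then have "\<bar>m a\<bar> \<le> word_bound"
  proof cases
    case 1
    then show ?thesis using im(1) zz_ge wB by simp
  next
    case 2
    define k i where "k = (a - 1) div n" and "i = (a - 1) mod n"
    have a: "a = 1 + k * n + i" using 2 by (simp add: k_def i_def)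
    have "a - 1 < (n + 1) * n" using 2 by (simp add: mult.commute)
    then have "k < n + 1" unfolding k_def by (rule less_mult_imp_div_less)
    moreover have "i < n" using n_pos by (simp add: i_def)
    ultimately have "\<bar>m a\<bar> \<le> zz" using im(2)[of k i] row_le[of k i] a by (simp add: zz_def)
    then show ?thesis using wB by simp
  next
    case 3
    then obtain k where k: "a = 1 + n * (n + 1) + k" "k \<le> n"
      using that[of "a - (1 + n * (n + 1))"] by (metis add_diff_inverse_nat add_less_cancel_left less_Suc_eq_le linorder_not_le Suc_eq_plus1)
    then have "\<bar>m a\<bar> \<le> rhs_bound" using im(3)[OF k(2)] rhs_le[OF k(2)] by (simp add: rhs_bound_def zz_def)
    then show ?thesis using word_bound_ge(3) by simp
  next
    case 4
    then show ?thesis using im(4)[OF 4] wB by simp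
  qed
  then show "\<bar>input_memory (encode_instance H b) a\<bar> \<le> word_bound" by (simp add: m_def)
qed

text \<open>The word length is a sum of logarithms. Those of \<open>n\<close> and of
  \<open>Delta_aug H b\<close> are replaced by the numbers themselves, and only that of
  \<open>Delta H\<close> is kept; since the three resulting factors are at least 1, each summand is
  at most a constant times their product \<open>r\<close>.\<close>

lemma word_cost_le: "word_cost word_bound \<le> 50 * (real n * max 1 (log 2 (Delta H)) * Delta_aug H b)"
proof -
  define L where "L = max 1 (log 2 (Delta H))"
  define r where "r = real n * L * Delta_aug H b"
  have n1: "1 \<le> real n" using n_pos by simp
  have a1: "1 \<le> real_of_int (Delta_aug H b)" using Delta_aug_pos by simp
  have L1: "1 \<le> L" "log 2 (Delta H) \<le> L" by (auto simp: L_def)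
  have d1: "1 \<le> real_of_int (Delta H)" using Delta_pos by simp
  have nL: "1 \<le> real n * L" "real n \<le> real n * L" "L \<le> real n * L"
    using n1 L1 mult_mono[of 1 "real n" 1 L] mult_left_mono[of 1 L "real n"] mult_right_mono[of 1 "real n" L] by auto
  have r: "1 \<le> r" "real n \<le> r" "L \<le> r" "real_of_int (Delta_aug H b) \<le> r"
    using nL a1 mult_left_mono[of 1 "real_of_int (Delta_aug H b)" "real n * L"]
      mult_right_mono[of 1 "real n * L" "real_of_int (Delta_aug H b)"] by (auto simp: r_def)
  have B: "real_of_int word_bound = 10000 * ((real n * Delta H) ^ 4 * (real n * Delta_aug H b))"
    by (simp add: word_bound_def zz_def)
  have log_le: "log 2 (real k) \<le> real k" if "1 \<le> k" for k :: nat
    using log2_of_power_le[of k k] that less_exp[of k] by simp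
  define a where "a = nat (Delta_aug H b)"
  have a: "1 \<le> a" "real_of_int (Delta_aug H b) = real a" using Delta_aug_pos by (auto simp: a_def)
  have "log 2 (real_of_int word_bound) =
      log 2 10000 + 4 * (log 2 n + log 2 (Delta H)) + (log 2 n + log 2 (Delta_aug H b))"
    unfolding B using n1 a1 d1 by (simp add: log_mult log_nat_power)
  \<comment> \<open>14 is an upper bound for \<open>log 2 10000\<close>; each other logarithm is at
    most \<open>r\<close>.\<close>
  also have "\<dots> \<le> 14 + 4 * (r + r) + (r + r)"
  proof -
    have "log 2 10000 \<le> (14 :: real)" by (simp add: log_le_iff)
    moreover have "log 2 n \<le> r" using log_le[OF n_pos] r by linarith
    moreover have "log 2 (Delta_aug H b) \<le> r" using log_le[OF a(1)] r unfolding a(2) by linarith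
    moreover have "log 2 (Delta H) \<le> r" using L1 r by linarith
    ultimately show ?thesis by (intro add_mono mult_left_mono) simp_all
  qed
  also have "14 + 4 * (r + r) + (r + r) \<le> 24 * r" using r(1) by simp
  finally have lg: "log 2 (real_of_int word_bound) \<le> 24 * r" .
  have Bpos: "0 < word_bound" using word_bound_ge(2) zz_ge(1) zero_less_power[of zz 2] by linarith
  have "real (log_cost word_bound) \<le> 25 * r"
  proof -
    have "real (nat (bitlen word_bound)) \<le> log 2 (real_of_int word_bound) + 1"
      using Bpos bitlen_nonneg[of word_bound] by (simp add: bitlen_alt_def)
    then show ?thesis using lg r Bpos by (simp add: log_cost_def bit_size_def)
  qed
  then have "word_cost word_bound \<le> 50 * r" by (simp add: word_cost_def)
  then show ?thesis unfolding r_def L_def .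
qed

lemma Width_program_correct:
  shows "\<exists>t m. exec Width_program (input_memory (encode_instance H b)) t m \<and> width_output n (polyhedron H b) m \<and>
    real t \<le> 300000 * (max 1 (log 2 (Delta H)) * real n ^ 4 * real_of_int (Delta H) ^ 3 * real_of_int (Delta_aug H b))"
proof -
  obtain t m where tm: "exec Width_program (input_memory (encode_instance H b)) t m"
    "int t \<le> 6000 * zz ^ 3 * word_cost word_bound" "width_output n (polyhedron H b) m"
    using runs_Width_program bounded_input unfolding runs_def by blast
  have "real t = real_of_int (int t)" by simp
  also have "\<dots> \<le> real_of_int (6000 * zz ^ 3 * word_cost word_bound)" using tm(2) by (simp only: of_int_le_iff)
  also have "\<dots> = 6000 * real_of_int zz ^ 3 * word_cost word_bound" by simp
  also have "\<dots> \<le> 6000 * real_of_int zz ^ 3 * (50 * (real n * max 1 (log 2 (Delta H)) * Delta_aug H b))"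
    using zz_ge(1) by (intro mult_left_mono word_cost_le) auto
  \<comment> \<open>\<open>zz ^ 3\<close> contributes \<open>n ^ 3\<close>, and the word length the
    fourth factor \<open>n\<close>.\<close>
  also have "\<dots> = 300000 * (max 1 (log 2 (Delta H)) * real n ^ 4 * real_of_int (Delta H) ^ 3 * real_of_int (Delta_aug H b))"
    by (simp add: zz_def power_mult_distrib power4_eq_xxxx power3_eq_cube)
  finally show ?thesis using tm by blast
qed

end

theorem theorem4:
  fixes M :: program
  assumes "multiplication_program M"
  shows "\<exists>(A :: program) (C :: real). \<forall>(n :: nat) (H :: int mat) (b :: int vec).
    n \<ge> 1 \<and> H \<in> carrier_mat (n + 1) n \<and> int_rank H = n \<and> reduced_hnf H \<and>
    b \<in> carrier_vec (n + 1) \<and> is_simplex n (polyhedron H b) \<longrightarrow>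
    (\<exists>t m. exec A (input_memory (encode_instance H b)) t m \<and>
       width_output n (polyhedron H b) m \<and>
       real t \<le> C * (max 1 (log 2 (Delta H)) * real n ^ 5 * real_of_int (Delta H) ^ 3 *
         real_of_int (Delta_aug H b) *
         real (mult_time M (nat \<lceil>real n ^ 3 * log 2 (Delta_aug H b) + real n ^ 3 * log 2 n\<rceil>))))"
proof (rule exI[of _ Width_program], rule exI[of _ 300000], intro allI impI, elim conjE)
  fix n :: nat and H :: "int mat" and b :: "int vec"
  assume "n \<ge> 1" "H \<in> carrier_mat (n + 1) n" "int_rank H = n" "reduced_hnf H"
    "b \<in> carrier_vec (n + 1)" "is_simplex n (polyhedron H b)"
  then interpret hnf_simplex n H b by (simp add: hnf_simplex_def)
  let ?mt = "real (mult_time M (nat \<lceil>real n ^ 3 * log 2 (Delta_aug H b) + real n ^ 3 * log 2 n\<rceil>))"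
  define c where "c = max 1 (log 2 (Delta H)) * real n ^ 4 * real_of_int (Delta H) ^ 3 * real_of_int (Delta_aug H b)"
  obtain t m where tm: "exec Width_program (input_memory (encode_instance H b)) t m"
    "width_output n (polyhedron H b) m" "real t \<le> 300000 * c"
    using Width_program_correct unfolding c_def by blast
  have c: "0 \<le> c" using Delta_pos Delta_aug_pos by (simp add: c_def)
  \<comment> \<open>From \<open>n ^ 4\<close> to the stated bound there is a factor \<open>n\<close>
    times the multiplication time, both at least 1.\<close>
  have "1 * 1 \<le> real n * ?mt" using mult_time_ge_1[OF assms] n_pos by (intro mult_mono) auto
  then have "c * 1 \<le> c * (real n * ?mt)" using c by (intro mult_left_mono) auto
  then have "real t \<le> 300000 * (c * (real n * ?mt))" using tm(3) by linarith
  also have "c * (real n * ?mt) = max 1 (log 2 (Delta H)) * real n ^ 5 * real_of_int (Delta H) ^ 3 *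
      real_of_int (Delta_aug H b) * ?mt"
    unfolding c_def by (simp add: eval_nat_numeral)
  finally show "\<exists>t m. exec Width_program (input_memory (encode_instance H b)) t m \<and> width_output n (polyhedron H b) m \<and>
     real t \<le> 300000 * (max 1 (log 2 (Delta H)) * real n ^ 5 * real_of_int (Delta H) ^ 3 *
         real_of_int (Delta_aug H b) * ?mt)"
    using tm by blast
qed

end
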